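(* Let $K:\mathbb{R}_+^3\to[0,\infty)$ be measurable with $K(x,y,z)=K(y,x,z)$ for all $x,y,z$ and $K(x,y,z)=0$ whenever $z>x$. Let $\varphi\in Y_{0,2}^+$ and assume $K(x,y,z)\le\check x^2\check y^2\varphi(z)$ for all $x,y,z\ge0$, and that for $x\ge0$ (and $y,z\ge 0$) the second derivative of $K$ in its first variable satisfies $\partial_1^2K(\cdot,y,z)(x)\le\check y^{2}\varphi(z)$. Then for any $c_0\in Y_{0,2}^+$ with $c_0\not\equiv0$ there exists a weak solution $c$ of (CGEDG) in $Y_{0,2}^+$ (i.e. with parameters $(\beta,r)=(0,2)$) with initial datum $c_0$ on $[0,T_0)$, where $$T_0:=\Bigl(2\|\varphi\|_{0,2}\bigl(M_0(c_0)+M_2(c_0)\bigr)\Bigr)^{-1}.$$ Moreover, it preserves the first moment: $M_1(c_t)=M_1(c_0)$ for all $t\in[0,T_0)$.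
   Context: Notation: $\mathbb{R}_+=[0,\infty)$, $\check x=\max(1,x)$, $M_r(c)=\int_0^\infty x^rc(x)\,dx$. For $\beta,r\in\mathbb{R}$, $Y_{-\beta,r}=\{c\in L^1(\mathbb{R}_+):\|c\|_{-\beta,r}:=\int_0^\infty(x^{-\beta}+x^r)|c(x)|\,dx<\infty\}$, and $Y_{-\beta,r}^+$ is its cone of nonnegative elements; in particular $\|c\|_{0,2}=\int_0^\infty(1+x^2)|c(x)|\,dx$. $Y_0=L^1(\mathbb{R}_+)$. If $\|\varphi\|_{0,2}=0$, $T_0$ is read as $+\infty$. Weak solution of the continuous generalized exchange-driven growth equation (CGEDG) with kernel $K$: let $T\in(0,\infty]$ and $c_0\in Y_{-\beta,r}^+$. A weak solution on $[0,T)$ with initial datum $c_0$ and parameters $(\beta,r)$ is a map $c:[0,T)\to Y_{-\beta,r}^+$, $t\mapsto c_t$, such that, with $\kappa[c_s](x,y,z):=K(x,y,z)c_s(x)c_s(y)$: (a) $c\in C([0,T),Y_0)\cap L^\infty([0,T),Y_{-\beta,r})$; (b) for all $t\in[0,T)$, $\int_0^t\int_0^\infty\int_0^\infty\int_0^\infty\kappa[c_s](x,y,z)\,dx\,dy\,dz\,ds<\infty$; (c) for all $t\in[0,T)$ and all $f\in L^\infty(\mathbb{R}_+)$, $\int_0^\infty f(x)[c_t(x)-c_0(x)]\,dx=\int_0^t\iiint_D(\Delta_zf)(x)\,\kappa[c_s](x,y,z)\,dz\,dx\,dy\,ds$, where $D=\{(x,y,z)\in\mathbb{R}_+^3:x\ge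 z,\ y\ge z\}$ and $(\Delta_zf)(x)=f(x+z)-2f(x)+f(x-z)$. *)

theory Defs
  imports "HOL-Analysis.Analysis"
begin

text \<open>
  Elements of \<open>L\<^sup>1(\<real>\<^sub>+)\<close> and \<open>L\<^sup>\<infinity>(\<real>\<^sub>+)\<close> are represented by Lebesgue measurable functions
  \<open>real \<Rightarrow> real\<close>, of which only the restriction to \<open>\<real>\<^sub>+\<close> matters and which are only
  relevant up to null sets.  Since \<open>0 powr a = 0\<close>, the weights \<open>x powr a\<close> may differ from
  the usual \<open>x\<^sup>a\<close> at \<open>x = 0\<close> (e.g. for \<open>a = 0\<close>), which is a null set.
\<close>

abbreviation half_line :: "real set" ("\<real>\<^sub>+") where
  "\<real>\<^sub>+ \<equiv> {0..}"

definition moment :: "real \<Rightarrow> (real \<Rightarrow> real) \<Rightarrow> real" where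
  "moment r c = (LINT x|lebesgue_on \<real>\<^sub>+. x powr r * c x)"

definition Y_norm :: "real \<Rightarrow> real \<Rightarrow> (real \<Rightarrow> real) \<Rightarrow> real" where
  "Y_norm \<beta> r c = (LINT x|lebesgue_on \<real>\<^sub>+. (x powr (-\<beta>) + x powr r) * \<bar>c x\<bar>)"

definition Y_space :: "real \<Rightarrow> real \<Rightarrow> (real \<Rightarrow> real) set" where
  "Y_space \<beta> r = {c. integrable (lebesgue_on \<real>\<^sub>+) c \<and>
     integrable (lebesgue_on \<real>\<^sub>+) (\<lambda>x. (x powr (-\<beta>) + x powr r) * \<bar>c x\<bar>)}"

definition Y_cone :: "real \<Rightarrow> real \<Rightarrow> (real \<Rightarrow> real) set" where
  "Y_cone \<beta> r = {c \<in> Y_space \<beta> r. AE x in lebesgue_on \<real>\<^sub>+. 0 \<le> c x}"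

definition L_infinity :: "(real \<Rightarrow> real) set" where
  "L_infinity = {f \<in> borel_measurable (lebesgue_on \<real>\<^sub>+).
     \<exists>C. AE x in lebesgue_on \<real>\<^sub>+. \<bar>f x\<bar> \<le> C}"

definition time_interval :: "ereal \<Rightarrow> real set" where
  "time_interval T = {t. 0 \<le> t \<and> ereal t < T}"

definition \<kappa> :: "(real \<Rightarrow> real \<Rightarrow> real \<Rightarrow> real) \<Rightarrow> (real \<Rightarrow> real) \<Rightarrow> real \<Rightarrow> real \<Rightarrow> real \<Rightarrow> real" where
  "\<kappa> K c x y z = K x y z * c x * c y"

definition exchange_domain :: "(real \<times> real \<times> real) set" where
  "exchange_domain = {(x, y, z). 0 \<le> x \<and> 0 \<le> y \<and> 0 \<le> z \<and> z \<le> x \<and> z \<le> y}"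

definition second_difference :: "real \<Rightarrow> (real \<Rightarrow> real) \<Rightarrow> real \<Rightarrow> real" where
  "second_difference z f x = f (x + z) - 2 * f x + f (x - z)"

text \<open>
  In the following definition, \<open>c t x\<close> is the density at time \<open>t\<close> and size \<open>x\<close>, and \<open>u\<close> is
  the initial datum.  The clause with \<open>B\<close> expresses \<open>c \<in> L\<^sup>\<infinity>([0,T), Y\<^bsub>-\<beta>,r\<^esub>)\<close>; strong
  measurability in \<open>t\<close> need not be required separately, because continuity into \<open>L\<^sup>1(\<real>\<^sub>+)\<close>
  implies weak measurability into the separable space \<open>Y\<^bsub>-\<beta>,r\<^esub>\<close> (truncate the functionals
  to \<open>[1/n, n]\<close>).  The integrals on the right-hand side of the last clause converge
  absolutely (for almost every \<open>s\<close> in the case of the inner one) by the finiteness clause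
  preceding it, so the convention that non-integrable functions have integral \<open>0\<close> plays
  no role.
\<close>

definition weak_solution ::
  "(real \<Rightarrow> real \<Rightarrow> real \<Rightarrow> real) \<Rightarrow> real \<Rightarrow> real \<Rightarrow> ereal \<Rightarrow> (real \<Rightarrow> real)
    \<Rightarrow> (real \<Rightarrow> real \<Rightarrow> real) \<Rightarrow> bool" where
  "weak_solution K \<beta> r T u c \<longleftrightarrow>
     0 < T \<and> u \<in> Y_cone \<beta> r \<and>
     (\<forall>t \<in> time_interval T. c t \<in> Y_cone \<beta> r) \<and>
     (AE x in lebesgue_on \<real>\<^sub>+. c 0 x = u x) \<and>
     (\<forall>t \<in> time_interval T.
        ((\<lambda>s. LINT x|lebesgue_on \<real>\<^sub>+. \<bar>c s x - c t x\<bar>) \<longlongrightarrow> 0) (at t within time_interval T)) \<and>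
     (\<exists>B. AE t in lebesgue_on (time_interval T). Y_norm \<beta> r (c t) \<le> B) \<and>
     (\<forall>t \<in> time_interval T.
        (\<integral>\<^sup>+ s. (\<integral>\<^sup>+ (x, y, z). ennreal (\<kappa> K (c s) x y z) \<partial>lebesgue_on (\<real>\<^sub>+ \<times> \<real>\<^sub>+ \<times> \<real>\<^sub>+))
           \<partial>lebesgue_on {0..t}) < \<infinity>) \<and>
     (\<forall>t \<in> time_interval T. \<forall>f \<in> L_infinity.
        (LINT x|lebesgue_on \<real>\<^sub>+. f x * (c t x - u x)) =
        (LINT s|lebesgue_on {0..t}.
           (LINT (x, y, z)|lebesgue_on exchange_domain.
              second_difference z f x * \<kappa> K (c s) x y z)))"

definition existence_time :: "(real \<Rightarrow> real) \<Rightarrow> (real \<Rightarrow> real) \<Rightarrow> ereal" where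
  "existence_time \<phi> c =
     (if Y_norm 0 2 \<phi> = 0 then \<infinity>
      else ereal (inverse (2 * Y_norm 0 2 \<phi> * (moment 0 c + moment 2 c))))"

end

theory Submission
  imports Defs "HOL-Complex_Analysis.Great_Picard"
begin

text \<open>
  The equation is approximated by an explicit Euler scheme with the truncated kernel
  \<open>min K (n \<phi>)\<close> and step \<open>T\<^sub>0 / n\<close>, for which every step is a mass preserving jump operator.
  Since \<open>\<Delta>\<^sub>z x\<^sup>2 = 2 z\<^sup>2\<close>, the mass with weight \<open>1 + x\<^sup>2\<close> satisfies a discrete Riccati inequality
  with constant \<open>2 \<integral> z\<^sup>2 \<phi>\<close>, which is strictly smaller than \<open>2 \<parallel>\<phi>\<parallel>\<close>; hence it stays bounded up to
  and including \<open>T\<^sub>0\<close>.  With the rates frozen, the step is linear and positive.  The one-sided bound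
  on the second derivative of \<open>K\<close> gives a maximum principle for it, and fourth moments grow at most
  exponentially.  Splitting \<open>c\<^sub>0\<close> into a bounded part of compact support and a part of small weighted
  mass therefore shows that the approximations are equi-integrable with weight \<open>1 + x\<^sup>2\<close>, uniformly
  in time.  Being Lipschitz in time, they have a subsequence that converges weakly in \<open>L\<^sup>1\<close> with this
  weight at every time, and this suffices to pass to the limit in the quadratic term.
\<close>

section \<open>The Euler step\<close>

text \<open>The kernel may grow like the very weight that the datum integrates, so \<open>c0\<close>
  has no moment to spare: a flux is controlled by the weighted mass and by nothing weaker, and
  weight escaping to infinity along the approximations would be lost in the limit. Hence compactness
  is needed with the weight itself, and bounded parts of compact support supply the higher moments
  that \<open>c0\<close> lacks. Truncation at \<open>n * \<phi> z\<close> is tied to the step: it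
  bounds the total jump rate at every size by a multiple of n, which the step of order 1/n cancels
  exactly, so the step stays positive. The later estimates have to be uniform in n. A minimum is
  used because the only regularity of \<open>K\<close> is an upper bound on second differences, and
  minima preserve it. An upper bound is enough: for a density below l, gain minus loss at height l
  is at most l times the integrated second difference of the rates.\<close>

lemma nn_integral_shift:
  fixes f :: "real \<Rightarrow> ennreal" and z :: real
  assumes [measurable]: "f \<in> borel_measurable borel"
  shows "(\<integral>\<^sup>+ x. f (x + z) \<partial>lborel) = (\<integral>\<^sup>+ x. f x \<partial>lborel)"
  using nn_integral_real_affine[of f 1 z] by (simp add: add.commute)

text \<open>
  Densities take extended nonnegative values, so that the step is additive at every point, also
  where the jump integral diverges.  The subtraction is the truncated one; it is only used for
  \<open>2 h \<integral> A x z dz \<le> 1\<close>.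
\<close>

definition jump_step ::
  "ennreal \<Rightarrow> (real \<Rightarrow> real \<Rightarrow> ennreal) \<Rightarrow> (real \<Rightarrow> ennreal) \<Rightarrow> real \<Rightarrow> ennreal" where
  "jump_step h A u x = (1 - 2 * h * (\<integral>\<^sup>+ z. A x z \<partial>lborel)) * u x
     + h * (\<integral>\<^sup>+ z. A (x - z) z * u (x - z) + A (x + z) z * u (x + z) \<partial>lborel)"

lemma measurable_jump_step [measurable]:
  assumes [measurable]: "case_prod A \<in> borel_measurable (borel \<Otimes>\<^sub>M borel)" "u \<in> borel_measurable borel"
  shows "jump_step h A u \<in> borel_measurable borel"
  unfolding jump_step_def by measurable

lemma jump_step_add:
  assumes [measurable]: "case_prod A \<in> borel_measurable (borel \<Otimes>\<^sub>M borel)"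
    "u \<in> borel_measurable borel" "v \<in> borel_measurable borel"
  shows "jump_step h A (\<lambda>x. u x + v x) x = jump_step h A u x + jump_step h A v x"
proof -
  have "(\<integral>\<^sup>+ z. A (x - z) z * (u (x - z) + v (x - z)) + A (x + z) z * (u (x + z) + v (x + z)) \<partial>lborel)
    = (\<integral>\<^sup>+ z. (A (x - z) z * u (x - z) + A (x + z) z * u (x + z)) +
        (A (x - z) z * v (x - z) + A (x + z) z * v (x + z)) \<partial>lborel)"
    by (intro nn_integral_cong) (simp add: algebra_simps)
  also have "\<dots> = (\<integral>\<^sup>+ z. A (x - z) z * u (x - z) + A (x + z) z * u (x + z) \<partial>lborel) +
      (\<integral>\<^sup>+ z. A (x - z) z * v (x - z) + A (x + z) z * v (x + z) \<partial>lborel)"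
    by (rule nn_integral_add) measurable
  finally show ?thesis
    unfolding jump_step_def by (simp add: algebra_simps)
qed

text \<open>For fixed z a translation turns the gain at x into the test function at the two landing
  sites, and Tonelli reduces the claim to fixed z. Gain and loss are not subtracted from each other,
  so nothing has to be finite.\<close>

lemma nn_integral_jump_step:
  assumes [measurable]: "case_prod A \<in> borel_measurable (borel \<Otimes>\<^sub>M borel)"
    "u \<in> borel_measurable borel" "f \<in> borel_measurable borel"
  shows "(\<integral>\<^sup>+ x. f x * jump_step h A u x \<partial>lborel) =
    (\<integral>\<^sup>+ x. f x * (1 - 2 * h * (\<integral>\<^sup>+ z. A x z \<partial>lborel)) * u x \<partial>lborel) +
    h * (\<integral>\<^sup>+ x. \<integral>\<^sup>+ z. A x z * u x * (f (x + z) + f (x - z)) \<partial>lborel \<partial>lborel)"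
proof -
  have shift: "(\<integral>\<^sup>+ x. f x * (A (x - z) z * u (x - z) + A (x + z) z * u (x + z)) \<partial>lborel) =
      (\<integral>\<^sup>+ x. A x z * u x * (f (x + z) + f (x - z)) \<partial>lborel)" for z
  proof -
    have "(\<integral>\<^sup>+ x. f x * (A (x - z) z * u (x - z) + A (x + z) z * u (x + z)) \<partial>lborel) =
        (\<integral>\<^sup>+ x. f x * (A (x - z) z * u (x - z)) \<partial>lborel) + (\<integral>\<^sup>+ x. f x * (A (x + z) z * u (x + z)) \<partial>lborel)"
      unfolding distrib_left by (rule nn_integral_add) measurable
    also have "(\<integral>\<^sup>+ x. f x * (A (x - z) z * u (x - z)) \<partial>lborel) = (\<integral>\<^sup>+ x. f (x + z) * (A x z * u x) \<partial>lborel)"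
      using nn_integral_shift[of "\<lambda>x. f x * (A (x - z) z * u (x - z))" z] by simp
    also have "(\<integral>\<^sup>+ x. f x * (A (x + z) z * u (x + z)) \<partial>lborel) = (\<integral>\<^sup>+ x. f (x - z) * (A x z * u x) \<partial>lborel)"
      using nn_integral_shift[of "\<lambda>x. f (x - z) * (A x z * u x)" z] by simp
    also have "(\<integral>\<^sup>+ x. f (x + z) * (A x z * u x) \<partial>lborel) + (\<integral>\<^sup>+ x. f (x - z) * (A x z * u x) \<partial>lborel) =
        (\<integral>\<^sup>+ x. f (x + z) * (A x z * u x) + f (x - z) * (A x z * u x) \<partial>lborel)"
      by (rule nn_integral_add[symmetric]) measurable
    finally show ?thesis
      by (simp add: algebra_simps)
  qed
  have "(\<integral>\<^sup>+ x. f x * jump_step h A u x \<partial>lborel) =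
    (\<integral>\<^sup>+ x. f x * (1 - 2 * h * (\<integral>\<^sup>+ z. A x z \<partial>lborel)) * u x +
      h * (\<integral>\<^sup>+ z. f x * (A (x - z) z * u (x - z) + A (x + z) z * u (x + z)) \<partial>lborel) \<partial>lborel)"
    unfolding jump_step_def
  proof (intro nn_integral_cong)
    fix x
    have "f x * (\<integral>\<^sup>+ z. A (x - z) z * u (x - z) + A (x + z) z * u (x + z) \<partial>lborel) =
        (\<integral>\<^sup>+ z. f x * (A (x - z) z * u (x - z) + A (x + z) z * u (x + z)) \<partial>lborel)"
      by (rule nn_integral_cmult[symmetric]) measurable
    then show "f x * ((1 - 2 * h * (\<integral>\<^sup>+ z. A x z \<partial>lborel)) * u x
        + h * (\<integral>\<^sup>+ z. A (x - z) z * u (x - z) + A (x + z) z * u (x + z) \<partial>lborel)) =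
      f x * (1 - 2 * h * (\<integral>\<^sup>+ z. A x z \<partial>lborel)) * u x +
        h * (\<integral>\<^sup>+ z. f x * (A (x - z) z * u (x - z) + A (x + z) z * u (x + z)) \<partial>lborel)"
      by (simp only: distrib_left mult.assoc mult.left_commute[of "f x" h])
  qed
  also have "\<dots> = (\<integral>\<^sup>+ x. f x * (1 - 2 * h * (\<integral>\<^sup>+ z. A x z \<partial>lborel)) * u x \<partial>lborel) +
      (\<integral>\<^sup>+ x. h * (\<integral>\<^sup>+ z. f x * (A (x - z) z * u (x - z) + A (x + z) z * u (x + z)) \<partial>lborel) \<partial>lborel)"
    by (rule nn_integral_add) measurable
  also have "(\<integral>\<^sup>+ x. h * (\<integral>\<^sup>+ z. f x * (A (x - z) z * u (x - z) + A (x + z) z * u (x + z)) \<partial>lborel) \<partial>lborel) =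
      h * (\<integral>\<^sup>+ x. \<integral>\<^sup>+ z. f x * (A (x - z) z * u (x - z) + A (x + z) z * u (x + z)) \<partial>lborel \<partial>lborel)"
    by (rule nn_integral_cmult) measurable
  also have "(\<integral>\<^sup>+ x. \<integral>\<^sup>+ z. f x * (A (x - z) z * u (x - z) + A (x + z) z * u (x + z)) \<partial>lborel \<partial>lborel) =
      (\<integral>\<^sup>+ z. \<integral>\<^sup>+ x. f x * (A (x - z) z * u (x - z) + A (x + z) z * u (x + z)) \<partial>lborel \<partial>lborel)"
    by (rule lborel_pair.Fubini'[symmetric]) measurable
  also have "\<dots> = (\<integral>\<^sup>+ z. \<integral>\<^sup>+ x. A x z * u x * (f (x + z) + f (x - z)) \<partial>lborel \<partial>lborel)"
    by (simp only: shift)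
  also have "\<dots> = (\<integral>\<^sup>+ x. \<integral>\<^sup>+ z. A x z * u x * (f (x + z) + f (x - z)) \<partial>lborel \<partial>lborel)"
    by (rule lborel_pair.Fubini') measurable
  finally show ?thesis .
qed

text \<open>The rate bound makes the truncated subtraction genuine, so what stays at x and what
  leaves it, once in each direction, add up to \<open>u x\<close>.\<close>

lemma jump_step_outflow:
  assumes [measurable]: "case_prod A \<in> borel_measurable (borel \<Otimes>\<^sub>M borel)"
    "u \<in> borel_measurable borel" "f \<in> borel_measurable borel"
    and rate: "\<And>x. 2 * h * (\<integral>\<^sup>+ z. A x z \<partial>lborel) \<le> 1"
  shows "(\<integral>\<^sup>+ x. f x * (1 - 2 * h * (\<integral>\<^sup>+ z. A x z \<partial>lborel)) * u x \<partial>lborel) +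
      h * (\<integral>\<^sup>+ x. \<integral>\<^sup>+ z. A x z * u x * (2 * f x) \<partial>lborel \<partial>lborel) = (\<integral>\<^sup>+ x. f x * u x \<partial>lborel)"
proof -
  have "(\<integral>\<^sup>+ x. \<integral>\<^sup>+ z. A x z * u x * (2 * f x) \<partial>lborel \<partial>lborel) =
      (\<integral>\<^sup>+ x. (\<integral>\<^sup>+ z. A x z \<partial>lborel) * (u x * (2 * f x)) \<partial>lborel)"
    unfolding mult.assoc by (intro nn_integral_cong nn_integral_multc) measurable
  then have "h * (\<integral>\<^sup>+ x. \<integral>\<^sup>+ z. A x z * u x * (2 * f x) \<partial>lborel \<partial>lborel) =
      (\<integral>\<^sup>+ x. h * ((\<integral>\<^sup>+ z. A x z \<partial>lborel) * (u x * (2 * f x))) \<partial>lborel)"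
    by (simp add: nn_integral_cmult)
  then have "(\<integral>\<^sup>+ x. f x * (1 - 2 * h * (\<integral>\<^sup>+ z. A x z \<partial>lborel)) * u x \<partial>lborel) +
      h * (\<integral>\<^sup>+ x. \<integral>\<^sup>+ z. A x z * u x * (2 * f x) \<partial>lborel \<partial>lborel) =
      (\<integral>\<^sup>+ x. f x * (1 - 2 * h * (\<integral>\<^sup>+ z. A x z \<partial>lborel)) * u x +
        h * ((\<integral>\<^sup>+ z. A x z \<partial>lborel) * (u x * (2 * f x))) \<partial>lborel)"
    by (simp add: nn_integral_add)
  also have "\<dots> = (\<integral>\<^sup>+ x. f x * u x \<partial>lborel)"
  proof (intro nn_integral_cong)
    fix x
    let ?r = "2 * h * (\<integral>\<^sup>+ z. A x z \<partial>lborel)"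
    have "f x * (1 - ?r) * u x + h * ((\<integral>\<^sup>+ z. A x z \<partial>lborel) * (u x * (2 * f x))) =
        (1 - ?r + ?r) * (f x * u x)"
      by (simp add: algebra_simps)
    also have "1 - ?r + ?r = 1"
      by (rule diff_add_cancel_ennreal[OF rate])
    finally show "f x * (1 - ?r) * u x + h * ((\<integral>\<^sup>+ z. A x z \<partial>lborel) * (u x * (2 * f x))) = f x * u x"
      by simp
  qed
  finally show ?thesis .
qed

text \<open>The weak form of one step, with the loss moved to the other side because extended values
  do not admit differences.\<close>

lemma jump_step_balance:
  assumes [measurable]: "case_prod A \<in> borel_measurable (borel \<Otimes>\<^sub>M borel)"
    "u \<in> borel_measurable borel" "f \<in> borel_measurable borel"
    and rate: "\<And>x. 2 * h * (\<integral>\<^sup>+ z. A x z \<partial>lborel) \<le> 1"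
  shows "(\<integral>\<^sup>+ x. f x * jump_step h A u x \<partial>lborel) +
      h * (\<integral>\<^sup>+ x. \<integral>\<^sup>+ z. A x z * u x * (2 * f x) \<partial>lborel \<partial>lborel) =
    (\<integral>\<^sup>+ x. f x * u x \<partial>lborel) +
      h * (\<integral>\<^sup>+ x. \<integral>\<^sup>+ z. A x z * u x * (f (x + z) + f (x - z)) \<partial>lborel \<partial>lborel)"
  using jump_step_outflow[OF assms]
  unfolding nn_integral_jump_step[OF assms(1-3)] by (simp add: ac_simps)

text \<open>The identity for \<open>f\<close> is asked only along jumps that occur, so that it
  covers, besides constants, the function \<open>ennreal x\<close>, which is affine between x - z
  and x + z only for \<open>z \<le> x\<close>.\<close>

lemma jump_step_conserved:
  assumes [measurable]: "case_prod A \<in> borel_measurable (borel \<Otimes>\<^sub>M borel)"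
    "u \<in> borel_measurable borel" "f \<in> borel_measurable borel"
    and rate: "\<And>x. 2 * h * (\<integral>\<^sup>+ z. A x z \<partial>lborel) \<le> 1"
    and f: "\<And>x z. A x z \<noteq> 0 \<Longrightarrow> f (x + z) + f (x - z) = 2 * f x"
  shows "(\<integral>\<^sup>+ x. f x * jump_step h A u x \<partial>lborel) = (\<integral>\<^sup>+ x. f x * u x \<partial>lborel)"
proof -
  have "A x z * u x * (f (x + z) + f (x - z)) = A x z * u x * (2 * f x)" for x z
    using f[of x z] by (cases "A x z = 0") auto
  then show ?thesis
    using jump_step_outflow[OF assms(1-4)] unfolding nn_integral_jump_step[OF assms(1-3)] by simp
qed

text \<open>The part \<open>2 * f x\<close> of the gain is exactly what the loss removes; only the
  excess \<open>D\<close> survives.\<close>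

lemma jump_step_le:
  assumes [measurable]: "case_prod A \<in> borel_measurable (borel \<Otimes>\<^sub>M borel)"
    "u \<in> borel_measurable borel" "f \<in> borel_measurable borel"
    "case_prod D \<in> borel_measurable (borel \<Otimes>\<^sub>M borel)"
    and rate: "\<And>x. 2 * h * (\<integral>\<^sup>+ z. A x z \<partial>lborel) \<le> 1"
    and f: "\<And>x z. A x z * (f (x + z) + f (x - z)) \<le> A x z * (2 * f x) + D x z"
  shows "(\<integral>\<^sup>+ x. f x * jump_step h A u x \<partial>lborel) \<le>
    (\<integral>\<^sup>+ x. f x * u x \<partial>lborel) + h * (\<integral>\<^sup>+ x. \<integral>\<^sup>+ z. D x z * u x \<partial>lborel \<partial>lborel)"
proof -
  have "(\<integral>\<^sup>+ x. \<integral>\<^sup>+ z. A x z * u x * (f (x + z) + f (x - z)) \<partial>lborel \<partial>lborel) \<le>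
      (\<integral>\<^sup>+ x. \<integral>\<^sup>+ z. A x z * u x * (2 * f x) + D x z * u x \<partial>lborel \<partial>lborel)"
  proof (intro nn_integral_mono)
    fix x z
    show "A x z * u x * (f (x + z) + f (x - z)) \<le> A x z * u x * (2 * f x) + D x z * u x"
      using mult_left_mono[OF f[of x z], of "u x"] by (simp add: algebra_simps)
  qed
  also have "\<dots> = (\<integral>\<^sup>+ x. (\<integral>\<^sup>+ z. A x z * u x * (2 * f x) \<partial>lborel) + (\<integral>\<^sup>+ z. D x z * u x \<partial>lborel) \<partial>lborel)"
    by (intro nn_integral_cong nn_integral_add) measurable
  also have "\<dots> = (\<integral>\<^sup>+ x. \<integral>\<^sup>+ z. A x z * u x * (2 * f x) \<partial>lborel \<partial>lborel) +
      (\<integral>\<^sup>+ x. \<integral>\<^sup>+ z. D x z * u x \<partial>lborel \<partial>lborel)"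
    by (rule nn_integral_add) measurable
  finally have "h * (\<integral>\<^sup>+ x. \<integral>\<^sup>+ z. A x z * u x * (f (x + z) + f (x - z)) \<partial>lborel \<partial>lborel) \<le>
      h * (\<integral>\<^sup>+ x. \<integral>\<^sup>+ z. A x z * u x * (2 * f x) \<partial>lborel \<partial>lborel) +
      h * (\<integral>\<^sup>+ x. \<integral>\<^sup>+ z. D x z * u x \<partial>lborel \<partial>lborel)"
    by (simp add: mult_left_mono flip: distrib_left)
  from add_left_mono[OF this, of "\<integral>\<^sup>+ x. f x * (1 - 2 * h * (\<integral>\<^sup>+ z. A x z \<partial>lborel)) * u x \<partial>lborel"]
  show ?thesis
    unfolding nn_integral_jump_step[OF assms(1-3)] jump_step_outflow[OF assms(1-3,5), symmetric]
    by (simp add: add.assoc)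
qed

text \<open>A maximum principle. What arrives at x comes at the rates of the departure points x - z
  and x + z, so a one-sided bound on the second difference of the rates, integrated in z, limits the
  excess over the loss at x.\<close>

lemma jump_step_AE_le:
  assumes [measurable]: "case_prod A \<in> borel_measurable (borel \<Otimes>\<^sub>M borel)"
    "u \<in> borel_measurable borel"
    and rate: "\<And>x. 2 * h * (\<integral>\<^sup>+ z. A x z \<partial>lborel) \<le> 1"
    and u: "AE x in lborel. u x \<le> l"
    and A: "AE x in lborel. (\<integral>\<^sup>+ z. A (x - z) z + A (x + z) z \<partial>lborel) \<le> 2 * (\<integral>\<^sup>+ z. A x z \<partial>lborel) + d"
  shows "AE x in lborel. jump_step h A u x \<le> l * (1 + h * d)"
  using u A
proof eventually_elim
  fix x
  assume ux: "u x \<le> l"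
    and Ax: "(\<integral>\<^sup>+ z. A (x - z) z + A (x + z) z \<partial>lborel) \<le> 2 * (\<integral>\<^sup>+ z. A x z \<partial>lborel) + d"
  let ?r = "2 * h * (\<integral>\<^sup>+ z. A x z \<partial>lborel)"
  \<comment> \<open>For fixed x the exceptional set of \<open>u\<close>, pulled back along z
    \<mapsto> x - z and z \<mapsto> x + z, is still null.\<close>
  have "AE z in lborel. u (x - z) \<le> l" "AE z in lborel. u (x + z) \<le> l"
    using AE_borel_affine[of "-1" "\<lambda>x. u x \<le> l" x] AE_borel_affine[of 1 "\<lambda>x. u x \<le> l" x] u by auto
  then have "(\<integral>\<^sup>+ z. A (x - z) z * u (x - z) + A (x + z) z * u (x + z) \<partial>lborel) \<le>
      (\<integral>\<^sup>+ z. l * (A (x - z) z + A (x + z) z) \<partial>lborel)"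
    by (intro nn_integral_mono_AE, eventually_elim)
      (unfold distrib_left mult.commute[of l], intro add_mono mult_left_mono, auto)
  also have "\<dots> = l * (\<integral>\<^sup>+ z. A (x - z) z + A (x + z) z \<partial>lborel)"
    by (rule nn_integral_cmult) measurable
  also have "\<dots> \<le> l * (2 * (\<integral>\<^sup>+ z. A x z \<partial>lborel) + d)"
    by (rule mult_left_mono[OF Ax]) simp
  finally have "h * (\<integral>\<^sup>+ z. A (x - z) z * u (x - z) + A (x + z) z * u (x + z) \<partial>lborel) \<le>
      h * (l * (2 * (\<integral>\<^sup>+ z. A x z \<partial>lborel) + d))"
    by (rule mult_left_mono) simp
  then have "jump_step h A u x \<le> (1 - ?r) * l + h * (l * (2 * (\<integral>\<^sup>+ z. A x z \<partial>lborel) + d))"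
    unfolding jump_step_def by (intro add_mono mult_left_mono[OF ux]) auto
  also have "\<dots> = l * ((1 - ?r + ?r) + h * d)"
    by (simp add: algebra_simps)
  also have "1 - ?r + ?r = 1"
    by (rule diff_add_cancel_ennreal[OF rate])
  finally show "jump_step h A u x \<le> l * (1 + h * d)" .
qed

section \<open>Exchange kernels\<close>

text \<open>The weight of the norm with parameters (0, 2). It dominates the square of
  \<open>max 1 x\<close>, and its second difference with step z is \<open>2 * z\<^sup>2\<close> at
  every x.\<close>

definition wt :: "real \<Rightarrow> real" where
  "wt x = 1 + x\<^sup>2"

lemma wt_ge_1: "1 \<le> wt x"
  by (simp add: wt_def)

lemma wt_pos: "0 < wt x"
  using wt_ge_1[of x] by linarith

lemma measurable_wt [measurable]: "wt \<in> borel_measurable borel"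
  unfolding wt_def by measurable

text \<open>A Borel version of the kernel on the whole line, with the support conditions built in.
  Such a version agrees with the given kernel only almost everywhere, so the bound on the second
  derivative survives as an almost everywhere bound on second differences.
  \<open>phi_nonzero\<close> sets aside the case in which nothing moves.\<close>

locale exchange_kernel =
  fixes K :: "real \<Rightarrow> real \<Rightarrow> real \<Rightarrow> real" and \<phi> :: "real \<Rightarrow> real"
  assumes K_measurable: "(\<lambda>(x, y, z). K x y z) \<in> borel_measurable (borel \<Otimes>\<^sub>M borel \<Otimes>\<^sub>M borel)"
    and K_nonneg: "0 \<le> K x y z"
    and K_support: "K x y z \<noteq> 0 \<Longrightarrow> 0 \<le> z \<and> z \<le> x \<and> z \<le> y"
    and phi_measurable [measurable]: "\<phi> \<in> borel_measurable borel"
    and phi_nonneg: "0 \<le> \<phi> z"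
    and phi_integrable: "integrable lborel (\<lambda>z. wt z * \<phi> z)"
    and phi_nonzero: "0 < (\<integral>z. \<phi> z \<partial>lborel)"
    and K_bound: "K x y z \<le> wt x * wt y * \<phi> z"
    and K_second_difference: "AE x in lborel. AE y in lborel. AE z in lborel.
      K (x + z) y z + K (x - z) y z \<le> 2 * K x y z + z\<^sup>2 * wt y * \<phi> z"
begin

lemma measurable_K [measurable (raw)]:
  assumes "f \<in> borel_measurable M" "g \<in> borel_measurable M" "h \<in> borel_measurable M"
  shows "(\<lambda>p. K (f p) (g p) (h p)) \<in> borel_measurable M"
  using measurable_compose[OF measurable_Pair[OF assms(1) measurable_Pair[OF assms(2,3)]] K_measurable]
  by simp

definition phi_norm :: real where
  "phi_norm = (\<integral>z. wt z * \<phi> z \<partial>lborel)"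

definition phi_two :: real where
  "phi_two = (\<integral>z. z\<^sup>2 * \<phi> z \<partial>lborel)"

lemma integrable_phi [simp]: "integrable lborel \<phi>"
  by (rule Bochner_Integration.integrable_bound[OF phi_integrable])
    (auto simp: phi_nonneg abs_mult wt_def mult_left_mono intro!: mult_right_mono[of 1 _ "\<phi> _", simplified])

lemma integrable_phi2 [simp]: "integrable lborel (\<lambda>z. z\<^sup>2 * \<phi> z)"
  by (rule Bochner_Integration.integrable_bound[OF phi_integrable])
    (auto simp: phi_nonneg abs_mult wt_def intro!: mult_right_mono)

lemma phi_norm_eq: "phi_norm = (\<integral>z. \<phi> z \<partial>lborel) + phi_two"
  unfolding phi_norm_def phi_two_def wt_def
  by (simp add: distrib_right flip: Bochner_Integration.integral_add)

lemma phi_two_nonneg: "0 \<le> phi_two"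
  unfolding phi_two_def by (intro integral_nonneg_AE) (simp add: phi_nonneg)

text \<open>The gap between the two constants is the integral of \<open>\<phi>\<close>; it is what
  leaves room at the final time.\<close>

lemma phi_norm_pos: "0 < phi_norm" and phi_two_less: "phi_two < phi_norm"
  and phi_le_norm: "(\<integral>z. \<phi> z \<partial>lborel) \<le> phi_norm"
  using phi_norm_eq phi_two_nonneg phi_nonzero by auto

lemma nn_phi2: "(\<integral>\<^sup>+z. ennreal (z\<^sup>2 * \<phi> z) \<partial>lborel) = ennreal phi_two"
  unfolding phi_two_def by (rule nn_integral_eq_integral) (auto simp: phi_nonneg)

lemma nn_phi: "(\<integral>\<^sup>+z. ennreal (\<phi> z) \<partial>lborel) \<le> ennreal phi_norm"
  using nn_integral_eq_integral[OF integrable_phi] phi_nonneg phi_le_norm by (simp add: ennreal_leI)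

definition truncated :: "nat \<Rightarrow> real \<Rightarrow> real \<Rightarrow> real \<Rightarrow> real" where
  "truncated n x y z = min (K x y z) (real n * \<phi> z)"

lemma measurable_truncated [measurable (raw)]:
  assumes [measurable]: "f \<in> borel_measurable M" "g \<in> borel_measurable M" "h \<in> borel_measurable M"
  shows "(\<lambda>p. truncated n (f p) (g p) (h p)) \<in> borel_measurable M"
  unfolding truncated_def by measurable

lemma truncated_nonneg: "0 \<le> truncated n x y z"
  and truncated_le: "truncated n x y z \<le> wt x * wt y * \<phi> z"
  and truncated_le_n: "truncated n x y z \<le> real n * \<phi> z"
  using K_nonneg[of x y z] phi_nonneg[of z] K_bound[of x y z] by (auto simp: truncated_def)

lemma truncated_support: "truncated n x y z \<noteq> 0 \<Longrightarrow> 0 \<le> z \<and> z \<le> x \<and> z \<le> y"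
  using K_support[of x y z] phi_nonneg[of z] by (cases "K x y z = 0") (auto simp: truncated_def)

text \<open>A minimum of two functions inherits an upper bound on second differences.\<close>

lemma truncated_second_difference: "AE x in lborel. AE y in lborel. AE z in lborel.
    truncated n (x + z) y z + truncated n (x - z) y z \<le> 2 * truncated n x y z + z\<^sup>2 * wt y * \<phi> z"
proof -
  have "truncated n (x + z) y z + truncated n (x - z) y z \<le> 2 * truncated n x y z + z\<^sup>2 * wt y * \<phi> z"
    if "K (x + z) y z + K (x - z) y z \<le> 2 * K x y z + z\<^sup>2 * wt y * \<phi> z" for x y z
  proof -
    have "0 \<le> z\<^sup>2 * wt y * \<phi> z"
      using wt_pos[of y] phi_nonneg[of z] by simp
    with that show ?thesis
      unfolding truncated_def by (auto simp: min_def)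
  qed
  then show ?thesis
    using K_second_difference by (fastforce elim: eventually_mono)
qed

text \<open>The intensity felt at size x from all partners y: the mean field that the scheme freezes
  during a step.\<close>

definition rate :: "nat \<Rightarrow> (real \<Rightarrow> ennreal) \<Rightarrow> real \<Rightarrow> real \<Rightarrow> ennreal" where
  "rate n u x z = (\<integral>\<^sup>+ y. ennreal (truncated n x y z) * u y \<partial>lborel)"

lemma measurable_rate [measurable]:
  assumes [measurable]: "u \<in> borel_measurable borel"
  shows "case_prod (rate n u) \<in> borel_measurable (borel \<Otimes>\<^sub>M borel)"
  unfolding rate_def by measurable

lemma rate_support: "rate n u x z \<noteq> 0 \<Longrightarrow> 0 \<le> z \<and> z \<le> x"
proof (rule ccontr)
  assume nz: "rate n u x z \<noteq> 0" and "\<not> (0 \<le> z \<and> z \<le> x)"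
  then have "truncated n x y z = 0" for y
    using truncated_support[of n x y z] by auto
  with nz show False
    by (simp add: rate_def)
qed

lemma rate_le_n:
  assumes [measurable]: "u \<in> borel_measurable borel"
  shows "rate n u x z \<le> ennreal (real n * \<phi> z) * (\<integral>\<^sup>+ y. u y \<partial>lborel)"
proof -
  have "rate n u x z \<le> (\<integral>\<^sup>+ y. ennreal (real n * \<phi> z) * u y \<partial>lborel)"
    unfolding rate_def by (intro nn_integral_mono mult_right_mono ennreal_leI truncated_le_n) auto
  then show ?thesis
    by (simp add: nn_integral_cmult)
qed

text \<open>Uniform in n, at the price of a quadratic weight in x. The bound
  \<open>rate_le_n\<close> is uniform in x instead and serves the stability of the step.\<close>

lemma rate_le_wt:
  assumes [measurable]: "u \<in> borel_measurable borel"
  shows "rate n u x z \<le> ennreal (wt x * \<phi> z) * (\<integral>\<^sup>+ y. ennreal (wt y) * u y \<partial>lborel)"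
proof -
  have "rate n u x z \<le> (\<integral>\<^sup>+ y. ennreal (wt x * \<phi> z) * (ennreal (wt y) * u y) \<partial>lborel)"
    unfolding rate_def
  proof (intro nn_integral_mono)
    fix y
    have "ennreal (truncated n x y z) \<le> ennreal (wt x * \<phi> z) * ennreal (wt y)"
      using truncated_le[of n x y z] wt_pos[of x] wt_pos[of y] phi_nonneg[of z]
      by (subst ennreal_mult[symmetric]) (auto intro!: ennreal_leI simp: mult_ac)
    then show "ennreal (truncated n x y z) * u y \<le> ennreal (wt x * \<phi> z) * (ennreal (wt y) * u y)"
      by (simp add: mult_right_mono flip: mult.assoc)
  qed
  then show ?thesis
    by (simp add: nn_integral_cmult)
qed

lemma nn_integral_rate_le:
  assumes [measurable]: "u \<in> borel_measurable borel"
  shows "(\<integral>\<^sup>+ z. rate n u x z \<partial>lborel) \<le> ennreal (real n * phi_norm) * (\<integral>\<^sup>+ y. u y \<partial>lborel)"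
proof -
  have "(\<integral>\<^sup>+ z. rate n u x z \<partial>lborel) \<le> (\<integral>\<^sup>+ z. ennreal (real n * \<phi> z) * (\<integral>\<^sup>+ y. u y \<partial>lborel) \<partial>lborel)"
    by (intro nn_integral_mono rate_le_n[OF assms])
  also have "\<dots> = (\<integral>\<^sup>+ z. ennreal (real n) * ennreal (\<phi> z) \<partial>lborel) * (\<integral>\<^sup>+ y. u y \<partial>lborel)"
    by (subst nn_integral_multc) (auto simp: ennreal_mult phi_nonneg)
  also have "\<dots> \<le> ennreal (real n * phi_norm) * (\<integral>\<^sup>+ y. u y \<partial>lborel)"
    using phi_norm_pos by (intro mult_right_mono)
      (auto simp: nn_integral_cmult ennreal_mult intro!: mult_left_mono nn_phi)
  finally show ?thesis .
qed

text \<open>Supplies the \<open>d\<close> of \<open>jump_step_AE_le\<close>: the z-integral of the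
  one-sided bound gives \<open>phi_two\<close> and the y-integral the weighted mass, so the constant
  depends neither on n nor on x.\<close>

lemma rate_second_difference:
  assumes [measurable]: "u \<in> borel_measurable borel"
  shows "AE x in lborel. (\<integral>\<^sup>+ z. rate n u (x - z) z + rate n u (x + z) z \<partial>lborel) \<le>
    2 * (\<integral>\<^sup>+ z. rate n u x z \<partial>lborel) + ennreal phi_two * (\<integral>\<^sup>+ y. ennreal (wt y) * u y \<partial>lborel)"
  using truncated_second_difference[of n]
proof eventually_elim
  fix x
  assume x: "AE y in lborel. AE z in lborel.
    truncated n (x + z) y z + truncated n (x - z) y z \<le> 2 * truncated n x y z + z\<^sup>2 * wt y * \<phi> z"
  have "(\<integral>\<^sup>+ z. rate n u (x - z) z + rate n u (x + z) z \<partial>lborel) =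
      (\<integral>\<^sup>+ z. \<integral>\<^sup>+ y. ennreal (truncated n (x + z) y z + truncated n (x - z) y z) * u y \<partial>lborel \<partial>lborel)"
    unfolding rate_def
    by (intro nn_integral_cong, subst nn_integral_add[symmetric])
      (auto simp: truncated_nonneg distrib_right add.commute)
  also have "\<dots> = (\<integral>\<^sup>+ y. \<integral>\<^sup>+ z. ennreal (truncated n (x + z) y z + truncated n (x - z) y z) * u y \<partial>lborel \<partial>lborel)"
    by (rule lborel_pair.Fubini') measurable
  also have "\<dots> \<le> (\<integral>\<^sup>+ y. \<integral>\<^sup>+ z. 2 * (ennreal (truncated n x y z) * u y) +
      ennreal (z\<^sup>2 * \<phi> z) * (ennreal (wt y) * u y) \<partial>lborel \<partial>lborel)"
  proof (rule nn_integral_mono_AE, rule eventually_mono[OF x], rule nn_integral_mono_AE, erule eventually_mono)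
    fix y z
    assume "truncated n (x + z) y z + truncated n (x - z) y z \<le> 2 * truncated n x y z + z\<^sup>2 * wt y * \<phi> z"
    then have "ennreal (truncated n (x + z) y z + truncated n (x - z) y z) \<le>
        ennreal (2 * truncated n x y z + z\<^sup>2 * \<phi> z * wt y)"
      by (intro ennreal_leI) (simp add: mult_ac)
    also have "\<dots> = 2 * ennreal (truncated n x y z) + ennreal (z\<^sup>2 * \<phi> z) * ennreal (wt y)"
      using truncated_nonneg[of n x y z] phi_nonneg[of z] wt_pos[of y]
      by (subst ennreal_plus) (auto simp: ennreal_mult less_imp_le)
    finally show "ennreal (truncated n (x + z) y z + truncated n (x - z) y z) * u y \<le>
        2 * (ennreal (truncated n x y z) * u y) + ennreal (z\<^sup>2 * \<phi> z) * (ennreal (wt y) * u y)"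
      by (simp only: distrib_right[symmetric] mult.assoc[symmetric]) (rule mult_right_mono, auto)
  qed
  also have "\<dots> = (\<integral>\<^sup>+ y. (\<integral>\<^sup>+ z. 2 * (ennreal (truncated n x y z) * u y) \<partial>lborel) +
      (\<integral>\<^sup>+ z. ennreal (z\<^sup>2 * \<phi> z) * (ennreal (wt y) * u y) \<partial>lborel) \<partial>lborel)"
    by (intro nn_integral_cong nn_integral_add) measurable
  also have "\<dots> = (\<integral>\<^sup>+ y. \<integral>\<^sup>+ z. 2 * (ennreal (truncated n x y z) * u y) \<partial>lborel \<partial>lborel) +
      (\<integral>\<^sup>+ y. \<integral>\<^sup>+ z. ennreal (z\<^sup>2 * \<phi> z) * (ennreal (wt y) * u y) \<partial>lborel \<partial>lborel)"
    by (rule nn_integral_add) measurable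
  also have "(\<integral>\<^sup>+ y. \<integral>\<^sup>+ z. 2 * (ennreal (truncated n x y z) * u y) \<partial>lborel \<partial>lborel) =
      (\<integral>\<^sup>+ z. \<integral>\<^sup>+ y. 2 * (ennreal (truncated n x y z) * u y) \<partial>lborel \<partial>lborel)"
    by (rule lborel_pair.Fubini') measurable
  also have "\<dots> = 2 * (\<integral>\<^sup>+ z. rate n u x z \<partial>lborel)"
    unfolding rate_def by (simp add: nn_integral_cmult)
  also have "(\<integral>\<^sup>+ y. \<integral>\<^sup>+ z. ennreal (z\<^sup>2 * \<phi> z) * (ennreal (wt y) * u y) \<partial>lborel \<partial>lborel) =
      ennreal phi_two * (\<integral>\<^sup>+ y. ennreal (wt y) * u y \<partial>lborel)"
    by (simp add: nn_integral_multc nn_integral_cmult nn_phi2)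
  finally show "(\<integral>\<^sup>+ z. rate n u (x - z) z + rate n u (x + z) z \<partial>lborel) \<le>
    2 * (\<integral>\<^sup>+ z. rate n u x z \<partial>lborel) + ennreal phi_two * (\<integral>\<^sup>+ y. ennreal (wt y) * u y \<partial>lborel)" .
qed

text \<open>The growth condition on the test function absorbs the quadratic weight of the jump rate.\<close>

lemma jump_step_moment_le:
  fixes f :: "real \<Rightarrow> real"
  assumes [measurable]: "case_prod A \<in> borel_measurable (borel \<Otimes>\<^sub>M borel)"
    "u \<in> borel_measurable borel" "f \<in> borel_measurable borel"
    and rate: "\<And>x. 2 * h * (\<integral>\<^sup>+ z. A x z \<partial>lborel) \<le> 1"
    and support: "\<And>x z. A x z \<noteq> 0 \<Longrightarrow> 0 \<le> z \<and> z \<le> x"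
    and A: "\<And>x z. A x z \<le> ennreal (wt x * \<phi> z) * m"
    and f: "\<And>x. 0 \<le> f x" "0 \<le> C"
    and growth: "\<And>x z. 0 \<le> z \<Longrightarrow> z \<le> x \<Longrightarrow> wt x * (f (x + z) + f (x - z) - 2 * f x) \<le> C * z\<^sup>2 * f x"
  shows "(\<integral>\<^sup>+ x. ennreal (f x) * jump_step h A u x \<partial>lborel) \<le>
    (1 + h * ennreal (C * phi_two) * m) * (\<integral>\<^sup>+ x. ennreal (f x) * u x \<partial>lborel)"
proof -
  let ?D = "\<lambda>x z. ennreal (z\<^sup>2 * \<phi> z) * (ennreal C * m * ennreal (f x))"
  have "(\<integral>\<^sup>+ x. ennreal (f x) * jump_step h A u x \<partial>lborel) \<le>
    (\<integral>\<^sup>+ x. ennreal (f x) * u x \<partial>lborel) + h * (\<integral>\<^sup>+ x. \<integral>\<^sup>+ z. ?D x z * u x \<partial>lborel \<partial>lborel)"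
  proof (rule jump_step_le)
    fix x z
    show "A x z * (ennreal (f (x + z)) + ennreal (f (x - z))) \<le> A x z * (2 * ennreal (f x)) + ?D x z"
    proof (cases "A x z = 0")
      case False
      with support have xz: "0 \<le> z" "z \<le> x"
        by auto
      let ?d = "f (x + z) + f (x - z) - 2 * f x"
      have "ennreal (f (x + z)) + ennreal (f (x - z)) = ennreal (2 * f x + ?d)"
        using f by (simp flip: ennreal_plus)
      \<comment> \<open>The second difference may be negative, while the excess has to be an
        extended nonnegative number.\<close>
      also have "\<dots> \<le> ennreal (2 * f x + max 0 ?d)"
        by (intro ennreal_leI) simp
      also have "\<dots> = 2 * ennreal (f x) + ennreal (max 0 ?d)"
        using f by (subst ennreal_plus) (auto simp: ennreal_mult)
      finally have "A x z * (ennreal (f (x + z)) + ennreal (f (x - z))) \<le>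
          A x z * (2 * ennreal (f x) + ennreal (max 0 ?d))"
        by (rule mult_left_mono) simp
      also have "\<dots> = A x z * (2 * ennreal (f x)) + A x z * ennreal (max 0 ?d)"
        by (rule distrib_left)
      also have "A x z * ennreal (max 0 ?d) \<le> ennreal (wt x * \<phi> z) * m * ennreal (max 0 ?d)"
        by (intro mult_right_mono A) simp
      also have "\<dots> = ennreal (wt x * max 0 ?d * \<phi> z) * m"
        using wt_pos[of x] phi_nonneg[of z] by (simp add: ennreal_mult mult_ac)
      also have "\<dots> \<le> ennreal (C * z\<^sup>2 * f x * \<phi> z) * m"
        using growth[OF xz] f(2) f(1)[of x] phi_nonneg[of z]
        by (intro mult_right_mono ennreal_leI) (auto simp: max_def)
      also have "\<dots> = ?D x z"
        using f(2) f(1)[of x] phi_nonneg[of z] by (simp add: ennreal_mult mult_ac)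
      finally show ?thesis
        by (simp add: add_left_mono)
    qed simp
  qed (use rate in measurable)
  also have "(\<integral>\<^sup>+ x. \<integral>\<^sup>+ z. ?D x z * u x \<partial>lborel \<partial>lborel) =
      (\<integral>\<^sup>+ x. ennreal (C * phi_two) * m * (ennreal (f x) * u x) \<partial>lborel)"
  proof (intro nn_integral_cong)
    fix x
    have "(\<integral>\<^sup>+ z. ?D x z * u x \<partial>lborel) =
        (\<integral>\<^sup>+ z. ennreal (z\<^sup>2 * \<phi> z) \<partial>lborel) * (ennreal C * m * ennreal (f x) * u x)"
      unfolding mult.assoc by (rule nn_integral_multc) measurable
    then show "(\<integral>\<^sup>+ z. ?D x z * u x \<partial>lborel) = ennreal (C * phi_two) * m * (ennreal (f x) * u x)"
      unfolding nn_phi2 by (simp add: ennreal_mult f phi_two_nonneg mult_ac)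
  qed
  also have "\<dots> = ennreal (C * phi_two) * m * (\<integral>\<^sup>+ x. ennreal (f x) * u x \<partial>lborel)"
    by (rule nn_integral_cmult) measurable
  finally show ?thesis
    by (simp add: distrib_right mult.assoc)
qed

lemma wt_growth: "wt x * (wt (x + z) + wt (x - z) - 2 * wt x) \<le> 2 * z\<^sup>2 * wt x"
proof -
  have "wt (x + z) + wt (x - z) - 2 * wt x = 2 * z\<^sup>2"
    by (simp add: wt_def power2_eq_square algebra_simps)
  then show ?thesis
    by simp
qed

text \<open>The condition \<open>z \<le> x\<close> bounds 12 x^2 z^2 + 2 z^4 by 14 x^2 z^2, so that
  fourth moments need no more than the second moment of \<open>\<phi>\<close>. The factor
  \<open>wt x\<close> then turns 14 x^2 into at most 28 (1 + x^4).\<close>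

lemma fourth_moment_growth:
  assumes "0 \<le> z" "z \<le> x"
  shows "wt x * ((1 + (x + z) ^ 4) + (1 + (x - z) ^ 4) - 2 * (1 + x ^ 4)) \<le> 28 * z\<^sup>2 * (1 + x ^ 4)"
proof -
  have "(1 + (x + z) ^ 4) + (1 + (x - z) ^ 4) - 2 * (1 + x ^ 4) = z\<^sup>2 * (12 * x\<^sup>2 + 2 * z\<^sup>2)"
    by (simp add: power2_eq_square power4_eq_xxxx algebra_simps)
  moreover have "wt x * (12 * x\<^sup>2 + 2 * z\<^sup>2) \<le> wt x * (14 * x\<^sup>2)"
    using assms wt_pos[of x] by (intro mult_left_mono) (auto simp: power_mono)
  moreover have "wt x * (14 * x\<^sup>2) \<le> 28 * (1 + x ^ 4)"
  proof -
    have "0 \<le> (x\<^sup>2 - 1)\<^sup>2" "0 \<le> x ^ 4"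
      by simp_all
    then have "2 * x\<^sup>2 \<le> 1 + x ^ 4" "0 \<le> x ^ 4"
      by (simp_all add: power2_eq_square power4_eq_xxxx algebra_simps)
    moreover have "14 * a + 14 * b \<le> 28 * (1 + b)" if "2 * a \<le> 1 + b" "0 \<le> b" for a b :: real
      using that by (simp add: algebra_simps)
    ultimately have "14 * x\<^sup>2 + 14 * x ^ 4 \<le> 28 * (1 + x ^ 4)"
      by blast
    then show ?thesis
      by (simp add: wt_def power2_eq_square power4_eq_xxxx algebra_simps)
  qed
  ultimately have "z\<^sup>2 * (wt x * (12 * x\<^sup>2 + 2 * z\<^sup>2)) \<le> z\<^sup>2 * (28 * (1 + x ^ 4))"
    by (intro mult_left_mono) auto
  then show ?thesis
    using \<open>_ = z\<^sup>2 * (12 * x\<^sup>2 + 2 * z\<^sup>2)\<close> by (simp add: mult_ac)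
qed

end

section \<open>The explicit Euler scheme\<close>

locale exchange_data = exchange_kernel +
  fixes c0 :: "real \<Rightarrow> real"
  assumes c0_measurable [measurable]: "c0 \<in> borel_measurable borel"
    and c0_nonneg: "0 \<le> c0 x"
    and c0_negative: "x < 0 \<Longrightarrow> c0 x = 0"
    and c0_integrable: "integrable lborel (\<lambda>x. wt x * c0 x)"
    and c0_nonzero: "0 < (\<integral>x. wt x * c0 x \<partial>lborel)"
begin

definition wt_mass :: real where
  "wt_mass = (\<integral>x. wt x * c0 x \<partial>lborel)"

definition horizon :: real where
  "horizon = 1 / (2 * phi_norm * wt_mass)"

text \<open>The solution of the Riccati equation y' = 2 \<open>phi_two\<close> y^2 with y(0) =
  \<open>wt_mass\<close>, evaluated at \<open>horizon\<close>, where 2 \<open>phi_two\<close>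
  \<open>wt_mass\<close> t equals \<open>phi_two / phi_norm\<close>.\<close>

definition bound :: real where
  "bound = wt_mass / (1 - phi_two / phi_norm)"

definition tau :: "nat \<Rightarrow> real" where
  "tau n = horizon / real n"

primrec euler :: "nat \<Rightarrow> nat \<Rightarrow> real \<Rightarrow> ennreal" where
  "euler n 0 = (\<lambda>x. ennreal (c0 x))"
| "euler n (Suc k) = jump_step (ennreal (tau n)) (rate n (euler n k)) (euler n k)"

text \<open>The rates always come from the scheme started at \<open>c0\<close>, whatever
  \<open>u\<close> is; pieces of \<open>c0\<close> can therefore be followed separately and add up
  to \<open>euler\<close>.\<close>

primrec evolve :: "nat \<Rightarrow> (real \<Rightarrow> ennreal) \<Rightarrow> nat \<Rightarrow> real \<Rightarrow> ennreal" where
  "evolve n u 0 = u"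
| "evolve n u (Suc k) = jump_step (ennreal (tau n)) (rate n (euler n k)) (evolve n u k)"

lemma measurable_euler [measurable]: "euler n k \<in> borel_measurable borel"
  by (induction k) auto

lemma measurable_evolve [measurable]:
  "u \<in> borel_measurable borel \<Longrightarrow> evolve n u k \<in> borel_measurable borel"
  by (induction k) auto

lemma evolve_c0: "evolve n (\<lambda>x. ennreal (c0 x)) k = euler n k"
  by (induction k) auto

lemma evolve_add:
  assumes [measurable]: "p \<in> borel_measurable borel" "q \<in> borel_measurable borel"
  shows "evolve n (\<lambda>x. p x + q x) k = (\<lambda>x. evolve n p k x + evolve n q k x)"
proof (induction k)
  case (Suc k)
  show ?case
    unfolding evolve.simps Suc by (intro ext jump_step_add) measurable
qed simp

lemma euler_negative: "x < 0 \<Longrightarrow> euler n k x = 0"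
proof (induction k)
  case (Suc k)
  have "rate n (euler n k) (x - z) z = 0" "rate n (euler n k) (x + z) z = 0" for z
    using rate_support[of n "euler n k" "x - z" z] rate_support[of n "euler n k" "x + z" z] Suc.prems
    by force+
  then show ?case
    using Suc by (simp add: jump_step_def)
qed (simp add: c0_negative)

lemma wt_mass_pos: "0 < wt_mass"
  using c0_nonzero by (simp add: wt_mass_def)

lemma horizon_pos: "0 < horizon"
  using wt_mass_pos phi_norm_pos by (simp add: horizon_def)

lemma horizon_eq: "2 * phi_norm * wt_mass * horizon = 1"
  using wt_mass_pos phi_norm_pos by (simp add: horizon_def)

lemma ratio: "0 \<le> phi_two / phi_norm" "phi_two / phi_norm < 1"
  using phi_norm_pos phi_two_nonneg phi_two_less by auto

lemma bound_pos: "0 < bound"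
  using wt_mass_pos ratio by (simp add: bound_def)

lemma tau_nonneg: "0 \<le> tau n"
  using horizon_pos by (simp add: tau_def)

section \<open>Stability of the step and the Riccati bound for the weighted mass\<close>

lemma nn_wt_mass: "(\<integral>\<^sup>+ x. ennreal (wt x) * ennreal (c0 x) \<partial>lborel) = ennreal wt_mass"
  unfolding wt_mass_def using wt_pos c0_nonneg
  by (subst nn_integral_eq_integral[OF c0_integrable, symmetric]) (auto simp: ennreal_mult less_imp_le)

lemma nn_c0_le: "(\<integral>\<^sup>+ x. ennreal (c0 x) \<partial>lborel) \<le> ennreal wt_mass"
  unfolding nn_wt_mass[symmetric]
proof (intro nn_integral_mono)
  fix x
  show "ennreal (c0 x) \<le> ennreal (wt x) * ennreal (c0 x)"
    using mult_right_mono[of 1 "ennreal (wt x)" "ennreal (c0 x)"] wt_ge_1[of x] by simp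
qed

text \<open>The n of the truncation level cancels the n in \<open>tau n\<close>, and what is left,
  \<open>2 * phi_norm * wt_mass * horizon\<close>, equals 1. The hypothesis concerns the unweighted
  mass, which the scheme conserves.\<close>

lemma rate_stable:
  assumes [measurable]: "u \<in> borel_measurable borel"
    and u: "(\<integral>\<^sup>+ y. u y \<partial>lborel) \<le> ennreal wt_mass" and "0 < n"
  shows "2 * ennreal (tau n) * (\<integral>\<^sup>+ z. rate n u x z \<partial>lborel) \<le> 1"
proof -
  have "(\<integral>\<^sup>+ z. rate n u x z \<partial>lborel) \<le> ennreal (real n * phi_norm) * ennreal wt_mass"
    using nn_integral_rate_le[OF assms(1)] u by (rule order_trans[OF _ mult_left_mono]) simp
  then have "2 * ennreal (tau n) * (\<integral>\<^sup>+ z. rate n u x z \<partial>lborel) \<le>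
      2 * ennreal (tau n) * (ennreal (real n * phi_norm) * ennreal wt_mass)"
    by (rule mult_left_mono) simp
  also have "\<dots> = ennreal (2 * tau n * (real n * phi_norm * wt_mass))"
    using tau_nonneg[of n] phi_norm_pos wt_mass_pos by (simp add: ennreal_mult)
  also have "2 * tau n * (real n * phi_norm * wt_mass) = 1"
    using \<open>0 < n\<close> horizon_eq by (simp add: tau_def field_simps)
  finally show ?thesis
    by simp
qed

lemma ennreal_one_plus_mult:
  fixes a b c d :: real
  assumes "0 \<le> a" "0 \<le> b" "0 \<le> c" "0 \<le> d"
  shows "(1 + ennreal a * ennreal b * ennreal c) * ennreal d = ennreal ((1 + a * b * c) * d)"
  using assms by (simp add: ennreal_mult ennreal_plus)

text \<open>Rests on (s + d)(s - d) \<le> s^2: an explicit Euler step stays below a convex solution,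
  here m / s of the Riccati equation while the denominator s falls linearly.\<close>

lemma discrete_riccati:
  fixes s d m :: real
  assumes "0 \<le> d" "d < s" "0 \<le> m"
  shows "(1 + d * (1 / s)) * (m / s) \<le> m / (s - d)"
proof -
  have "(1 + d * (1 / s)) * (m / s) = m * ((s + d) / s\<^sup>2)"
    using assms by (simp add: field_simps power2_eq_square)
  also have "(s + d) / s\<^sup>2 \<le> 1 / (s - d)"
    using assms by (simp add: field_simps power2_eq_square)
  finally show ?thesis
    using assms by (simp add: mult_left_mono)
qed

text \<open>Both parts go through one induction because each step is stable only if the mass before
  it is still that of \<open>c0\<close>, and the conservation of mass and the weighted estimate both
  presuppose a stable step.\<close>

lemma euler_mass_wt:
  assumes "0 < n" "k \<le> n"
  shows "(\<integral>\<^sup>+ x. euler n k x \<partial>lborel) = (\<integral>\<^sup>+ x. ennreal (c0 x) \<partial>lborel)"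
    and "(\<integral>\<^sup>+ x. ennreal (wt x) * euler n k x \<partial>lborel) \<le>
      ennreal (wt_mass / (1 - phi_two / phi_norm * k / n))"
  using assms(2)
proof (induction k)
  case 0
  { case 1 show ?case by simp }
  { case 2 show ?case by (simp add: nn_wt_mass) }
next
  case (Suc k)
  let ?A = "rate n (euler n k)" and ?u = "euler n k" and ?r = "phi_two / phi_norm"
  have stable: "2 * ennreal (tau n) * (\<integral>\<^sup>+ z. ?A x z \<partial>lborel) \<le> 1" if "Suc k \<le> n" for x
    using Suc.IH that nn_c0_le by (intro rate_stable \<open>0 < n\<close>) auto
  { case 1
    show ?case
      using jump_step_conserved[of ?A ?u "\<lambda>_. 1" "ennreal (tau n)"] stable[OF 1] Suc.IH 1
      by simp }
  { case 2
    let ?s = "1 - ?r * k / n"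
    have kn: "real k / real n < 1" "real (Suc k) / real n \<le> 1"
      using 2 by auto
    \<comment> \<open>Since \<open>Suc k \<le> n\<close> and the ratio is below 1, the denominator
      is still positive after this step.\<close>
    have "?r * (real (Suc k) / real n) \<le> ?r * 1"
      using kn ratio by (intro mult_left_mono) auto
    then have d: "?r / n < ?s"
      using ratio by (simp add: field_simps add_divide_distrib)
    have "0 \<le> ?r / n"
      by (intro divide_nonneg_nonneg ratio) simp
    with d have s: "0 < ?s"
      by linarith
    have IH: "(\<integral>\<^sup>+ x. ennreal (wt x) * ?u x \<partial>lborel) \<le> ennreal (wt_mass / ?s)"
      using Suc.IH 2 by simp
    have "(\<integral>\<^sup>+ x. ennreal (wt x) * euler n (Suc k) x \<partial>lborel) \<le>
      (1 + ennreal (tau n) * ennreal (2 * phi_two) * (\<integral>\<^sup>+ x. ennreal (wt x) * ?u x \<partial>lborel)) *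
        (\<integral>\<^sup>+ x. ennreal (wt x) * ?u x \<partial>lborel)"
      unfolding euler.simps
      by (rule jump_step_moment_le)
        (use stable[OF 2] rate_support rate_le_wt wt_growth wt_pos in \<open>auto simp: less_imp_le\<close>)
    also have "\<dots> \<le> (1 + ennreal (tau n) * ennreal (2 * phi_two) * ennreal (wt_mass / ?s)) * ennreal (wt_mass / ?s)"
      by (intro mult_mono add_left_mono mult_left_mono IH) auto
    also have "\<dots> = ennreal ((1 + tau n * (2 * phi_two) * (wt_mass / ?s)) * (wt_mass / ?s))"
      using s wt_mass_pos tau_nonneg[of n] phi_two_nonneg by (intro ennreal_one_plus_mult) auto
    \<comment> \<open>\<open>wt_mass\<close> cancels against \<open>horizon\<close>, so one step
      lowers the denominator by exactly the ratio divided by n.\<close>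
    also have "tau n * (2 * phi_two) * (wt_mass / ?s) = ?r / n * (1 / ?s)"
      using wt_mass_pos phi_norm_pos by (simp add: tau_def horizon_def)
    also have "ennreal ((1 + ?r / n * (1 / ?s)) * (wt_mass / ?s)) \<le> ennreal (wt_mass / (?s - ?r / n))"
      using d \<open>0 \<le> ?r / n\<close> wt_mass_pos by (intro ennreal_leI discrete_riccati) auto
    also have "?s - ?r / n = 1 - ?r * real (Suc k) / n"
      by (simp add: field_simps add_divide_distrib)
    finally show ?case . }
qed

lemma euler_wt_le:
  assumes "0 < n" "k \<le> n"
  shows "(\<integral>\<^sup>+ x. ennreal (wt x) * euler n k x \<partial>lborel) \<le> ennreal bound"
proof -
  have "phi_two / phi_norm * (real k / real n) \<le> phi_two / phi_norm * 1"
    using assms ratio by (intro mult_left_mono) auto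
  then have "wt_mass / (1 - phi_two / phi_norm * k / n) \<le> bound"
    unfolding bound_def using ratio wt_mass_pos by (intro divide_left_mono) auto
  then show ?thesis
    using euler_mass_wt(2)[OF assms] by (meson ennreal_leI order_trans)
qed

lemma euler_stable:
  assumes "0 < n" "k \<le> n"
  shows "2 * ennreal (tau n) * (\<integral>\<^sup>+ z. rate n (euler n k) x z \<partial>lborel) \<le> 1"
  using assms euler_mass_wt(1)[OF assms] nn_c0_le by (intro rate_stable) auto

lemma euler_rate_le:
  assumes "0 < n" "k \<le> n"
  shows "rate n (euler n k) x z \<le> ennreal (wt x * \<phi> z) * ennreal bound"
  using rate_le_wt[of "euler n k" n x z] euler_wt_le[OF assms]
  by (rule order_trans[OF _ mult_left_mono]) auto

definition growth_factor :: "nat \<Rightarrow> ennreal" where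
  "growth_factor n = ennreal (exp (28 * phi_two * bound * tau n))"

definition total_growth :: real where
  "total_growth = exp (28 * phi_two * bound * horizon)"

lemma growth_factor_power:
  assumes "0 < n" "k \<le> n"
  shows "growth_factor n ^ k \<le> ennreal total_growth"
proof -
  have "real k * (28 * phi_two * bound * tau n) = (28 * phi_two * bound * horizon) * (real k / real n)"
    by (simp add: tau_def)
  also have "\<dots> \<le> (28 * phi_two * bound * horizon) * 1"
    using assms phi_two_nonneg bound_pos horizon_pos by (intro mult_left_mono) auto
  finally have "exp (28 * phi_two * bound * tau n) ^ k \<le> total_growth"
    unfolding total_growth_def by (simp flip: exp_of_nat_mult)
  then show ?thesis
    unfolding growth_factor_def by (simp add: ennreal_power ennreal_leI)
qed

text \<open>The constant 28 serves three estimates at once: 1 is needed for the maximum principle, 2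
  for the weighted mass and 28 for the fourth moment.\<close>

lemma growth_factor_step:
  assumes "0 \<le> C" "C \<le> 28"
  shows "1 + ennreal (tau n) * ennreal (C * phi_two) * ennreal bound \<le> growth_factor n"
proof -
  have "1 + tau n * (C * phi_two) * bound \<le> 1 + 28 * phi_two * bound * tau n"
    using assms phi_two_nonneg bound_pos tau_nonneg[of n]
      mult_right_mono[of C 28 "phi_two * bound * tau n"] by (simp add: mult_ac)
  also have "\<dots> \<le> exp (28 * phi_two * bound * tau n)"
    by (rule exp_ge_add_one_self)
  finally have "ennreal (1 + tau n * (C * phi_two) * bound) \<le> growth_factor n"
    unfolding growth_factor_def by (rule ennreal_leI)
  then show ?thesis
    using assms phi_two_nonneg bound_pos tau_nonneg[of n]
    by (simp add: ennreal_mult ennreal_plus less_imp_le)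
qed

lemma evolve_moment_le:
  fixes f :: "real \<Rightarrow> real"
  assumes [measurable]: "u \<in> borel_measurable borel" "f \<in> borel_measurable borel"
    and f: "\<And>x. 0 \<le> f x" "0 \<le> C" "C \<le> 28"
    and growth: "\<And>x z. 0 \<le> z \<Longrightarrow> z \<le> x \<Longrightarrow> wt x * (f (x + z) + f (x - z) - 2 * f x) \<le> C * z\<^sup>2 * f x"
    and "0 < n" "k \<le> n"
  shows "(\<integral>\<^sup>+ x. ennreal (f x) * evolve n u k x \<partial>lborel) \<le> growth_factor n ^ k * (\<integral>\<^sup>+ x. ennreal (f x) * u x \<partial>lborel)"
  using \<open>k \<le> n\<close>
proof (induction k)
  case (Suc k)
  let ?A = "rate n (euler n k)" and ?u = "evolve n u k"
  have "(\<integral>\<^sup>+ x. ennreal (f x) * evolve n u (Suc k) x \<partial>lborel) \<le>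
      (1 + ennreal (tau n) * ennreal (C * phi_two) * ennreal bound) * (\<integral>\<^sup>+ x. ennreal (f x) * ?u x \<partial>lborel)"
    unfolding evolve.simps
    by (rule jump_step_moment_le)
      (use euler_stable rate_support euler_rate_le growth f Suc \<open>0 < n\<close> in auto)
  also have "\<dots> \<le> growth_factor n * (growth_factor n ^ k * (\<integral>\<^sup>+ x. ennreal (f x) * u x \<partial>lborel))"
    using Suc f by (intro mult_mono growth_factor_step) auto
  finally show ?case
    by (simp add: mult.assoc)
qed simp

text \<open>Each step multiplies the height by at most 1 + \<open>tau n * phi_two * bound\<close>.
  This is uniform in n because the weighted mass that enters the rates stays below
  \<open>bound\<close>.\<close>

lemma evolve_AE_le:
  assumes [measurable]: "u \<in> borel_measurable borel"
    and u: "AE x in lborel. u x \<le> l" and "0 < n" "k \<le> n"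
  shows "AE x in lborel. evolve n u k x \<le> l * growth_factor n ^ k"
  using \<open>k \<le> n\<close>
proof (induction k)
  case (Suc k)
  let ?A = "rate n (euler n k)"
  have "AE x in lborel. evolve n u (Suc k) x \<le>
      (l * growth_factor n ^ k) * (1 + ennreal (tau n) * (ennreal phi_two * ennreal bound))"
    unfolding evolve.simps
  proof (rule jump_step_AE_le)
    show "2 * ennreal (tau n) * (\<integral>\<^sup>+ z. ?A x z \<partial>lborel) \<le> 1" for x
      using Suc \<open>0 < n\<close> by (intro euler_stable) auto
    have "ennreal phi_two * (\<integral>\<^sup>+ y. ennreal (wt y) * euler n k y \<partial>lborel) \<le> ennreal phi_two * ennreal bound"
      using Suc \<open>0 < n\<close> by (intro mult_left_mono euler_wt_le) auto
    with rate_second_difference[of "euler n k" n]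
    show "AE x in lborel. (\<integral>\<^sup>+ z. ?A (x - z) z + ?A (x + z) z \<partial>lborel) \<le>
        2 * (\<integral>\<^sup>+ z. ?A x z \<partial>lborel) + ennreal phi_two * ennreal bound"
      by (auto elim!: eventually_mono intro: order_trans add_left_mono)
  qed (use Suc in auto)
  moreover have "(l * growth_factor n ^ k) * (1 + ennreal (tau n) * (ennreal phi_two * ennreal bound)) \<le>
      l * growth_factor n ^ Suc k"
    using mult_left_mono[OF growth_factor_step[of 1 n], of "l * growth_factor n ^ k"]
    by (simp add: mult_ac)
  ultimately show ?case
    by (auto elim!: eventually_mono intro: order_trans)
qed (use u in simp)

lemma euler_first_moment:
  assumes "0 < n" "k \<le> n"
  shows "(\<integral>\<^sup>+ x. ennreal x * euler n k x \<partial>lborel) = (\<integral>\<^sup>+ x. ennreal x * ennreal (c0 x) \<partial>lborel)"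
  using \<open>k \<le> n\<close>
proof (induction k)
  case (Suc k)
  let ?A = "rate n (euler n k)" and ?u = "euler n k"
  have "(\<integral>\<^sup>+ x. ennreal x * euler n (Suc k) x \<partial>lborel) = (\<integral>\<^sup>+ x. ennreal x * ?u x \<partial>lborel)"
    unfolding euler.simps
  proof (rule jump_step_conserved)
    fix x z assume "?A x z \<noteq> 0"
    then have "0 \<le> z" "z \<le> x"
      using rate_support by auto
    then show "ennreal (x + z) + ennreal (x - z) = 2 * ennreal x"
      by (subst ennreal_plus[symmetric]) (auto simp: ennreal_mult simp flip: ennreal_numeral)
  qed (use Suc \<open>0 < n\<close> in \<open>auto intro: euler_stable\<close>)
  with Suc show ?case
    by simp
qed simp

section \<open>Equi-integrability with the quadratic weight\<close>

lemma nn_moment_cutoff: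
  assumes "0 < e"
  obtains l :: nat where "(\<integral>\<^sup>+ x. ennreal (wt x) *
      (ennreal (c0 x) * indicator {x. \<not> (\<bar>x\<bar> \<le> real l \<and> c0 x \<le> real l)} x) \<partial>lborel) \<le> ennreal e"
proof -
  let ?f = "\<lambda>l x. ennreal (wt x) * (ennreal (c0 x) * indicator {x. \<not> (\<bar>x\<bar> \<le> real l \<and> c0 x \<le> real l)} x)"
  have "(\<lambda>l. \<integral>\<^sup>+ x. ?f l x \<partial>lborel) \<longlonglongrightarrow> (\<integral>\<^sup>+ (x::real). 0 \<partial>lborel)"
  proof (rule nn_integral_dominated_convergence[where w = "\<lambda>x. ennreal (wt x) * ennreal (c0 x)"])
    show "(\<integral>\<^sup>+ x. ennreal (wt x) * ennreal (c0 x) \<partial>lborel) < \<infinity>"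
      by (simp add: nn_wt_mass)
    show "AE x in lborel. (\<lambda>l. ?f l x) \<longlonglongrightarrow> 0"
    proof (rule AE_I2)
      fix x
      obtain N where "max \<bar>x\<bar> (c0 x) \<le> real N"
        using real_arch_simple by blast
      then have "?f l x = 0" if "N \<le> l" for l
        using that by (auto simp: indicator_def)
      then show "(\<lambda>l. ?f l x) \<longlonglongrightarrow> 0"
        by (intro tendsto_eventually eventually_sequentiallyI[of N])
    qed
  qed (auto simp: indicator_def)
  then have "\<forall>\<^sub>F l in sequentially. (\<integral>\<^sup>+ x. ?f l x \<partial>lborel) < ennreal e"
    using assms by (intro order_tendstoD) (auto simp: ennreal_zero_less_divide)
  then obtain l where "(\<integral>\<^sup>+ x. ?f l x \<partial>lborel) < ennreal e"
    by (auto simp: eventually_sequentially)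
  then show ?thesis
    by (intro that[of l]) (rule less_imp_le)
qed

text \<open>From (1 + x^2)^2 \<le> 2 (1 + x^4): far out, the weight is a small fraction of the
  density of the fourth moment.\<close>

lemma wt_tail:
  assumes "r < \<bar>x\<bar>" "0 \<le> r"
  shows "wt x \<le> 2 / wt r * (1 + x ^ 4)"
proof -
  have "r\<^sup>2 \<le> x\<^sup>2"
    using assms by (metis abs_le_square_iff abs_of_nonneg less_imp_le)
  then have "wt x * wt r \<le> wt x * wt x"
    using wt_pos[of x] by (intro mult_left_mono) (auto simp: wt_def)
  also have "wt x * wt x = 2 * (1 + x ^ 4) - (x\<^sup>2 - 1)\<^sup>2"
    by (simp add: wt_def power2_eq_square power4_eq_xxxx algebra_simps)
  also have "\<dots> \<le> 2 * (1 + x ^ 4)"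
    by simp
  finally show ?thesis
    using wt_pos[of r] by (simp add: field_simps)
qed

text \<open>Evolving the two parts of the initial datum with the same linear dynamics replaces the
  criterion of de la Vallee Poussin.\<close>

lemma euler_equi_integrable:
  assumes "0 < e"
  obtains L r :: real where "0 \<le> L" "0 \<le> r"
    "\<And>n k g. 0 < n \<Longrightarrow> k \<le> n \<Longrightarrow> g \<in> borel_measurable borel \<Longrightarrow> (\<And>x. g x \<le> 1) \<Longrightarrow>
      (\<integral>\<^sup>+ x. g x * (ennreal (wt x) * euler n k x) \<partial>lborel) \<le>
        ennreal L * (\<integral>\<^sup>+ x. g x * indicator {-r..r} x \<partial>lborel) + ennreal e"
proof -
  have E: "0 < total_growth"
    by (simp add: total_growth_def)
  with assms have "0 < e / (2 * total_growth)"
    by simp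
  \<comment> \<open>The remainder may grow by the factor \<open>total_growth\<close> in the course
    of the evolution, so its initial share of e is divided by that factor.\<close>
  then obtain l :: nat where l: "(\<integral>\<^sup>+ x. ennreal (wt x) *
      (ennreal (c0 x) * indicator {x. \<not> (\<bar>x\<bar> \<le> real l \<and> c0 x \<le> real l)} x) \<partial>lborel) \<le> ennreal (e / (2 * total_growth))"
    using nn_moment_cutoff by blast
  define p where "p = (\<lambda>x. ennreal (c0 x) * indicator {x. \<bar>x\<bar> \<le> real l \<and> c0 x \<le> real l} x)"
  define q where "q = (\<lambda>x. ennreal (c0 x) * indicator {x. \<not> (\<bar>x\<bar> \<le> real l \<and> c0 x \<le> real l)} x)"
  have [measurable]: "p \<in> borel_measurable borel" "q \<in> borel_measurable borel"
    unfolding p_def q_def by measurable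
  have pq: "(\<lambda>x. ennreal (c0 x)) = (\<lambda>x. p x + q x)"
    by (auto simp: p_def q_def indicator_def)
  have p_le: "p x \<le> ennreal (real l)" for x
    by (auto simp: p_def indicator_def intro: ennreal_leI)
  define P where "P = (1 + real l ^ 4) * wt_mass"
  have "0 \<le> P"
    using wt_mass_pos by (simp add: P_def)
  have p4: "(\<integral>\<^sup>+ x. ennreal (1 + x ^ 4) * p x \<partial>lborel) \<le> ennreal P"
  proof -
    have "(\<integral>\<^sup>+ x. ennreal (1 + x ^ 4) * p x \<partial>lborel) \<le> (\<integral>\<^sup>+ x. ennreal (1 + real l ^ 4) * ennreal (c0 x) \<partial>lborel)"
    proof (intro nn_integral_mono)
      fix x
      have "x ^ 4 \<le> real l ^ 4" if "\<bar>x\<bar> \<le> real l"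
        using power_mono[OF that, of 4] by simp
      then show "ennreal (1 + x ^ 4) * p x \<le> ennreal (1 + real l ^ 4) * ennreal (c0 x)"
        by (auto simp: p_def indicator_def intro!: mult_right_mono ennreal_leI)
    qed
    also have "\<dots> = ennreal (1 + real l ^ 4) * (\<integral>\<^sup>+ x. ennreal (c0 x) \<partial>lborel)"
      by (rule nn_integral_cmult) measurable
    also have "\<dots> \<le> ennreal (1 + real l ^ 4) * ennreal wt_mass"
      by (intro mult_left_mono nn_c0_le) simp
    also have "\<dots> = ennreal P"
      using wt_mass_pos by (simp add: P_def ennreal_mult)
    finally show ?thesis .
  qed
  \<comment> \<open>Chosen so that 2 / wt r times the evolved fourth moment is at most e / 2; for
    this it is enough that r \<le> wt r.\<close>
  define r where "r = 4 * total_growth * P / e"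
  have "0 \<le> r"
    using \<open>0 \<le> P\<close> E assms by (simp add: r_def)
  have tail: "2 / wt r * (total_growth * P) \<le> e / 2"
  proof -
    have "r \<le> wt r"
      using zero_le_power2[of "r - 1 / 2"] by (simp add: wt_def power2_eq_square algebra_simps)
    then have "4 * total_growth * P \<le> e * wt r"
      using assms by (simp add: r_def field_simps)
    then show ?thesis
      using wt_pos[of r] by (simp add: field_simps)
  qed
  \<comment> \<open>Bounds the weight times the evolved bounded part on [-r, r].\<close>
  define L where "L = wt r * (real l * total_growth)"
  have "0 \<le> L"
    using wt_pos[of r] E by (simp add: L_def)
  have "(\<integral>\<^sup>+ x. g x * (ennreal (wt x) * euler n k x) \<partial>lborel) \<le>
      ennreal L * (\<integral>\<^sup>+ x. g x * indicator {-r..r} x \<partial>lborel) + ennreal e"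
    if nk: "0 < n" "k \<le> n" and [measurable]: "g \<in> borel_measurable borel" and g: "\<And>x. g x \<le> 1" for n k g
  proof -
    let ?p = "evolve n p k" and ?q = "evolve n q k"
    have "euler n k = (\<lambda>x. ?p x + ?q x)"
      unfolding evolve_c0[symmetric] pq by (rule evolve_add) measurable
    then have "(\<integral>\<^sup>+ x. g x * (ennreal (wt x) * euler n k x) \<partial>lborel) =
        (\<integral>\<^sup>+ x. g x * (ennreal (wt x) * ?p x) + g x * (ennreal (wt x) * ?q x) \<partial>lborel)"
      by (simp add: distrib_left)
    \<comment> \<open>Inside [-r, r] the bounded part is controlled by its height, outside by its
      fourth moment. The remainder is controlled by its weighted mass alone, as
      \<open>g \<le> 1\<close>.\<close>
    also have "\<dots> \<le> (\<integral>\<^sup>+ x. (ennreal L * (g x * indicator {-r..r} x) +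
        ennreal (2 / wt r) * (ennreal (1 + x ^ 4) * ?p x)) + ennreal (wt x) * ?q x \<partial>lborel)"
    proof (intro nn_integral_mono_AE)
      have "AE x in lborel. ?p x \<le> ennreal (real l) * growth_factor n ^ k"
        using p_le nk by (intro evolve_AE_le) auto
      then show "AE x in lborel. g x * (ennreal (wt x) * ?p x) + g x * (ennreal (wt x) * ?q x) \<le>
        (ennreal L * (g x * indicator {-r..r} x) + ennreal (2 / wt r) * (ennreal (1 + x ^ 4) * ?p x)) +
          ennreal (wt x) * ?q x"
      proof (rule eventually_mono)
        fix x
        assume "?p x \<le> ennreal (real l) * growth_factor n ^ k"
        also have "\<dots> \<le> ennreal (real l) * ennreal total_growth"
          by (intro mult_left_mono growth_factor_power nk) simp
        finally have px: "?p x \<le> ennreal (real l * total_growth)"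
          using E by (simp add: ennreal_mult)
        have "g x * (ennreal (wt x) * ?p x) \<le>
            ennreal L * (g x * indicator {-r..r} x) + ennreal (2 / wt r) * (ennreal (1 + x ^ 4) * ?p x)"
        proof (cases "\<bar>x\<bar> \<le> r")
          case True
          then have "wt x \<le> wt r"
            unfolding wt_def using power_mono[of "\<bar>x\<bar>" r 2] by simp
          then have "ennreal (wt x) * ?p x \<le> ennreal (wt r) * ennreal (real l * total_growth)"
            by (intro mult_mono px ennreal_leI) auto
          also have "\<dots> = ennreal L"
            using E wt_pos[of r] by (simp add: L_def ennreal_mult)
          finally have "g x * (ennreal (wt x) * ?p x) \<le> g x * ennreal L"
            by (rule mult_left_mono) simp
          also have "\<dots> = ennreal L * (g x * indicator {-r..r} x)"
            using True by (simp add: mult.commute abs_le_iff)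
          finally show ?thesis
            by (rule add_increasing2[rotated]) simp
        next
          case False
          then have "wt x \<le> 2 / wt r * (1 + x ^ 4)"
            using \<open>0 \<le> r\<close> by (intro wt_tail) auto
          then have "ennreal (wt x) \<le> ennreal (2 / wt r * (1 + x ^ 4))"
            by (rule ennreal_leI)
          also have "\<dots> = ennreal (2 / wt r) * ennreal (1 + x ^ 4)"
            using wt_pos[of r] by (intro ennreal_mult) auto
          finally have "g x * (ennreal (wt x) * ?p x) \<le> 1 * (ennreal (2 / wt r) * ennreal (1 + x ^ 4) * ?p x)"
            using g by (intro mult_mono) auto
          then show ?thesis
            by (simp add: mult.assoc add_increasing)
        qed
        moreover have "g x * (ennreal (wt x) * ?q x) \<le> 1 * (ennreal (wt x) * ?q x)"
          by (intro mult_right_mono g) simp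
        ultimately show "g x * (ennreal (wt x) * ?p x) + g x * (ennreal (wt x) * ?q x) \<le>
          (ennreal L * (g x * indicator {-r..r} x) + ennreal (2 / wt r) * (ennreal (1 + x ^ 4) * ?p x)) +
            ennreal (wt x) * ?q x"
          by (intro add_mono) simp_all
      qed
    qed
    also have "\<dots> = ennreal L * (\<integral>\<^sup>+ x. g x * indicator {-r..r} x \<partial>lborel) +
        ennreal (2 / wt r) * (\<integral>\<^sup>+ x. ennreal (1 + x ^ 4) * ?p x \<partial>lborel) +
        (\<integral>\<^sup>+ x. ennreal (wt x) * ?q x \<partial>lborel)"
      by (simp add: nn_integral_add nn_integral_cmult)
    also have "(\<integral>\<^sup>+ x. ennreal (1 + x ^ 4) * ?p x \<partial>lborel) \<le> ennreal total_growth * ennreal P"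
    proof -
      have "(\<integral>\<^sup>+ x. ennreal (1 + x ^ 4) * ?p x \<partial>lborel) \<le>
          growth_factor n ^ k * (\<integral>\<^sup>+ x. ennreal (1 + x ^ 4) * p x \<partial>lborel)"
        using fourth_moment_growth nk by (intro evolve_moment_le[where C = 28]) auto
      also have "\<dots> \<le> ennreal total_growth * ennreal P"
        by (intro mult_mono growth_factor_power p4 nk) auto
      finally show ?thesis .
    qed
    also have "(\<integral>\<^sup>+ x. ennreal (wt x) * ?q x \<partial>lborel) \<le> ennreal total_growth * ennreal (e / (2 * total_growth))"
    proof -
      have "(\<integral>\<^sup>+ x. ennreal (wt x) * ?q x \<partial>lborel) \<le>
          growth_factor n ^ k * (\<integral>\<^sup>+ x. ennreal (wt x) * q x \<partial>lborel)"
        using wt_growth wt_pos nk by (intro evolve_moment_le[where C = 2]) (auto simp: less_imp_le)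
      also have "\<dots> \<le> ennreal total_growth * ennreal (e / (2 * total_growth))"
        using l unfolding q_def by (intro mult_mono growth_factor_power nk) auto
      finally show ?thesis .
    qed
    also have "ennreal total_growth * ennreal (e / (2 * total_growth)) = ennreal (e / 2)"
      using E assms by (simp flip: ennreal_mult)
    also have "ennreal (2 / wt r) * (ennreal total_growth * ennreal P) = ennreal (2 / wt r * (total_growth * P))"
      using E \<open>0 \<le> P\<close> wt_pos[of r]
      by (simp only: ennreal_mult zero_le_mult_iff zero_le_divide_iff less_imp_le zero_le_numeral simp_thms)
    also have "\<dots> \<le> ennreal (e / 2)"
      by (rule ennreal_leI[OF tail])
    also have "ennreal L * (\<integral>\<^sup>+ x. g x * indicator {-r..r} x \<partial>lborel) + ennreal (e / 2) + ennreal (e / 2) =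
        ennreal L * (\<integral>\<^sup>+ x. g x * indicator {-r..r} x \<partial>lborel) + ennreal e"
      using assms by (simp add: add.assoc flip: ennreal_plus)
    finally show ?thesis
      by (auto simp: add_left_mono add_right_mono mult_left_mono)
  qed
  with \<open>0 \<le> L\<close> \<open>0 \<le> r\<close> show ?thesis
    by (rule that)
qed

text \<open>The growth \<open>wt x * wt y\<close> of the kernel is absorbed by the weighted masses
  of the two partners, hence a bound independent of n and k. No weight is left over, so
  \<open>g\<close> has to be bounded.\<close>

lemma euler_flux_le:
  assumes nk: "0 < n" "k \<le> n" and [measurable]: "case_prod g \<in> borel_measurable (borel \<Otimes>\<^sub>M borel)"
    and g: "\<And>x z. g x z \<le> ennreal C" and "0 \<le> C"
  shows "(\<integral>\<^sup>+ x. \<integral>\<^sup>+ z. rate n (euler n k) x z * euler n k x * g x z \<partial>lborel \<partial>lborel) \<le>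
    ennreal (C * phi_norm * bound\<^sup>2)"
proof -
  let ?u = "euler n k"
  have "(\<integral>\<^sup>+ x. \<integral>\<^sup>+ z. rate n ?u x z * ?u x * g x z \<partial>lborel \<partial>lborel) \<le>
      (\<integral>\<^sup>+ x. \<integral>\<^sup>+ z. ennreal (\<phi> z) * (ennreal (C * bound) * (ennreal (wt x) * ?u x)) \<partial>lborel \<partial>lborel)"
  proof (intro nn_integral_mono)
    fix x z
    have "rate n ?u x z * ?u x * g x z \<le> ennreal (wt x * \<phi> z) * ennreal bound * ?u x * ennreal C"
      by (intro mult_mono euler_rate_le nk g) auto
    also have "\<dots> = ennreal (\<phi> z) * (ennreal (C * bound) * (ennreal (wt x) * ?u x))"
      using \<open>0 \<le> C\<close> bound_pos phi_nonneg[of z] wt_pos[of x] by (simp add: ennreal_mult mult_ac)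
    finally show "rate n ?u x z * ?u x * g x z \<le> ennreal (\<phi> z) * (ennreal (C * bound) * (ennreal (wt x) * ?u x))" .
  qed
  also have "\<dots> = (\<integral>\<^sup>+ z. ennreal (\<phi> z) \<partial>lborel) * (ennreal (C * bound) * (\<integral>\<^sup>+ x. ennreal (wt x) * ?u x \<partial>lborel))"
    by (simp add: nn_integral_multc nn_integral_cmult)
  also have "\<dots> \<le> ennreal phi_norm * (ennreal (C * bound) * ennreal bound)"
    by (intro mult_mono nn_phi euler_wt_le nk) auto
  also have "\<dots> = ennreal (C * phi_norm * bound\<^sup>2)"
    using \<open>0 \<le> C\<close> bound_pos phi_norm_pos by (simp add: ennreal_mult power2_eq_square mult_ac)
  finally show ?thesis .
qed

lemma euler_balance:
  assumes nk: "0 < n" "k \<le> n" and [measurable]: "f \<in> borel_measurable borel"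
  shows "(\<integral>\<^sup>+ x. f x * euler n (Suc k) x \<partial>lborel) + ennreal (tau n) *
      (\<integral>\<^sup>+ x. \<integral>\<^sup>+ z. rate n (euler n k) x z * euler n k x * (2 * f x) \<partial>lborel \<partial>lborel) =
    (\<integral>\<^sup>+ x. f x * euler n k x \<partial>lborel) + ennreal (tau n) *
      (\<integral>\<^sup>+ x. \<integral>\<^sup>+ z. rate n (euler n k) x z * euler n k x * (f (x + z) + f (x - z)) \<partial>lborel \<partial>lborel)"
  unfolding euler.simps by (rule jump_step_balance) (use euler_stable[OF nk] in auto)

end

section \<open>Weak compactness of equi-integrable measures\<close>

text \<open>The approximation is asked only from some N on, because for sequences at nearby times
  the error contains the step length, which is small only eventually.\<close>

lemma convergent_approx:
  fixes x :: "nat \<Rightarrow> real"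
  assumes "\<And>e. 0 < e \<Longrightarrow> \<exists>y. convergent y \<and> (\<exists>N. \<forall>n\<ge>N. \<bar>x n - y n\<bar> \<le> e)"
  shows "convergent x"
proof (rule Cauchy_convergent, rule CauchyI)
  fix e :: real assume "0 < e"
  then obtain y N where "convergent y" and N: "\<And>n. n \<ge> N \<Longrightarrow> \<bar>x n - y n\<bar> \<le> e / 4"
    using assms[of "e / 4"] by auto
  then obtain M where M: "\<And>m n. m \<ge> M \<Longrightarrow> n \<ge> M \<Longrightarrow> norm (y m - y n) < e / 4"
    using convergent_Cauchy CauchyD[of y "e / 4"] \<open>0 < e\<close> by (metis divide_pos_pos zero_less_numeral)
  have "norm (x m - x n) < e" if "m \<ge> max M N" "n \<ge> max M N" for m n
    using N[of m] N[of n] M[of m n] that \<open>0 < e\<close> unfolding real_norm_def by linarith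
  then show "\<exists>M. \<forall>m\<ge>M. \<forall>n\<ge>M. norm (x m - x n) < e"
    by blast
qed

lemma tendsto_zero_approx:
  fixes x :: "nat \<Rightarrow> real"
  assumes "\<And>e. 0 < e \<Longrightarrow> \<exists>y. y \<longlonglongrightarrow> 0 \<and> (\<forall>n. \<bar>x n\<bar> \<le> y n + e)"
  shows "x \<longlonglongrightarrow> 0"
proof (rule LIMSEQ_I)
  fix e :: real assume "0 < e"
  then obtain y where y: "y \<longlonglongrightarrow> 0" and xy: "\<And>n. \<bar>x n\<bar> \<le> y n + e / 2"
    using assms[of "e / 2"] by auto
  obtain N where "\<And>n. n \<ge> N \<Longrightarrow> norm (y n - 0) < e / 2"
    using LIMSEQ_D[OF y, of "e / 2"] \<open>0 < e\<close> by auto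
  then have "\<bar>y n\<bar> < e / 2" if "n \<ge> N" for n
    using that by simp
  then have "norm (x n - 0) < e" if "n \<ge> N" for n
    using xy[of n] that by (force simp: abs_less_iff)
  then show "\<exists>N. \<forall>n\<ge>N. norm (x n - 0) < e"
    by blast
qed

lemma integrable_bounded_borel:
  fixes f :: "real \<Rightarrow> real"
  assumes "finite_measure M" "sets M = sets borel" "f \<in> borel_measurable borel" "\<And>x. \<bar>f x\<bar> \<le> C"
  shows "integrable M f"
  using assms by (intro finite_measure.integrable_const_bound[of M f C]) (auto cong: measurable_cong_sets)

lemma integral_abs_le:
  fixes f :: "'a \<Rightarrow> real"
  assumes "finite_measure M" "\<And>x. \<bar>f x\<bar> \<le> C"
  shows "\<bar>\<integral>x. f x \<partial>M\<bar> \<le> C * measure M (space M)"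
proof (cases "integrable M f")
  case True
  interpret finite_measure M by fact
  have "\<bar>\<integral>x. f x \<partial>M\<bar> \<le> (\<integral>x. C \<partial>M)"
    by (rule order_trans[OF integral_abs_bound integral_mono]) (use True assms in auto)
  then show ?thesis
    by (simp add: mult.commute)
next
  \<comment> \<open>Without integrability the integral is 0 by convention, and C is nonnegative as a
    bound of an absolute value.\<close>
  case False
  have "0 \<le> C"
    using assms(2)[of undefined] by linarith
  with False show ?thesis
    by (simp add: not_integrable_integral_eq)
qed

text \<open>Equi-integrability and tightness in one inequality: on [-r, r] the measures are
  dominated by L times Lebesgue measure up to an error e, and outside their mass is at most e. The
  normalisation \<open>g \<le> 1\<close> makes the error independent of \<open>g\<close>.\<close>

locale equi_integrable =
  fixes \<nu> :: "nat \<Rightarrow> real measure" and B :: real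
  assumes sets_nu [measurable_cong, simp]: "sets (\<nu> n) = sets borel"
    and nu_mass: "emeasure (\<nu> n) UNIV \<le> ennreal B"
    and B_nonneg: "0 \<le> B"
    and uniform: "0 < e \<Longrightarrow> \<exists>L\<ge>0. \<exists>r\<ge>0. \<forall>n. \<forall>g \<in> borel_measurable borel. (\<forall>x. g x \<le> 1) \<longrightarrow>
      (\<integral>\<^sup>+ x. g x \<partial>\<nu> n) \<le> ennreal L * (\<integral>\<^sup>+ x. g x * indicator {-r..r} x \<partial>lborel) + ennreal e"
begin

lemma space_nu [simp]: "space (\<nu> n) = UNIV"
  using sets_eq_imp_space_eq[OF sets_nu] by simp

lemma finite_nu: "finite_measure (\<nu> n)"
  using nu_mass[of n] by (intro finite_measureI) (auto simp: top_unique)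

lemma measure_nu_le: "measure (\<nu> n) A \<le> B"
proof -
  interpret finite_measure "\<nu> n" by (rule finite_nu)
  have "measure (\<nu> n) A \<le> measure (\<nu> n) UNIV"
    using bounded_measure[of A] by simp
  also have "\<dots> \<le> B"
    using nu_mass[of n] B_nonneg unfolding emeasure_eq_measure by simp
  finally show ?thesis .
qed

lemma uniform_real:
  fixes e :: real
  assumes "0 < e"
  shows "\<exists>L\<ge>0. \<exists>r. \<forall>n. \<forall>g \<in> (borel_measurable borel :: (real \<Rightarrow> real) set). (\<forall>x. 0 \<le> g x) \<longrightarrow> (\<forall>x. g x \<le> 1) \<longrightarrow>
    (\<integral>x. g x \<partial>\<nu> n) \<le> L * (\<integral>x. g x * indicator {-r..r} x \<partial>lborel) + e"
proof -
  obtain L r where L: "0 \<le> L" "0 \<le> r" and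
    *: "\<And>n g. g \<in> borel_measurable borel \<Longrightarrow> (\<And>x. g x \<le> 1) \<Longrightarrow>
      (\<integral>\<^sup>+ x. g x \<partial>\<nu> n) \<le> ennreal L * (\<integral>\<^sup>+ x. g x * indicator {-r..r} x \<partial>lborel) + ennreal e"
    using uniform[OF assms] by blast
  have "(\<integral>x. g x \<partial>\<nu> n) \<le> L * (\<integral>x. g x * indicator {-r..r} x \<partial>lborel) + e"
    if [measurable]: "g \<in> borel_measurable borel" and g: "\<And>x. 0 \<le> g x" "\<And>x. g x \<le> 1" for n and g :: "real \<Rightarrow> real"
  proof -
    interpret finite_measure "\<nu> n" by (rule finite_nu)
    have "integrable lborel (\<lambda>x. g x * indicator {-r..r} x)"
      proof (rule Bochner_Integration.integrable_bound)
      show "integrable lborel (indicator {-r..r} :: real \<Rightarrow> real)"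
        by (rule integrable_real_indicator) (auto simp: emeasure_lborel_Icc_eq)
    qed (use g in \<open>auto simp: indicator_def\<close>)
    then have "(\<integral>\<^sup>+ x. ennreal (g x) * indicator {-r..r} x \<partial>lborel) = ennreal (\<integral>x. g x * indicator {-r..r} x \<partial>lborel)"
      using g by (subst nn_integral_eq_integral[symmetric]) (auto simp: indicator_def intro!: nn_integral_cong)
    moreover have "(\<integral>\<^sup>+ x. ennreal (g x) \<partial>\<nu> n) = ennreal (\<integral>x. g x \<partial>\<nu> n)"
      using g by (intro nn_integral_eq_integral integrable_bounded_borel[of _ _ 1, OF finite_nu]) (auto simp: abs_le_iff intro: order_trans[of _ 0])
    moreover have I: "0 \<le> (\<integral>x. g x * indicator {-r..r} x \<partial>lborel)"
      using g by (intro integral_nonneg_AE) auto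
    ultimately have "ennreal (\<integral>x. g x \<partial>\<nu> n) \<le> ennreal (L * (\<integral>x. g x * indicator {-r..r} x \<partial>lborel) + e)"
      using *[of "\<lambda>x. ennreal (g x)" n] g L assms by (simp add: ennreal_mult ennreal_plus)
    then show ?thesis
      using I L assms by (subst (asm) ennreal_le_iff) auto
  qed
  with L(1) show ?thesis
    by blast
qed

text \<open>Dominated convergence does not apply directly, since the measure moves with n.
  Equi-integrability replaces it by L times Lebesgue measure on a fixed interval, where dominated
  convergence does apply.\<close>

lemma integral_vanishing:
  fixes g :: "nat \<Rightarrow> real \<Rightarrow> real"
  assumes [measurable]: "\<And>n. g n \<in> borel_measurable borel"
    and g: "\<And>n x. \<bar>g n x\<bar> \<le> C" and lim: "\<And>x. (\<lambda>n. g n x) \<longlonglongrightarrow> 0"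
  shows "(\<lambda>n. \<integral>x. g n x \<partial>\<nu> n) \<longlonglongrightarrow> 0"
proof (rule tendsto_zero_approx)
  fix e :: real assume "0 < e"
  \<comment> \<open>The summand 1 keeps the normalising divisor positive when C is 0.\<close>
  define D where "D = C + 1"
  have D: "0 < D" "\<bar>g n x\<bar> / D \<le> 1" for n x
    using g[of n x] by (auto simp: D_def field_simps)
  with \<open>0 < e\<close> have "0 < e / D"
    by simp
  obtain L r where Lr: "0 \<le> L" and
    *: "\<And>n g. g \<in> borel_measurable borel \<Longrightarrow> (\<And>x. 0 \<le> g x) \<Longrightarrow> (\<And>x. g x \<le> 1) \<Longrightarrow>
      (\<integral>x. g x \<partial>\<nu> n) \<le> L * (\<integral>x. g x * indicator {-r..r} x \<partial>lborel) + e / D"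
    using uniform_real[OF \<open>0 < e / D\<close>] by blast
  let ?y = "\<lambda>n. D * (L * (\<integral>x. \<bar>g n x\<bar> / D * indicator {-r..r} x \<partial>lborel))"
  have "(\<lambda>n. \<integral>x. \<bar>g n x\<bar> / D * indicator {-r..r} x \<partial>lborel) \<longlonglongrightarrow> (\<integral>(x::real). 0 \<partial>lborel)"
  proof (rule integral_dominated_convergence[where w = "indicator {-r..r}"])
    show "integrable lborel (indicator {-r..r} :: real \<Rightarrow> real)"
      by (rule integrable_real_indicator) (auto simp: emeasure_lborel_Icc_eq)
    show "AE x in lborel. (\<lambda>n. \<bar>g n x\<bar> / D * indicator {-r..r} x) \<longlonglongrightarrow> 0"
      using lim by (intro AE_I2 tendsto_mult_left_zero tendsto_divide_zero tendsto_rabs_zero)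
    show "AE x in lborel. norm (\<bar>g n x\<bar> / D * indicator {-r..r} x) \<le> indicator {-r..r} x" for n
      using D by (auto simp: indicator_def)
  qed auto
  then have "?y \<longlonglongrightarrow> 0"
    by (intro tendsto_mult_right_zero) simp
  moreover have "\<bar>\<integral>x. g n x \<partial>\<nu> n\<bar> \<le> ?y n + e" for n
  proof -
    interpret finite_measure "\<nu> n" by (rule finite_nu)
    have "\<bar>\<integral>x. g n x \<partial>\<nu> n\<bar> \<le> (\<integral>x. \<bar>g n x\<bar> \<partial>\<nu> n)"
      by (rule integral_abs_bound)
    also have "\<dots> = D * (\<integral>x. \<bar>g n x\<bar> / D \<partial>\<nu> n)"
      using D(1) by simp
    also have "\<dots> \<le> D * (L * (\<integral>x. \<bar>g n x\<bar> / D * indicator {-r..r} x \<partial>lborel) + e / D)"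
      using D by (intro mult_left_mono *) (auto simp: less_imp_le)
    also have "\<dots> = ?y n + e"
      using D(1) by (simp add: distrib_left)
    finally show ?thesis .
  qed
  ultimately show "\<exists>y. y \<longlonglongrightarrow> 0 \<and> (\<forall>n. \<bar>\<integral>x. g n x \<partial>\<nu> n\<bar> \<le> y n + e)"
    by blast
qed

text \<open>Continuity from above at the empty set, uniformly in n: Lebesgue measure on one bounded
  interval controls all the measures at once. In the two lemmas that follow it replaces the
  continuity of a single measure.\<close>

lemma measure_small:
  assumes [measurable]: "\<And>i. D i \<in> sets borel" and D: "decseq D" "(\<Inter>i. D i) = {}" and "0 < e"
  shows "\<exists>k. \<forall>n. \<forall>i\<ge>k. measure (\<nu> n) (D i) \<le> e"
proof -
  have "0 < e / 2"
    using \<open>0 < e\<close> by simp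
  obtain L r where Lr: "0 \<le> L" and
    *: "\<And>n g. g \<in> borel_measurable borel \<Longrightarrow> (\<And>x. 0 \<le> g x) \<Longrightarrow> (\<And>x. g x \<le> 1) \<Longrightarrow>
      (\<integral>x. g x \<partial>\<nu> n) \<le> L * (\<integral>x. g x * indicator {-r..r} x \<partial>lborel) + e / 2"
    using uniform_real[OF \<open>0 < e / 2\<close>] by blast
  have "(\<lambda>i. \<integral>x. indicator (D i) x * indicator {-r..r} x \<partial>lborel) \<longlonglongrightarrow> (\<integral>(x::real). (0::real) \<partial>lborel)"
  proof (rule integral_dominated_convergence[where w = "indicator {-r..r}"])
    show "integrable lborel (indicator {-r..r} :: real \<Rightarrow> real)"
      by (rule integrable_real_indicator) (auto simp: emeasure_lborel_Icc_eq)
    show "AE x in lborel. (\<lambda>i. indicator (D i) x * indicator {-r..r} x) \<longlonglongrightarrow> (0::real)"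
    proof (rule AE_I2, rule tendsto_mult_left_zero)
      fix x
      obtain i where "x \<notin> D i"
        using D by auto
      then have "indicator (D j) x = (0::real)" if "i \<le> j" for j
        using that D(1) by (auto simp: decseq_def indicator_def)
      then show "(\<lambda>i. indicator (D i) x) \<longlonglongrightarrow> (0::real)"
        by (intro tendsto_eventually eventually_sequentiallyI[of i])
    qed
  qed (auto simp: indicator_def)
  then have "(\<lambda>i. L * (\<integral>x. indicator (D i) x * indicator {-r..r} x \<partial>lborel)) \<longlonglongrightarrow> 0"
    by (auto intro: tendsto_mult_right_zero)
  then have "\<forall>\<^sub>F i in sequentially. L * (\<integral>x. indicator (D i) x * indicator {-r..r} x \<partial>lborel) < e / 2"
    using \<open>0 < e\<close> by (intro order_tendstoD) auto
  then obtain k where k: "\<And>i. i \<ge> k \<Longrightarrow> L * (\<integral>x. indicator (D i) x * indicator {-r..r} x \<partial>lborel) < e / 2"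
    by (auto simp: eventually_sequentially)
  have "measure (\<nu> n) (D i) \<le> e" if "i \<ge> k" for n i
    using *[of "indicator (D i)" n] k[OF that] by simp
  then show ?thesis
    by blast
qed

text \<open>Uniform smallness lets convergence pass from rational half-lines to all half-lines, and
  through countable disjoint unions, where the tails are small for all n together. The half-lines
  form an intersection stable generator, so an induction over disjoint unions and complements
  reaches every Borel set.\<close>

lemma convergent_measure:
  assumes atMost: "\<And>q. q \<in> \<rat> \<Longrightarrow> convergent (\<lambda>n. measure (\<nu> n) {..q})"
    and UNIV: "convergent (\<lambda>n. measure (\<nu> n) UNIV)"
    and A: "A \<in> sets borel"
  shows "convergent (\<lambda>n. measure (\<nu> n) A)"
proof -
  have real_atMost: "convergent (\<lambda>n. measure (\<nu> n) {..a})" for a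
  proof (rule convergent_approx)
    fix e :: real assume "0 < e"
    have "a < a + 1 / real (Suc i)" for i
      by simp
    then have "\<exists>q\<in>\<rat>. a < q \<and> q < a + 1 / real (Suc i)" for i
      by (rule Rats_dense_in_real)
    then obtain q where q: "\<And>i. q i \<in> \<rat>" "\<And>i. a < q i" "\<And>i. q i < a + 1 / real (Suc i)"
      by metis
    have "(\<Inter>i. {a<..a + 1 / real (Suc i)}) = {}"
    proof (rule ccontr)
      assume "(\<Inter>i. {a<..a + 1 / real (Suc i)}) \<noteq> {}"
      then obtain x where x: "\<And>i. a < x \<and> x \<le> a + 1 / real (Suc i)"
        by fastforce
      then obtain i where "inverse (real (Suc i)) < x - a"
        using reals_Archimedean[of "x - a"] by auto
      with x[of i] show False
        by (simp add: inverse_eq_divide)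
    qed
    moreover have "decseq (\<lambda>i. {a<..a + 1 / real (Suc i)})"
    proof (rule decseq_SucI, rule subsetI)
      fix i x assume x: "x \<in> {a<..a + 1 / real (Suc (Suc i))}"
      have "1 / real (Suc (Suc i)) \<le> 1 / real (Suc i)"
        by (intro divide_left_mono) auto
      with x show "x \<in> {a<..a + 1 / real (Suc i)}"
        by auto
    qed
    ultimately have "\<exists>k. \<forall>n. \<forall>i\<ge>k. measure (\<nu> n) {a<..a + 1 / real (Suc i)} \<le> e"
      using \<open>0 < e\<close> by (intro measure_small) auto
    then obtain k where k: "\<And>n i. i \<ge> k \<Longrightarrow> measure (\<nu> n) {a<..a + 1 / real (Suc i)} \<le> e"
      by blast
    have "\<bar>measure (\<nu> n) {..a} - measure (\<nu> n) {..q k}\<bar> \<le> e" for n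
    proof -
      interpret finite_measure "\<nu> n" by (rule finite_nu)
      have "{..q k} = {..a} \<union> {a<..q k}" "{..a} \<inter> {a<..q k} = {}"
        using q(2)[of k] by auto
      then have "measure (\<nu> n) {..q k} = measure (\<nu> n) {..a} + measure (\<nu> n) {a<..q k}"
        by (simp add: finite_measure_Union)
      moreover have "measure (\<nu> n) {a<..q k} \<le> measure (\<nu> n) {a<..a + 1 / real (Suc k)}"
        using q(3)[of k] by (intro finite_measure_mono) auto
      ultimately show ?thesis
        using k[of k n] by simp
    qed
    then show "\<exists>y. convergent y \<and> (\<exists>N. \<forall>n\<ge>N. \<bar>measure (\<nu> n) {..a} - y n\<bar> \<le> e)"
      using atMost[OF q(1)[of k]] by blast
  qed
  have borel: "sets borel = sigma_sets UNIV (range (\<lambda>a::real. {..a}))"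
    unfolding borel_eq_atMost by (rule sets_measure_of) auto
  have "Int_stable (range (\<lambda>a::real. {..a}))" "range (\<lambda>a::real. {..a}) \<subseteq> Pow UNIV"
    by (auto simp: Int_stable_def)
  from this A[unfolded borel] show ?thesis
  proof (induction rule: sigma_sets_induct_disjoint)
    case (basic A)
    then show ?case
      using real_atMost by auto
  next
    case (compl A)
    then have [measurable]: "A \<in> sets borel"
      unfolding borel by simp
    have "measure (\<nu> n) (UNIV - A) = measure (\<nu> n) UNIV - measure (\<nu> n) A" for n
    proof -
      interpret finite_measure "\<nu> n" by (rule finite_nu)
      show ?thesis
        using finite_measure_compl[of A] by simp
    qed
    then show ?case
      using compl UNIV by (simp add: convergent_diff)
  next
    case (union A)
    then have A [measurable]: "A i \<in> sets borel" for i
      unfolding borel by auto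
    let ?D = "\<lambda>k. \<Union>i\<in>{k..}. A i"
    have [measurable]: "?D k \<in> sets borel" for k
      by measurable
    show ?case
    proof (rule convergent_approx)
      fix e :: real assume "0 < e"
      \<comment> \<open>By disjointness a point belongs to at most one of the sets, so it eventually
        leaves the tails.\<close>
      have "(\<Inter>k. ?D k) = {}"
      proof (rule ccontr)
        assume "(\<Inter>k. ?D k) \<noteq> {}"
        then obtain x where "\<And>k. x \<in> ?D k"
          by blast
        then have x: "\<exists>i\<ge>k. x \<in> A i" for k
          by auto
        obtain i where "x \<in> A i"
          using x[of 0] by auto
        moreover obtain j where "j \<ge> Suc i" "x \<in> A j"
          using x[of "Suc i"] by auto
        ultimately show False
          using disjoint_family_onD[OF union(1), of i j] by auto
      qed
      moreover have "decseq ?D"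
        by (intro decseq_SucI) force
      moreover have "?D k \<in> sets borel" for k
        by measurable
      ultimately have "\<exists>k. \<forall>n. \<forall>i\<ge>k. measure (\<nu> n) (?D i) \<le> e"
        using \<open>0 < e\<close> by (intro measure_small)
      then obtain k where k: "\<And>n. measure (\<nu> n) (?D k) \<le> e"
        by blast
      have "measure (\<nu> n) (\<Union>i. A i) = (\<Sum>i<k. measure (\<nu> n) (A i)) + measure (\<nu> n) (?D k)" for n
      proof -
        interpret finite_measure "\<nu> n" by (rule finite_nu)
        have "(UNIV :: nat set) = {..<k} \<union> {k..}"
          by auto
        then have "(\<Union>i. A i) = (\<Union>i<k. A i) \<union> ?D k"
          by (metis UN_Un)
        moreover have "(\<Union>i<k. A i) \<inter> ?D k = {}"
        proof (rule equals0I)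
          fix x assume "x \<in> (\<Union>i<k. A i) \<inter> ?D k"
          then obtain i j where "i < k" "k \<le> j" "x \<in> A i" "x \<in> A j"
            by auto
          with disjoint_family_onD[OF union(1), of i j] show False
            by auto
        qed
        ultimately have "measure (\<nu> n) (\<Union>i. A i) = measure (\<nu> n) (\<Union>i<k. A i) + measure (\<nu> n) (?D k)"
          by (simp add: finite_measure_Union)
        moreover have "measure (\<nu> n) (\<Union>i<k. A i) = (\<Sum>i<k. measure (\<nu> n) (A i))"
          using union(1) by (intro finite_measure_finite_Union) (auto simp: disjoint_family_on_def)
        ultimately show ?thesis
          by simp
      qed
      then have "\<bar>measure (\<nu> n) (\<Union>i. A i) - (\<Sum>i<k. measure (\<nu> n) (A i))\<bar> \<le> e" for n
        using k[of n] by simp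
      moreover have "convergent (\<lambda>n. \<Sum>i<k. measure (\<nu> n) (A i))"
        using union(3) by (intro convergent_sum)
      ultimately show "\<exists>y. convergent y \<and> (\<exists>N. \<forall>n\<ge>N. \<bar>measure (\<nu> n) (\<Union>i. A i) - y n\<bar> \<le> e)"
        by blast
    qed
  qed (auto simp: convergent_const)
qed

text \<open>An argument of Vitali-Hahn-Saks type, in which the uniform smallness of tails is known
  beforehand and makes the limit countably additive. Radon-Nikodym then yields a density, since the
  domination by Lebesgue measure holds for every n and is inherited by the limit.\<close>

lemma ex_limit_density:
  assumes conv: "\<And>A. A \<in> sets borel \<Longrightarrow> convergent (\<lambda>n. measure (\<nu> n) A)"
  obtains d :: "real \<Rightarrow> real" where "d \<in> borel_measurable borel" "\<And>x. 0 \<le> d x"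
    "finite_measure (density lborel (\<lambda>x. ennreal (d x)))"
    "\<And>A. A \<in> sets borel \<Longrightarrow> (\<lambda>n. measure (\<nu> n) A) \<longlonglongrightarrow> measure (density lborel (\<lambda>x. ennreal (d x))) A"
proof -
  define m where "m A = lim (\<lambda>n. measure (\<nu> n) A)" for A
  have m: "(\<lambda>n. measure (\<nu> n) A) \<longlonglongrightarrow> m A" if "A \<in> sets borel" for A
    using conv[OF that] unfolding m_def by (simp add: convergent_LIMSEQ_iff)
  have m_nonneg: "0 \<le> m A" if "A \<in> sets borel" for A
    by (rule LIMSEQ_le_const[OF m[OF that]]) simp
  have m_empty: "m {} = 0"
    using m[of "{}"] by (simp add: LIMSEQ_const_iff)
  define N where "N = measure_of UNIV (sets borel) (\<lambda>A. ennreal (m A))"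
  have N_sets [simp, measurable_cong]: "sets N = sets borel"
    unfolding N_def using sets.sigma_sets_eq[of "borel :: real measure"] by simp
  have N_emeasure: "emeasure N A = ennreal (m A)" if A: "A \<in> sets borel" for A
    unfolding N_def
  proof (rule emeasure_measure_of_sigma)
    show "sigma_algebra UNIV (sets (borel :: real measure))"
      using sets.sigma_algebra_axioms[of "borel :: real measure"] by simp
    show "positive (sets borel) (\<lambda>A. ennreal (m A))"
      by (simp add: positive_def m_empty)
    show "countably_additive (sets borel) (\<lambda>A. ennreal (m A))"
      unfolding countably_additive_def
    proof (intro allI impI)
      fix A :: "nat \<Rightarrow> real set"
      assume "range A \<subseteq> sets borel" and disj: "disjoint_family A" and U [measurable]: "(\<Union>i. A i) \<in> sets borel"
      then have A [measurable]: "A i \<in> sets borel" for i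
        by auto
      let ?D = "\<lambda>k. (\<Union>i. A i) - (\<Union>i<k. A i)"
      have empty: "(\<Inter>k. ?D k) = {}"
        by auto
      have "decseq ?D"
        by (intro decseq_SucI) auto
      have small: "\<exists>k. \<forall>n. \<forall>i\<ge>k. measure (\<nu> n) (?D i) \<le> e" if "0 < e" for e
        by (rule measure_small[OF _ \<open>decseq ?D\<close> empty that]) measurable
      have split: "measure (\<nu> n) (\<Union>i. A i) = (\<Sum>i<k. measure (\<nu> n) (A i)) + measure (\<nu> n) (?D k)" for n k
      proof -
        interpret finite_measure "\<nu> n" by (rule finite_nu)
        have "measure (\<nu> n) (\<Union>i<k. A i) = (\<Sum>i<k. measure (\<nu> n) (A i))"
        proof (rule finite_measure_finite_Union)
          show "disjoint_family_on A {..<k}"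
            by (rule disjoint_family_on_mono[OF _ disj]) simp
        qed (simp_all add: image_subset_iff)
        moreover have "measure (\<nu> n) (?D k) = measure (\<nu> n) (\<Union>i. A i) - measure (\<nu> n) (\<Union>i<k. A i)"
        proof (rule finite_measure_Diff)
          show "(\<Union>i. A i) \<in> sets (\<nu> n)"
            unfolding sets_nu by (rule U)
          show "(\<Union>i<k. A i) \<in> sets (\<nu> n)"
            unfolding sets_nu by measurable
          show "(\<Union>i<k. A i) \<subseteq> (\<Union>i. A i)"
            by (rule UN_mono) simp_all
        qed
        ultimately show ?thesis
          by simp
      qed
      have "(\<lambda>i. m (A i)) sums m (\<Union>i. A i)"
        unfolding sums_def
      proof (rule LIMSEQ_I)
        fix e :: real assume "0 < e"
        then obtain k where k: "\<And>i n. k \<le> i \<Longrightarrow> measure (\<nu> n) (?D i) \<le> e / 2"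
          using small[of "e / 2"] by force
        have "\<bar>(\<Sum>j<i. m (A j)) - m (\<Union>i. A i)\<bar> \<le> e / 2" if "k \<le> i" for i
        proof (rule LIMSEQ_le_const2)
          show "(\<lambda>n. \<bar>(\<Sum>j<i. measure (\<nu> n) (A j)) - measure (\<nu> n) (\<Union>i. A i)\<bar>) \<longlonglongrightarrow>
              \<bar>(\<Sum>j<i. m (A j)) - m (\<Union>i. A i)\<bar>"
            by (intro tendsto_intros m) auto
          show "\<exists>M. \<forall>n\<ge>M. \<bar>(\<Sum>j<i. measure (\<nu> n) (A j)) - measure (\<nu> n) (\<Union>i. A i)\<bar> \<le> e / 2"
            using k[OF that] unfolding split[of _ i] by simp
        qed
        moreover have "e / 2 < e"
          using \<open>0 < e\<close> by simp
        ultimately show "\<exists>M. \<forall>i\<ge>M. norm ((\<Sum>j<i. m (A j)) - m (\<Union>i. A i)) < e"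
          unfolding real_norm_def by (meson le_less_trans)
      qed
      then show "(\<Sum>i. ennreal (m (A i))) = ennreal (m (\<Union>i. A i))"
        using m_nonneg by (intro suminf_ennreal_eq) auto
    qed
  qed (use A in auto)
  interpret N: finite_measure N
    using N_emeasure[of UNIV] by (intro finite_measureI)
      (simp add: sets_eq_imp_space_eq[OF N_sets])
  have "absolutely_continuous lborel N"
    unfolding absolutely_continuous_def
  proof
    fix A :: "real set" assume A: "A \<in> null_sets lborel"
    then have [measurable]: "A \<in> sets borel"
      by auto
    \<comment> \<open>A Lebesgue null set contributes nothing to the main term, so only the
      arbitrary error e remains.\<close>
    have "m A \<le> 0 + e" if e: "0 < e" for e
    proof -
      obtain L r where
        *: "\<And>n g. g \<in> borel_measurable borel \<Longrightarrow> (\<And>x. 0 \<le> g x) \<Longrightarrow> (\<And>x. g x \<le> 1) \<Longrightarrow>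
          (\<integral>x. g x \<partial>\<nu> n) \<le> L * (\<integral>x. g x * indicator {-r..r} x \<partial>lborel) + e"
        using uniform_real[OF \<open>0 < e\<close>] by blast
      have "(\<integral>x. indicator A x * indicator {-r..r} x \<partial>lborel) = (\<integral>(x::real). (0::real) \<partial>lborel)"
        using AE_not_in[OF A] by (intro integral_cong_AE) (auto elim!: eventually_mono)
      then have "measure (\<nu> n) A \<le> e" for n
        using *[of "indicator A" n] by simp
      then show ?thesis
        by (intro LIMSEQ_le_const2[OF m]) auto
    qed
    then have "m A \<le> 0"
      by (rule field_le_epsilon)
    then show "A \<in> null_sets N"
      using N_emeasure[of A] by (intro null_setsI) (auto simp: ennreal_eq_0_iff)
  qed
  then obtain f where [measurable]: "f \<in> borel_measurable borel" and f: "density lborel f = N"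
    using sigma_finite_measure.Radon_Nikodym[OF sigma_finite_lborel, of N] by auto
  have "(\<integral>\<^sup>+ x. f x \<partial>lborel) = emeasure N UNIV"
    unfolding f[symmetric] by (simp add: emeasure_density)
  \<comment> \<open>The finite total mass makes the extended density finite almost everywhere, so
    that it has a real version.\<close>
  then have "AE x in lborel. f x \<noteq> \<infinity>"
    using N_emeasure[of UNIV] by (intro nn_integral_noteq_infinite) auto
  then have "density lborel (\<lambda>x. ennreal (enn2real (f x))) = N"
    unfolding f[symmetric] by (intro density_cong) (auto elim!: eventually_mono simp: less_top)
  moreover have "measure N A = m A" if "A \<in> sets borel" for A
    using N_emeasure[OF that] m_nonneg[OF that] by (simp add: measure_def)
  ultimately show ?thesis
    using m N.finite_measure_axioms by (intro that[of "\<lambda>x. enn2real (f x)"]) auto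
qed

end

section \<open>Single and double integrals against setwise convergent measures\<close>

locale equi_integrable_limit = equi_integrable +
  fixes \<mu> :: "real measure"
  assumes sets_mu [measurable_cong, simp]: "sets \<mu> = sets borel"
    and finite_mu: "finite_measure \<mu>"
    and measure_tendsto: "A \<in> sets borel \<Longrightarrow> (\<lambda>n. measure (\<nu> n) A) \<longlonglongrightarrow> measure \<mu> A"
begin

lemma space_mu [simp]: "space \<mu> = UNIV"
  using sets_eq_imp_space_eq[OF sets_mu] by simp

lemma measure_mu_le: "measure \<mu> UNIV \<le> B"
  by (rule LIMSEQ_le_const2[OF measure_tendsto]) (auto simp: measure_nu_le)

text \<open>Setwise convergence gives the claim for functions with finitely many values. Rounding
  \<open>k * f x\<close> down gives such a function within 1 / k of \<open>f\<close>, which costs at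
  most B / k for each measure.\<close>

lemma integral_tendsto:
  fixes f :: "real \<Rightarrow> real"
  assumes [measurable]: "f \<in> borel_measurable borel" and f: "\<And>x. \<bar>f x\<bar> \<le> C"
  shows "(\<lambda>n. \<integral>x. f x \<partial>\<nu> n) \<longlonglongrightarrow> (\<integral>x. f x \<partial>\<mu>)"
proof -
  have "(\<lambda>n. (\<integral>x. f x \<partial>\<nu> n) - (\<integral>x. f x \<partial>\<mu>)) \<longlonglongrightarrow> 0"
  proof (rule tendsto_zero_approx)
    fix e :: real assume "0 < e"
    \<comment> \<open>Makes the two rounding errors, together 2 * B / k, at most e; the summand 1
      keeps k positive when B is 0.\<close>
    define k where "k = (2 * B + 1) / e"
    have k: "0 < k" "2 * B / k \<le> e"
      using \<open>0 < e\<close> B_nonneg by (auto simp: k_def field_simps)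
    define s where "s x = real_of_int \<lfloor>k * f x\<rfloor> / k" for x
    have [measurable]: "s \<in> borel_measurable borel"
      unfolding s_def by measurable
    have fs: "\<bar>f x - s x\<bar> \<le> 1 / k" for x
    proof -
      have "\<bar>k * f x - real_of_int \<lfloor>k * f x\<rfloor>\<bar> \<le> 1"
        by linarith
      moreover have "f x - s x = (k * f x - real_of_int \<lfloor>k * f x\<rfloor>) / k"
        using k(1) by (simp add: s_def field_simps)
      ultimately show ?thesis
        using k(1) by (simp add: abs_divide divide_right_mono)
    qed
    define J where "J = {\<lfloor>- (k * C)\<rfloor>..\<lfloor>k * C\<rfloor>}"
    define A where "A j = {x. \<lfloor>k * f x\<rfloor> = j}" for j
    have [measurable]: "A j \<in> sets borel" for j
      unfolding A_def by measurable
    have s: "s = (\<lambda>x. \<Sum>j\<in>J. real_of_int j / k * indicator (A j) x)"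
    proof
      fix x
      have "\<bar>k * f x\<bar> \<le> k * C"
        using f[of x] k(1) by (simp add: abs_mult)
      then have "\<lfloor>k * f x\<rfloor> \<in> J"
        unfolding J_def by (auto intro!: floor_mono simp: abs_le_iff)
      moreover have "(\<Sum>j\<in>J. real_of_int j / k * indicator (A j) x) = (\<Sum>j\<in>J. if \<lfloor>k * f x\<rfloor> = j then real_of_int j / k else 0)"
        by (intro sum.cong) (auto simp: A_def)
      ultimately show "s x = (\<Sum>j\<in>J. real_of_int j / k * indicator (A j) x)"
        by (simp add: s_def J_def)
    qed
    have fin: "\<bar>f x\<bar> \<le> C" "\<bar>s x\<bar> \<le> C + 1 / k" for x
      using f[of x] fs[of x] by auto
    have int: "(\<integral>x. s x \<partial>M) = (\<Sum>j\<in>J. real_of_int j / k * measure M (A j))"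
        "\<bar>(\<integral>x. f x \<partial>M) - (\<integral>x. s x \<partial>M)\<bar> \<le> B / k"
      if M: "finite_measure M" "sets M = sets borel" "measure M UNIV \<le> B" for M
    proof -
      interpret finite_measure M by fact
      note [measurable_cong] = M(2)
      have sp: "space M = UNIV"
        using sets_eq_imp_space_eq[OF M(2)] by simp
      have "integrable M (\<lambda>x. real_of_int j / k * indicator (A j) x)" for j
        by (intro integrable_mult_right integrable_real_indicator) (auto simp: M(2) less_top[symmetric])
      then show "(\<integral>x. s x \<partial>M) = (\<Sum>j\<in>J. real_of_int j / k * measure M (A j))"
        unfolding s by (subst Bochner_Integration.integral_sum) (simp_all add: sp)
      have "(\<integral>x. f x \<partial>M) - (\<integral>x. s x \<partial>M) = (\<integral>x. f x - s x \<partial>M)"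
        using fin by (intro Bochner_Integration.integral_diff[symmetric] integrable_bounded_borel[OF M(1,2)]) auto
      also have "\<bar>\<dots>\<bar> \<le> 1 / k * measure M UNIV"
        using integral_abs_le[OF M(1), of "\<lambda>x. f x - s x" "1 / k"] fs sp by simp
      also have "\<dots> \<le> 1 / k * B"
        using k(1) M(3) by (intro mult_left_mono) auto
      finally show "\<bar>(\<integral>x. f x \<partial>M) - (\<integral>x. s x \<partial>M)\<bar> \<le> B / k"
        by simp
    qed
    let ?y = "\<lambda>n. \<bar>(\<integral>x. s x \<partial>\<nu> n) - (\<integral>x. s x \<partial>\<mu>)\<bar>"
    have "(\<lambda>n. \<integral>x. s x \<partial>\<nu> n) \<longlonglongrightarrow> (\<integral>x. s x \<partial>\<mu>)"
      unfolding int(1)[OF finite_mu sets_mu measure_mu_le] int(1)[OF finite_nu sets_nu measure_nu_le]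
      by (intro tendsto_intros measure_tendsto) auto
    then have "?y \<longlonglongrightarrow> 0"
      by (simp add: LIM_zero_iff tendsto_rabs_zero_iff)
    moreover have "\<bar>(\<integral>x. f x \<partial>\<nu> n) - (\<integral>x. f x \<partial>\<mu>)\<bar> \<le> ?y n + e" for n
      using int(2)[OF finite_mu sets_mu measure_mu_le] int(2)[OF finite_nu sets_nu measure_nu_le, of n] k(2)
      by linarith
    ultimately show "\<exists>y. y \<longlonglongrightarrow> 0 \<and> (\<forall>n. \<bar>(\<integral>x. f x \<partial>\<nu> n) - (\<integral>x. f x \<partial>\<mu>)\<bar> \<le> y n + e)"
      by blast
  qed
  then show ?thesis
    by (rule LIM_zero_cancel)
qed

text \<open>Both factors of the product converge only weakly. Still, for fixed x the inner integral
  converges, because arbitrary bounded Borel functions may serve as test functions. As a function of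
  x it is bounded and pointwise convergent, and so it can be treated in the outer integral as
  \<open>H n\<close> was in the inner one.\<close>

lemma double_integral_tendsto:
  fixes H :: "nat \<Rightarrow> real \<Rightarrow> real \<Rightarrow> real" and G :: "real \<Rightarrow> real \<Rightarrow> real"
  assumes [measurable]: "\<And>n. case_prod (H n) \<in> borel_measurable (borel \<Otimes>\<^sub>M borel)"
      "case_prod G \<in> borel_measurable (borel \<Otimes>\<^sub>M borel)"
    and H: "\<And>n x y. \<bar>H n x y\<bar> \<le> C" and G: "\<And>x y. \<bar>G x y\<bar> \<le> C"
    and lim: "\<And>x y. (\<lambda>n. H n x y) \<longlonglongrightarrow> G x y"
  shows "(\<lambda>n. \<integral>x. \<integral>y. H n x y \<partial>\<nu> n \<partial>\<nu> n) \<longlonglongrightarrow> (\<integral>x. \<integral>y. G x y \<partial>\<mu> \<partial>\<mu>)"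
proof -
  have [measurable]: "(\<lambda>x. \<integral>y. H n x y \<partial>\<nu> n) \<in> borel_measurable borel" for n
  proof -
    interpret finite_measure "\<nu> n" by (rule finite_nu)
    show ?thesis by measurable
  qed
  have [measurable]: "(\<lambda>x. \<integral>y. G x y \<partial>\<mu>) \<in> borel_measurable borel"
  proof -
    interpret finite_measure \<mu> by (rule finite_mu)
    show ?thesis by measurable
  qed
  have "0 \<le> C"
    using G[of 0 0] by linarith
  have bH: "\<bar>\<integral>y. H n x y \<partial>\<nu> n\<bar> \<le> C * B" for n x
    using integral_abs_le[OF finite_nu H] mult_left_mono[OF measure_nu_le \<open>0 \<le> C\<close>] by (rule order_trans)
  have bG: "\<bar>\<integral>y. G x y \<partial>\<mu>\<bar> \<le> C * B" for x
    using integral_abs_le[OF finite_mu G] mult_left_mono[OF measure_mu_le \<open>0 \<le> C\<close>] unfolding space_mu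
    by (rule order_trans)
  have inner: "(\<lambda>n. \<integral>y. H n x y \<partial>\<nu> n) \<longlonglongrightarrow> (\<integral>y. G x y \<partial>\<mu>)" for x
  proof -
    have "(\<lambda>n. \<integral>y. H n x y - G x y \<partial>\<nu> n) \<longlonglongrightarrow> 0"
    proof (rule integral_vanishing)
      show "\<bar>H n x y - G x y\<bar> \<le> 2 * C" for n y
        using H[of n x y] G[of x y] by linarith
      show "(\<lambda>n. H n x y - G x y) \<longlonglongrightarrow> 0" for y
        using lim by (rule LIM_zero)
    qed measurable
    moreover have "(\<lambda>n. \<integral>y. G x y \<partial>\<nu> n) \<longlonglongrightarrow> (\<integral>y. G x y \<partial>\<mu>)"
      using G by (intro integral_tendsto) auto
    ultimately have "(\<lambda>n. (\<integral>y. H n x y - G x y \<partial>\<nu> n) + (\<integral>y. G x y \<partial>\<nu> n)) \<longlonglongrightarrow> 0 + (\<integral>y. G x y \<partial>\<mu>)"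
      by (rule tendsto_add)
    moreover have "(\<integral>y. H n x y - G x y \<partial>\<nu> n) + (\<integral>y. G x y \<partial>\<nu> n) = (\<integral>y. H n x y \<partial>\<nu> n)" for n
      using H G by (subst Bochner_Integration.integral_diff)
        (auto intro!: integrable_bounded_borel[OF finite_nu sets_nu])
    ultimately show ?thesis
      by simp
  qed
  have "(\<lambda>n. \<integral>x. (\<integral>y. H n x y \<partial>\<nu> n) - (\<integral>y. G x y \<partial>\<mu>) \<partial>\<nu> n) \<longlonglongrightarrow> 0"
  proof (rule integral_vanishing)
    show "\<bar>(\<integral>y. H n x y \<partial>\<nu> n) - (\<integral>y. G x y \<partial>\<mu>)\<bar> \<le> 2 * (C * B)" for n x
      using bH[where n=n and x=x] bG[of x] by linarith
    show "(\<lambda>n. (\<integral>y. H n x y \<partial>\<nu> n) - (\<integral>y. G x y \<partial>\<mu>)) \<longlonglongrightarrow> 0" for x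
      using inner by (rule LIM_zero)
  qed measurable
  moreover have "(\<lambda>n. \<integral>x. \<integral>y. G x y \<partial>\<mu> \<partial>\<nu> n) \<longlonglongrightarrow> (\<integral>x. \<integral>y. G x y \<partial>\<mu> \<partial>\<mu>)"
    using bG by (intro integral_tendsto) auto
  ultimately have "(\<lambda>n. (\<integral>x. (\<integral>y. H n x y \<partial>\<nu> n) - (\<integral>y. G x y \<partial>\<mu>) \<partial>\<nu> n) + (\<integral>x. \<integral>y. G x y \<partial>\<mu> \<partial>\<nu> n))
      \<longlonglongrightarrow> 0 + (\<integral>x. \<integral>y. G x y \<partial>\<mu> \<partial>\<mu>)"
    by (rule tendsto_add)
  moreover have "(\<integral>x. (\<integral>y. H n x y \<partial>\<nu> n) - (\<integral>y. G x y \<partial>\<mu>) \<partial>\<nu> n) + (\<integral>x. \<integral>y. G x y \<partial>\<mu> \<partial>\<nu> n) =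
      (\<integral>x. \<integral>y. H n x y \<partial>\<nu> n \<partial>\<nu> n)" for n
    using bH bG by (subst Bochner_Integration.integral_diff)
      (auto intro!: integrable_bounded_borel[OF finite_nu sets_nu])
  ultimately show ?thesis
    by simp
qed

end

section \<open>Limits of the Euler scheme\<close>

lemma nn_integral_eq_integral_bounded:
  fixes f :: "real \<Rightarrow> real"
  assumes "finite_measure M" "sets M = sets borel" "f \<in> borel_measurable borel" "\<And>x. 0 \<le> f x" "\<And>x. f x \<le> C"
  shows "(\<integral>\<^sup>+ x. ennreal (f x) \<partial>M) = ennreal (\<integral>x. f x \<partial>M)"
  using assms by (intro nn_integral_eq_integral integrable_bounded_borel[of M f C]) auto

text \<open>The integral is the Riemann sum plus the contribution of the last, incomplete step,
  whose length is at most h.\<close>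

lemma step_function_integral:
  fixes q :: "nat \<Rightarrow> real"
  assumes "0 < h" "0 \<le> t" and C: "\<And>j. \<bar>q j\<bar> \<le> C"
  shows "(\<lambda>s. q (nat \<lfloor>s / h\<rfloor>)) \<in> borel_measurable (lebesgue_on {0..t})"
    and "\<bar>(\<integral>s. q (nat \<lfloor>s / h\<rfloor>) \<partial>lebesgue_on {0..t}) - h * (\<Sum>j<nat \<lfloor>t / h\<rfloor>. q j)\<bar> \<le> C * h"
proof -
  let ?s = "\<lambda>s. q (nat \<lfloor>s / h\<rfloor>)"
  have "?s \<in> borel_measurable borel"
    by (rule measurable_compose[of "\<lambda>s. nat \<lfloor>s / h\<rfloor>" _ "count_space UNIV"]) measurable
  then show meas: "?s \<in> borel_measurable (lebesgue_on S)" for S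
    by (intro measurable_restrict_space1 measurable_completion) auto
  have piece: "(?s has_integral (b - a) * q j) {a..b}"
    if "real j * h \<le> a" "a \<le> b" "b \<le> real (Suc j) * h" for a b j
  \<comment> \<open>The right endpoint may already carry the next index, hence the values are
    compared in the interior only.\<close>
  proof (rule has_integral_spike_interior[where f = "\<lambda>s. q j" and a = a and b = b, unfolded box_real])
    show "((\<lambda>s. q j) has_integral (b - a) * q j) {a..b}"
      using has_integral_const_real[of "q j" a b] \<open>a \<le> b\<close> by simp
    fix x assume "x \<in> {a<..<b}"
    then have "real j \<le> x / h" "x / h < real j + 1"
      using that \<open>0 < h\<close> by (auto simp: field_simps)
    then have "\<lfloor>x / h\<rfloor> = int j"
      by (intro floor_unique) auto
    then show "?s x = q j"
      by simp
  qed
  have steps: "(?s has_integral h * (\<Sum>j<k. q j)) {0..real k * h}" for k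
  proof (induction k)
    case (Suc k)
    have "(?s has_integral h * (\<Sum>j<k. q j) + (real (Suc k) * h - real k * h) * q k) {0..real (Suc k) * h}"
      using \<open>0 < h\<close> by (intro has_integral_combine[OF _ _ Suc piece]) auto
    then show ?case
      by (simp add: algebra_simps)
  next
    case 0
    show ?case
      using has_integral_refl(1)[of ?s 0] by simp
  qed
  define k where "k = nat \<lfloor>t / h\<rfloor>"
  have "0 \<le> \<lfloor>t / h\<rfloor>"
    using assms by simp
  then have "real k \<le> t / h" "t / h < real k + 1"
    unfolding k_def by linarith+
  then have k: "real k * h \<le> t" "t \<le> real (Suc k) * h"
    using \<open>0 < h\<close> by (simp_all add: field_simps)
  have "(?s has_integral h * (\<Sum>j<k. q j) + (t - real k * h) * q k) {0..t}"
    using \<open>0 < h\<close> k by (intro has_integral_combine[OF _ _ steps piece]) auto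
  moreover have "integrable (lebesgue_on {0..t}) ?s"
  proof -
    have "finite_measure (lebesgue_on {0..t})"
      by (intro finite_measure_lebesgue_on) simp
    then show ?thesis
      using C meas by (intro finite_measure.integrable_const_bound[of _ _ C]) auto
  qed
  ultimately have "(\<integral>s. ?s s \<partial>lebesgue_on {0..t}) = h * (\<Sum>j<k. q j) + (t - real k * h) * q k"
    by (simp add: lebesgue_integral_eq_integral integral_unique)
  moreover have "\<bar>(t - real k * h) * q k\<bar> \<le> h * C"
    unfolding abs_mult using k C by (intro mult_mono) (auto simp: algebra_simps)
  ultimately show "\<bar>(\<integral>s. ?s s \<partial>lebesgue_on {0..t}) - h * (\<Sum>j<nat \<lfloor>t / h\<rfloor>. q j)\<bar> \<le> C * h"
    unfolding k_def by (simp add: mult.commute)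
qed

section \<open>The kernel as a bounded function of pairs of sizes\<close>

context exchange_kernel
begin

text \<open>Dividing by \<open>wt x * wt y\<close> leaves a bounded function of x and y, since for
  fixed x and y the kernel is then at most \<open>\<phi> z\<close>; the weights reappear in the
  measures. In this form a flux is a double integral to which weak convergence applies.\<close>

definition profile :: "(real \<Rightarrow> real \<Rightarrow> real \<Rightarrow> real) \<Rightarrow> (real \<Rightarrow> real \<Rightarrow> real) \<Rightarrow> real \<Rightarrow> real \<Rightarrow> real" where
  "profile k g x y = (\<integral>z. g x z * k x y z \<partial>lborel) / (wt x * wt y)"

lemma profile:
  fixes g :: "real \<Rightarrow> real \<Rightarrow> real"
  assumes k_meas: "(\<lambda>(x, y, z). k x y z) \<in> borel_measurable (borel \<Otimes>\<^sub>M borel \<Otimes>\<^sub>M borel)"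
    and k: "\<And>x y z. 0 \<le> k x y z" "\<And>x y z. k x y z \<le> wt x * wt y * \<phi> z"
    and [measurable]: "case_prod g \<in> borel_measurable (borel \<Otimes>\<^sub>M borel)"
    and g: "\<And>x z. 0 \<le> g x z" "\<And>x z. g x z \<le> C"
  shows measurable_profile: "case_prod (profile k g) \<in> borel_measurable (borel \<Otimes>\<^sub>M borel)"
    and integrable_profile: "integrable lborel (\<lambda>z. g x z * k x y z)"
    and profile_nonneg: "0 \<le> profile k g x y"
    and profile_le: "profile k g x y \<le> C * phi_norm"
proof -
  have [measurable (raw)]: "(\<lambda>p. k (a p) (b p) (c p)) \<in> borel_measurable M"
    if "a \<in> borel_measurable M" "b \<in> borel_measurable M" "c \<in> borel_measurable M" for M and a b c :: "'x \<Rightarrow> real"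
    using measurable_compose[OF measurable_Pair[OF that(1) measurable_Pair[OF that(2,3)]] k_meas] by simp
  show "case_prod (profile k g) \<in> borel_measurable (borel \<Otimes>\<^sub>M borel)"
    unfolding profile_def by measurable
  have "0 \<le> C"
    using g[of 0 0] by linarith
  have le: "g x z * k x y z \<le> C * (wt x * wt y * \<phi> z)" for z
    using g k \<open>0 \<le> C\<close> by (intro mult_mono) auto
  have int_phi: "integrable lborel (\<lambda>z. C * (wt x * wt y * \<phi> z))"
    by (intro integrable_mult_right integrable_phi)
  show int: "integrable lborel (\<lambda>z. g x z * k x y z)"
  proof (rule Bochner_Integration.integrable_bound[OF int_phi])
    have "norm (g x z * k x y z) \<le> norm (C * (wt x * wt y * \<phi> z))" for z
      unfolding real_norm_def abs_of_nonneg[OF mult_nonneg_nonneg[OF g(1) k(1)]]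
      by (rule order_trans[OF le abs_ge_self])
    then show "AE z in lborel. norm (g x z * k x y z) \<le> norm (C * (wt x * wt y * \<phi> z))"
      by simp
  qed measurable
  show "0 \<le> profile k g x y"
    unfolding profile_def using g k wt_pos[of x] wt_pos[of y] by (intro divide_nonneg_pos integral_nonneg_AE) auto
  have "(\<integral>z. g x z * k x y z \<partial>lborel) \<le> (\<integral>z. C * (wt x * wt y * \<phi> z) \<partial>lborel)"
    by (intro integral_mono int int_phi le)
  also have "\<dots> = C * (wt x * wt y) * (\<integral>z. \<phi> z \<partial>lborel)"
    by simp
  also have "\<dots> \<le> C * (wt x * wt y) * phi_norm"
    using \<open>0 \<le> C\<close> wt_pos[of x] wt_pos[of y] by (intro mult_left_mono phi_le_norm) auto
  finally show "profile k g x y \<le> C * phi_norm"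
    unfolding profile_def using wt_pos[of x] wt_pos[of y] by (simp add: field_simps)
qed

text \<open>Tonelli, followed by moving both weights into \<open>\<mu>\<close>. The kernel
  \<open>k\<close> and the extended density \<open>u\<close> are left general in order to serve both
  the truncated scheme and the limit.\<close>

lemma nn_integral_profile:
  fixes g :: "real \<Rightarrow> real \<Rightarrow> real" and u :: "real \<Rightarrow> ennreal"
  assumes k_meas: "(\<lambda>(x, y, z). k x y z) \<in> borel_measurable (borel \<Otimes>\<^sub>M borel \<Otimes>\<^sub>M borel)"
    and k: "\<And>x y z. 0 \<le> k x y z" "\<And>x y z. k x y z \<le> wt x * wt y * \<phi> z"
    and g_meas [measurable]: "case_prod g \<in> borel_measurable (borel \<Otimes>\<^sub>M borel)"
    and g: "\<And>x z. 0 \<le> g x z" "\<And>x z. g x z \<le> C"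
    and [measurable]: "u \<in> borel_measurable borel"
    and \<mu>: "\<mu> = density lborel (\<lambda>x. ennreal (wt x) * u x)" "finite_measure \<mu>"
  shows "(\<integral>\<^sup>+ x. \<integral>\<^sup>+ z. (\<integral>\<^sup>+ y. ennreal (k x y z) * u y \<partial>lborel) * u x * ennreal (g x z) \<partial>lborel \<partial>lborel) =
    ennreal (\<integral>x. \<integral>y. profile k g x y \<partial>\<mu> \<partial>\<mu>)"
proof -
  note profile_facts = profile[OF k_meas k g_meas g]
  note profile_facts(1) [measurable]
  have [measurable (raw)]: "(\<lambda>p. k (a p) (b p) (c p)) \<in> borel_measurable M"
    if "a \<in> borel_measurable M" "b \<in> borel_measurable M" "c \<in> borel_measurable M" for M and a b c :: "'x \<Rightarrow> real"
    using measurable_compose[OF measurable_Pair[OF that(1) measurable_Pair[OF that(2,3)]] k_meas] by simp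
  have sets_mu [simp, measurable_cong]: "sets \<mu> = sets borel"
    by (simp add: \<mu>)
  have space_mu: "space \<mu> = UNIV"
    by (simp add: \<mu>)
  interpret finite_measure \<mu> by fact
  have density: "(\<integral>\<^sup>+ x. F x \<partial>\<mu>) = (\<integral>\<^sup>+ x. ennreal (wt x) * u x * F x \<partial>lborel)"
    if [measurable]: "F \<in> borel_measurable borel" for F
    unfolding \<mu>(1) by (rule nn_integral_density) measurable
  have "(\<integral>\<^sup>+ z. (\<integral>\<^sup>+ y. ennreal (k x y z) * u y \<partial>lborel) * u x * ennreal (g x z) \<partial>lborel) =
      ennreal (wt x) * u x * ennreal (\<integral>y. profile k g x y \<partial>\<mu>)" for x
  proof -
    have inner: "(\<integral>\<^sup>+ z. ennreal (g x z) * ennreal (k x y z) \<partial>lborel) =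
        ennreal (wt x) * (ennreal (wt y) * ennreal (profile k g x y))" for y
    proof -
      have "(\<integral>\<^sup>+ z. ennreal (g x z) * ennreal (k x y z) \<partial>lborel) = ennreal (\<integral>z. g x z * k x y z \<partial>lborel)"
        using g k by (subst nn_integral_eq_integral[OF profile_facts(2), symmetric]) (auto simp: ennreal_mult)
      also have "(\<integral>z. g x z * k x y z \<partial>lborel) = wt x * (wt y * profile k g x y)"
        using wt_pos[of x] wt_pos[of y] by (simp add: profile_def)
      finally show ?thesis
        using profile_facts(3) wt_pos[of x] wt_pos[of y] by (simp add: ennreal_mult less_imp_le)
    qed
    have "(\<integral>\<^sup>+ z. (\<integral>\<^sup>+ y. ennreal (k x y z) * u y \<partial>lborel) * u x * ennreal (g x z) \<partial>lborel) =
        (\<integral>\<^sup>+ z. \<integral>\<^sup>+ y. u x * (u y * (ennreal (g x z) * ennreal (k x y z))) \<partial>lborel \<partial>lborel)"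
    proof (intro nn_integral_cong)
      fix z
      have "(\<integral>\<^sup>+ y. ennreal (k x y z) * u y \<partial>lborel) * (u x * ennreal (g x z)) =
          (\<integral>\<^sup>+ y. ennreal (k x y z) * u y * (u x * ennreal (g x z)) \<partial>lborel)"
        by (rule nn_integral_multc[symmetric]) measurable
      then show "(\<integral>\<^sup>+ y. ennreal (k x y z) * u y \<partial>lborel) * u x * ennreal (g x z) =
          (\<integral>\<^sup>+ y. u x * (u y * (ennreal (g x z) * ennreal (k x y z))) \<partial>lborel)"
        by (simp add: mult_ac)
    qed
    also have "\<dots> = (\<integral>\<^sup>+ y. \<integral>\<^sup>+ z. u x * (u y * (ennreal (g x z) * ennreal (k x y z))) \<partial>lborel \<partial>lborel)"
      by (rule lborel_pair.Fubini') measurable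
    also have "\<dots> = (\<integral>\<^sup>+ y. u x * (u y * (ennreal (wt x) * (ennreal (wt y) * ennreal (profile k g x y)))) \<partial>lborel)"
      by (simp add: nn_integral_cmult inner)
    also have "\<dots> = (\<integral>\<^sup>+ y. (ennreal (wt x) * u x) * (ennreal (wt y) * u y * ennreal (profile k g x y)) \<partial>lborel)"
      by (simp add: mult_ac)
    also have "\<dots> = ennreal (wt x) * u x * (\<integral>\<^sup>+ y. ennreal (profile k g x y) \<partial>\<mu>)"
      unfolding \<mu>(1) by (simp add: nn_integral_cmult nn_integral_density)
    also have "(\<integral>\<^sup>+ y. ennreal (profile k g x y) \<partial>\<mu>) = ennreal (\<integral>y. profile k g x y \<partial>\<mu>)"
      by (rule nn_integral_eq_integral_bounded[OF \<mu>(2) sets_mu _ profile_facts(3,4)]) measurable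
    finally show ?thesis .
  qed
  then have "(\<integral>\<^sup>+ x. \<integral>\<^sup>+ z. (\<integral>\<^sup>+ y. ennreal (k x y z) * u y \<partial>lborel) * u x * ennreal (g x z) \<partial>lborel \<partial>lborel) =
      (\<integral>\<^sup>+ x. ennreal (wt x) * u x * ennreal (\<integral>y. profile k g x y \<partial>\<mu>) \<partial>lborel)"
    by simp
  also have "\<dots> = (\<integral>\<^sup>+ x. ennreal (\<integral>y. profile k g x y \<partial>\<mu>) \<partial>\<mu>)"
    by (rule density[symmetric]) measurable
  also have "\<dots> = ennreal (\<integral>x. \<integral>y. profile k g x y \<partial>\<mu> \<partial>\<mu>)"
  proof (rule nn_integral_eq_integral_bounded[OF \<mu>(2) sets_mu])
    show "(\<lambda>x. \<integral>y. profile k g x y \<partial>\<mu>) \<in> borel_measurable borel"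
      by measurable
    fix x
    show "0 \<le> (\<integral>y. profile k g x y \<partial>\<mu>)"
      by (intro integral_nonneg_AE AE_I2 profile_facts(3))
    have "\<bar>profile k g x y\<bar> \<le> C * phi_norm" for y
      using profile_facts(3,4)[of x y] by simp
    then show "(\<integral>y. profile k g x y \<partial>\<mu>) \<le> C * phi_norm * measure \<mu> UNIV"
      using integral_abs_le[OF \<mu>(2), of "profile k g x" "C * phi_norm"] space_mu by simp
  qed
  finally show ?thesis .
qed

end

section \<open>Weighted laws of the scheme and their regularity in time\<close>

context exchange_data
begin

definition idx :: "nat \<Rightarrow> real \<Rightarrow> nat" where
  "idx n t = nat \<lfloor>t / tau n\<rfloor>"

text \<open>The weight is part of the measure, so that setwise convergence of the laws to a density
  is weak convergence in L1 with weight \<open>wt\<close>.\<close>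

definition law :: "nat \<Rightarrow> real \<Rightarrow> real measure" where
  "law n t = density lborel (\<lambda>x. ennreal (wt x) * euler n (idx n t) x)"

lemma sets_law [simp, measurable_cong]: "sets (law n t) = sets borel"
  by (simp add: law_def)

lemma space_law [simp]: "space (law n t) = UNIV"
  by (simp add: law_def)

lemma tau_pos: "0 < n \<Longrightarrow> 0 < tau n"
  using horizon_pos by (simp add: tau_def)

lemma idx_le:
  assumes "0 < n" "t < horizon"
  shows "idx n t \<le> n"
proof -
  have "t / tau n \<le> real n"
    using assms horizon_pos by (simp add: tau_def field_simps)
  then show ?thesis
    unfolding idx_def by linarith
qed

lemma nn_integral_law:
  assumes [measurable]: "g \<in> borel_measurable borel"
  shows "(\<integral>\<^sup>+ x. g x \<partial>law n t) = (\<integral>\<^sup>+ x. g x * (ennreal (wt x) * euler n (idx n t) x) \<partial>lborel)"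
  unfolding law_def by (subst nn_integral_density) (auto simp: mult_ac)

lemma emeasure_law_le:
  assumes "0 < n" "t < horizon"
  shows "emeasure (law n t) UNIV \<le> ennreal bound"
  using euler_wt_le[OF assms(1) idx_le[OF assms]] by (simp add: law_def emeasure_density)

lemma finite_law:
  assumes "0 < n" "t < horizon"
  shows "finite_measure (law n t)"
  using emeasure_law_le[OF assms] by (intro finite_measureI) (auto simp: top_unique)

lemma nn_integral_euler:
  assumes "0 < n" "t < horizon" and [measurable]: "f \<in> borel_measurable borel"
    and f: "\<And>x. 0 \<le> f x" "\<And>x. f x \<le> C * wt x"
  shows "(\<integral>\<^sup>+ x. ennreal (f x) * euler n (idx n t) x \<partial>lborel) = ennreal (\<integral>x. f x / wt x \<partial>law n t)"
proof -
  have div: "0 \<le> f x / wt x" "f x / wt x \<le> C" for x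
    using f[of x] wt_pos[of x] by (simp_all add: field_simps)
  have "ennreal (f x) = ennreal (f x / wt x) * ennreal (wt x)" for x
    using div(1)[of x] wt_pos[of x] by (simp flip: ennreal_mult)
  then have "(\<integral>\<^sup>+ x. ennreal (f x) * euler n (idx n t) x \<partial>lborel) =
      (\<integral>\<^sup>+ x. ennreal (f x / wt x) \<partial>law n t)"
    by (simp add: nn_integral_law mult.assoc)
  also have "\<dots> = ennreal (\<integral>x. f x / wt x \<partial>law n t)"
    using div by (intro nn_integral_eq_integral_bounded[OF finite_law[OF assms(1,2)]]) auto
  finally show ?thesis .
qed

lemma law_equi_integrable:
  assumes "\<And>n. 0 < \<sigma> n" "t < horizon"
  shows "equi_integrable (\<lambda>n. law (\<sigma> n) t) bound"
proof
  fix e :: real assume "0 < e"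
  then obtain L r :: real where Lr: "0 \<le> L" "0 \<le> r" and
    *: "\<And>n k g. 0 < n \<Longrightarrow> k \<le> n \<Longrightarrow> g \<in> borel_measurable borel \<Longrightarrow> (\<And>x. g x \<le> 1) \<Longrightarrow>
      (\<integral>\<^sup>+ x. g x * (ennreal (wt x) * euler n k x) \<partial>lborel) \<le>
        ennreal L * (\<integral>\<^sup>+ x. g x * indicator {-r..r} x \<partial>lborel) + ennreal e"
    using euler_equi_integrable by blast
  show "\<exists>L\<ge>0. \<exists>r\<ge>0. \<forall>n. \<forall>g \<in> borel_measurable borel. (\<forall>x. g x \<le> 1) \<longrightarrow>
      (\<integral>\<^sup>+ x. g x \<partial>law (\<sigma> n) t) \<le> ennreal L * (\<integral>\<^sup>+ x. g x * indicator {-r..r} x \<partial>lborel) + ennreal e"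
    using Lr * assms idx_le by (intro exI[of _ L] exI[of _ r] conjI allI ballI impI) (simp_all add: nn_integral_law)
qed (use assms emeasure_law_le bound_pos in auto)

text \<open>A rise of the tested value is paid for by the gain and a fall by the loss, and each of
  them is at most \<open>D\<close>. Two inequalities stand in for an absolute value, the integrals
  being extended.\<close>

lemma euler_step_close:
  assumes nk: "0 < n" "k \<le> n" and [measurable]: "f \<in> borel_measurable borel"
    and f: "\<And>x. f x \<le> ennreal C" and "0 \<le> C"
  defines "D \<equiv> 2 * C * phi_norm * bound\<^sup>2"
  shows "(\<integral>\<^sup>+ x. f x * euler n (Suc k) x \<partial>lborel) \<le> (\<integral>\<^sup>+ x. f x * euler n k x \<partial>lborel) + ennreal (tau n * D)"
    and "(\<integral>\<^sup>+ x. f x * euler n k x \<partial>lborel) \<le> (\<integral>\<^sup>+ x. f x * euler n (Suc k) x \<partial>lborel) + ennreal (tau n * D)"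
proof -
  have "0 \<le> D"
    using \<open>0 \<le> C\<close> phi_norm_pos by (simp add: D_def)
  have C2: "ennreal (2 * C) = ennreal C + ennreal C"
    using \<open>0 \<le> C\<close> by (simp flip: ennreal_plus)
  let ?out = "\<integral>\<^sup>+ x. \<integral>\<^sup>+ z. rate n (euler n k) x z * euler n k x * (2 * f x) \<partial>lborel \<partial>lborel"
  let ?in = "\<integral>\<^sup>+ x. \<integral>\<^sup>+ z. rate n (euler n k) x z * euler n k x * (f (x + z) + f (x - z)) \<partial>lborel \<partial>lborel"
  have "?out \<le> ennreal D"
    unfolding D_def
  proof (rule euler_flux_le[OF nk])
    show "2 * f x \<le> ennreal (2 * C)" for x z
      using add_mono[OF f f, of x x] by (simp only: C2 mult_2[of "f x"])
  qed (use \<open>0 \<le> C\<close> in auto)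
  then have out: "ennreal (tau n) * ?out \<le> ennreal (tau n * D)"
    using tau_nonneg \<open>0 \<le> D\<close> by (simp add: ennreal_mult mult_left_mono)
  have "?in \<le> ennreal D"
    unfolding D_def
  proof (rule euler_flux_le[OF nk])
    show "f (x + z) + f (x - z) \<le> ennreal (2 * C)" for x z
      unfolding C2 by (intro add_mono f)
  qed (use \<open>0 \<le> C\<close> in auto)
  then have into: "ennreal (tau n) * ?in \<le> ennreal (tau n * D)"
    using tau_nonneg \<open>0 \<le> D\<close> by (simp add: ennreal_mult mult_left_mono)
  note balance = euler_balance[OF nk, of f]
  have "(\<integral>\<^sup>+ x. f x * euler n (Suc k) x \<partial>lborel) \<le> (\<integral>\<^sup>+ x. f x * euler n (Suc k) x \<partial>lborel) + ennreal (tau n) * ?out"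
    by simp
  also have "\<dots> = (\<integral>\<^sup>+ x. f x * euler n k x \<partial>lborel) + ennreal (tau n) * ?in"
    by (rule balance) measurable
  also have "\<dots> \<le> (\<integral>\<^sup>+ x. f x * euler n k x \<partial>lborel) + ennreal (tau n * D)"
    by (intro add_left_mono into)
  finally show "(\<integral>\<^sup>+ x. f x * euler n (Suc k) x \<partial>lborel) \<le> (\<integral>\<^sup>+ x. f x * euler n k x \<partial>lborel) + ennreal (tau n * D)" .
  have "(\<integral>\<^sup>+ x. f x * euler n k x \<partial>lborel) \<le> (\<integral>\<^sup>+ x. f x * euler n k x \<partial>lborel) + ennreal (tau n) * ?in"
    by simp
  also have "\<dots> = (\<integral>\<^sup>+ x. f x * euler n (Suc k) x \<partial>lborel) + ennreal (tau n) * ?out"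
    by (rule balance[symmetric]) measurable
  also have "\<dots> \<le> (\<integral>\<^sup>+ x. f x * euler n (Suc k) x \<partial>lborel) + ennreal (tau n * D)"
    by (intro add_left_mono out)
  finally show "(\<integral>\<^sup>+ x. f x * euler n k x \<partial>lborel) \<le> (\<integral>\<^sup>+ x. f x * euler n (Suc k) x \<partial>lborel) + ennreal (tau n * D)" .
qed

lemma euler_close:
  assumes "0 < n" "k \<le> n" "j \<le> k" and [measurable]: "f \<in> borel_measurable borel"
    and f: "\<And>x. f x \<le> ennreal C" and "0 \<le> C"
  defines "D \<equiv> 2 * C * phi_norm * bound\<^sup>2"
  shows "(\<integral>\<^sup>+ x. f x * euler n k x \<partial>lborel) \<le> (\<integral>\<^sup>+ x. f x * euler n j x \<partial>lborel) + ennreal (real (k - j) * (tau n * D)) \<and>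
    (\<integral>\<^sup>+ x. f x * euler n j x \<partial>lborel) \<le> (\<integral>\<^sup>+ x. f x * euler n k x \<partial>lborel) + ennreal (real (k - j) * (tau n * D))"
  using \<open>j \<le> k\<close> \<open>k \<le> n\<close>
proof (induction k rule: dec_induct)
  case (step k)
  let ?I = "\<lambda>k. \<integral>\<^sup>+ x. f x * euler n k x \<partial>lborel"
  have "0 \<le> tau n * D"
    using \<open>0 \<le> C\<close> phi_norm_pos tau_nonneg by (simp add: D_def)
  have split: "ennreal (real (Suc k - j) * (tau n * D)) = ennreal (real (k - j) * (tau n * D)) + ennreal (tau n * D)"
    using \<open>0 \<le> tau n * D\<close> step(1) by (simp add: Suc_diff_le distrib_right flip: ennreal_plus)
  have IH: "?I k \<le> ?I j + ennreal (real (k - j) * (tau n * D))" "?I j \<le> ?I k + ennreal (real (k - j) * (tau n * D))"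
    using step by auto
  note close = euler_step_close[OF \<open>0 < n\<close> _ assms(4) f \<open>0 \<le> C\<close>, of k, folded D_def]
  have "?I (Suc k) \<le> ?I k + ennreal (tau n * D)"
    using step by (intro close) auto
  also have "\<dots> \<le> ?I j + ennreal (real (k - j) * (tau n * D)) + ennreal (tau n * D)"
    by (intro add_right_mono IH)
  finally have "?I (Suc k) \<le> ?I j + ennreal (real (Suc k - j) * (tau n * D))"
    unfolding split by (simp add: add.assoc)
  moreover have "?I j \<le> ?I (Suc k) + ennreal (tau n * D) + ennreal (real (k - j) * (tau n * D))"
    using step by (intro order_trans[OF IH(2)] add_right_mono close) auto
  then have "?I j \<le> ?I (Suc k) + ennreal (real (Suc k - j) * (tau n * D))"
    unfolding split by (simp add: add.assoc add.commute[of "ennreal (tau n * D)"])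
  ultimately show ?case
    by blast
qed simp

text \<open>The extra \<open>tau n\<close> pays for rounding times to the grid: between s and t
  there are at most |t - s| / \<open>tau n\<close> + 1 steps. Division by \<open>wt\<close> undoes
  the weight of the law, so the estimate concerns bounded observables of the density itself.\<close>

lemma law_close:
  assumes "0 < n" "0 \<le> s" "s < horizon" "0 \<le> t" "t < horizon" and [measurable]: "f \<in> borel_measurable borel"
    and f: "\<And>x. 0 \<le> f x" "\<And>x. f x \<le> C"
  shows "\<bar>(\<integral>x. f x / wt x \<partial>law n t) - (\<integral>x. f x / wt x \<partial>law n s)\<bar> \<le>
    (\<bar>t - s\<bar> + tau n) * (2 * C * phi_norm * bound\<^sup>2)"
  using assms(2-5)
proof (induction s t rule: linorder_wlog)
  case (le s t)
  let ?I = "\<lambda>t. \<integral>x. f x / wt x \<partial>law n t"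
  let ?D = "2 * C * phi_norm * bound\<^sup>2"
  have "0 \<le> C"
    using f[of 0] by linarith
  then have D: "0 \<le> ?D"
    using phi_norm_pos by simp
  have tau: "0 < tau n"
    using tau_pos \<open>0 < n\<close> by simp
  have idx: "idx n s \<le> idx n t"
    unfolding idx_def using le tau by (intro nat_mono floor_mono divide_right_mono) auto
  have "0 \<le> s / tau n" "s / tau n \<le> t / tau n"
    using le tau by (auto intro: divide_right_mono)
  then have "real (idx n t - idx n s) \<le> t / tau n - s / tau n + 1"
    unfolding idx_def by linarith
  then have "real (idx n t - idx n s) * tau n \<le> (t / tau n - s / tau n + 1) * tau n"
    using tau by (intro mult_right_mono) auto
  also have "\<dots> = \<bar>t - s\<bar> + tau n"
    using tau le(1) by (simp add: field_simps)
  finally have "real (idx n t - idx n s) * (tau n * ?D) \<le> (\<bar>t - s\<bar> + tau n) * ?D"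
    using D by (simp add: mult_right_mono flip: mult.assoc[of _ "tau n"])
  then have E: "ennreal (real (idx n t - idx n s) * (tau n * ?D)) \<le> ennreal ((\<bar>t - s\<bar> + tau n) * ?D)" (is "_ \<le> ennreal ?E")
    by (rule ennreal_leI)
  have f': "f x \<le> C * wt x" for x
    using f(2)[of x] mult_left_mono[OF wt_ge_1[of x] \<open>0 \<le> C\<close>] by simp
  have I: "0 \<le> ?I t" for t
    using f wt_pos by (intro integral_nonneg_AE) (auto simp: less_imp_le)
  have "0 \<le> ?E"
    using D tau by simp
  have "ennreal (?I t) \<le> ennreal (?I s) + ennreal ?E" "ennreal (?I s) \<le> ennreal (?I t) + ennreal ?E"
    using euler_close[OF \<open>0 < n\<close> idx_le[OF \<open>0 < n\<close> \<open>t < horizon\<close>] idx, of "\<lambda>x. ennreal (f x)" C] f \<open>0 \<le> C\<close> le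
      order_trans[OF _ add_left_mono[OF E]]
    by (simp_all add: nn_integral_euler[OF \<open>0 < n\<close> _ assms(6) f(1) f'] ennreal_leI)
  then have "?I t \<le> ?I s + ?E" "?I s \<le> ?I t + ?E"
    using I \<open>0 \<le> ?E\<close> by (simp_all flip: ennreal_plus)
  then show ?case
    by linarith
next
  case (sym s t)
  then show ?case
    by (simp add: abs_minus_commute)
qed

lemma tau_tendsto: "strict_mono \<sigma> \<Longrightarrow> (\<lambda>n. tau (\<sigma> n)) \<longlonglongrightarrow> 0"
  unfolding tau_def
  by (intro tendsto_divide_0[OF tendsto_const] filterlim_at_top_imp_at_infinity
      filterlim_compose[OF filterlim_real_sequentially] filterlim_subseq)

end

section \<open>Selection of a subsequence that converges at every time\<close>

context exchange_data
begin

text \<open>Continuity in time is known for bounded observables, whereas the laws carry the weight.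
  Before a time is moved to a nearby rational one, the set is therefore cut to [-r, r], where the
  weight is bounded; tightness handles the rest.\<close>

lemma ex_subsequence:
  obtains \<sigma> :: "nat \<Rightarrow> nat" where "strict_mono \<sigma>" "\<And>n. 0 < \<sigma> n"
    "\<And>t A. 0 \<le> t \<Longrightarrow> t < horizon \<Longrightarrow> A \<in> sets borel \<Longrightarrow> convergent (\<lambda>n. measure (law (\<sigma> n) t) A)"
proof -
  \<comment> \<open>Countably many bounded sequences, as a diagonal selection requires: by
    \<open>convergent_measure\<close>, half-lines with rational end and the total mass suffice at
    each rational time.\<close>
  define S where "S = (\<rat> \<inter> {0..<horizon}) \<times> insert UNIV ((\<lambda>q::real. {..q}) ` \<rat>)"
  have "countable S"
    unfolding S_def by (intro countable_SIGMA countable_Int1 countable_insert countable_image countable_rat)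
  moreover have "norm (measure (law (Suc n) (fst p)) (snd p)) \<le> bound" if "p \<in> S" for n p
  proof -
    interpret equi_integrable "\<lambda>n. law (Suc n) (fst p)" bound
      using that by (intro law_equi_integrable) (auto simp: S_def)
    show ?thesis
      using measure_nu_le by simp
  qed
  ultimately obtain k where k: "strict_mono (k :: nat \<Rightarrow> nat)" and
    conv: "\<And>p. p \<in> S \<Longrightarrow> \<exists>l. (\<lambda>n. measure (law (Suc (k n)) (fst p)) (snd p)) \<longlonglongrightarrow> l"
    by (rule function_convergent_subsequence[where f = "\<lambda>n p. measure (law (Suc n) (fst p)) (snd p)" and S = S]) (blast, rule that)
  \<comment> \<open>Shifted by one because the number of steps has to be positive;
    \<open>tau 0\<close> is 0 by convention.\<close>
  define \<sigma> where "\<sigma> n = Suc (k n)" for n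
  have \<sigma>: "strict_mono \<sigma>" "\<And>n. 0 < \<sigma> n"
    using k by (auto simp: \<sigma>_def strict_mono_def)
  have rational: "convergent (\<lambda>n. measure (law (\<sigma> n) t) A)"
    if t: "t \<in> \<rat>" "0 \<le> t" "t < horizon" and A: "A \<in> sets borel" for t A
  proof -
    interpret equi_integrable "\<lambda>n. law (\<sigma> n) t" bound
      using \<sigma> t by (intro law_equi_integrable)
    show ?thesis
    proof (rule convergent_measure[OF _ _ A])
      show "convergent (\<lambda>n. measure (law (\<sigma> n) t) {..q})" if "q \<in> \<rat>" for q
        using conv[of "(t, {..q})"] t that by (auto simp: S_def \<sigma>_def convergent_def)
      show "convergent (\<lambda>n. measure (law (\<sigma> n) t) UNIV)"
        using conv[of "(t, UNIV)"] t by (auto simp: S_def \<sigma>_def convergent_def)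
    qed
  qed
  have "convergent (\<lambda>n. measure (law (\<sigma> n) t) A)"
    if t: "0 \<le> t" "t < horizon" and A [measurable]: "A \<in> sets borel" for t A
  proof (rule convergent_approx)
    fix e :: real assume "0 < e"
    interpret equi_integrable "\<lambda>n. law (\<sigma> n) t" bound
      using \<sigma> t by (intro law_equi_integrable)
    have "0 < e / 4"
      using \<open>0 < e\<close> by simp
    obtain L r :: real where tail: "\<And>n g. g \<in> borel_measurable borel \<Longrightarrow> (\<And>x. 0 \<le> g x) \<Longrightarrow> (\<And>x. g x \<le> 1) \<Longrightarrow>
      (\<integral>x. g x \<partial>law (\<sigma> n) t) \<le> L * (\<integral>x. g x * indicator {-r..r} x \<partial>lborel) + e / 4"
      using uniform_real[OF \<open>0 < e / 4\<close>] by blast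
    define D where "D = 2 * wt r * phi_norm * bound\<^sup>2"
    have "0 \<le> D"
      using wt_pos[of r] phi_norm_pos by (simp add: D_def)
    \<comment> \<open>Both |t - s| and \<open>tau (\<sigma> n)\<close> will be below
      \<open>\<delta>\<close>, so the change of time costs at most e / 2, and the tail e / 4. The
      summand 1 guards against D = 0.\<close>
    define \<delta> where "\<delta> = e / (4 * (D + 1))"
    have \<delta>: "0 < \<delta>" "\<delta> * D \<le> e / 4"
      using \<open>0 < e\<close> \<open>0 \<le> D\<close> by (simp_all add: \<delta>_def field_simps)
    obtain s where s: "s \<in> \<rat>" "t < s" "s < min horizon (t + \<delta>)"
      using Rats_dense_in_real[of t "min horizon (t + \<delta>)"] t \<delta> by auto
    have "\<forall>\<^sub>F n in sequentially. tau (\<sigma> n) < \<delta>"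
      using tau_tendsto[OF \<sigma>(1)] \<delta> by (intro order_tendstoD)
    then obtain N where N: "\<And>n. n \<ge> N \<Longrightarrow> tau (\<sigma> n) < \<delta>"
      by (auto simp: eventually_sequentially)
    let ?A = "A \<inter> {-r..r}"
    have "\<bar>measure (law (\<sigma> n) t) A - measure (law (\<sigma> n) s) ?A\<bar> \<le> e" if "n \<ge> N" for n
    proof -
      interpret finite_measure "law (\<sigma> n) t"
        by (rule finite_nu)
      have "A = ?A \<union> (A - {-r..r})"
        by auto
      then have "measure (law (\<sigma> n) t) A = measure (law (\<sigma> n) t) (?A \<union> (A - {-r..r}))"
        by simp
      also have "\<dots> = measure (law (\<sigma> n) t) ?A + measure (law (\<sigma> n) t) (A - {-r..r})"
        by (intro finite_measure_Union) auto
      finally have "measure (law (\<sigma> n) t) A = measure (law (\<sigma> n) t) ?A + measure (law (\<sigma> n) t) (A - {-r..r})" .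
      moreover have "measure (law (\<sigma> n) t) (A - {-r..r}) \<le> e / 4"
      proof -
        have disjoint: "(\<lambda>x. indicat_real (A - {-r..r}) x * indicator {-r..r} x) = (\<lambda>x. 0)"
          by (auto simp: indicator_def)
        have "(\<integral>x. indicator (A - {-r..r}) x \<partial>law (\<sigma> n) t) \<le>
            L * (\<integral>x. indicator (A - {-r..r}) x * indicator {-r..r} x \<partial>lborel) + e / 4"
          by (rule tail) auto
        then show ?thesis
          unfolding disjoint by simp
      qed
      moreover have "\<bar>measure (law (\<sigma> n) t) ?A - measure (law (\<sigma> n) s) ?A\<bar> \<le> e / 4 + e / 4"
      proof -
        define f where "f x = wt x * indicator ?A x" for x
        have [measurable]: "f \<in> borel_measurable borel"
          unfolding f_def by measurable
        have f: "0 \<le> f x" "f x \<le> wt r" for x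
          using wt_pos[of x] wt_pos[of r] abs_le_square_iff[of x r]
          by (auto simp: f_def indicator_def wt_def intro: less_imp_le add_nonneg_nonneg)
        have "f x / wt x = indicator ?A x" for x
          using wt_pos[of x] by (simp add: f_def)
        then have "\<bar>measure (law (\<sigma> n) t) ?A - measure (law (\<sigma> n) s) ?A\<bar> \<le> (\<bar>t - s\<bar> + tau (\<sigma> n)) * D"
          using law_close[OF \<sigma>(2), of s t f "wt r" n] s t f by (simp add: D_def)
        also have "\<dots> \<le> (\<delta> + \<delta>) * D"
          using N[OF that] s \<open>0 \<le> D\<close> by (intro mult_right_mono add_mono) auto
        finally show ?thesis
          using \<delta>(2) by (simp add: distrib_right)
      qed
      moreover have "0 \<le> measure (law (\<sigma> n) t) (A - {-r..r})"
        by simp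
      ultimately show ?thesis
        using \<open>0 < e\<close> by linarith
    qed
    moreover have "convergent (\<lambda>n. measure (law (\<sigma> n) s) ?A)"
      using s t by (intro rational) auto
    ultimately show "\<exists>y. convergent y \<and> (\<exists>N. \<forall>n\<ge>N. \<bar>measure (law (\<sigma> n) t) A - y n\<bar> \<le> e)"
      by blast
  qed
  with \<sigma> show ?thesis
    by (rule that)
qed

lemma law_negative: "emeasure (law n t) {..<0} = 0"
  by (auto simp: law_def emeasure_density nn_integral_0_iff_AE indicator_def intro!: AE_I2 euler_negative)

text \<open>At time 0 the laws do not depend on n, so the density can be chosen as
  \<open>wt x * c0 x\<close> at every point. At later times a density is determined only up to null
  sets and may be set to zero on the negative axis, which no law charges.\<close>

lemma ex_limit_at:
  assumes \<sigma>: "\<And>n. 0 < \<sigma> n" and t: "0 \<le> t" "t < horizon"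
    and conv: "\<And>A. A \<in> sets borel \<Longrightarrow> convergent (\<lambda>n. measure (law (\<sigma> n) t) A)"
  shows "\<exists>d. d \<in> borel_measurable borel \<and> (\<forall>x. 0 \<le> d x) \<and> (\<forall>x<0. d x = 0) \<and> (t = 0 \<longrightarrow> d = (\<lambda>x. wt x * c0 x)) \<and>
    finite_measure (density lborel (\<lambda>x. ennreal (d x))) \<and>
    (\<forall>A \<in> sets borel. (\<lambda>n. measure (law (\<sigma> n) t) A) \<longlonglongrightarrow> measure (density lborel (\<lambda>x. ennreal (d x))) A)"
proof (cases "t = 0")
  case True
  have "law n t = density lborel (\<lambda>x. ennreal (wt x * c0 x))" for n
    using True wt_pos c0_nonneg by (simp add: law_def idx_def ennreal_mult less_imp_le)
  moreover have "finite_measure (law (\<sigma> 0) t)"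
    using \<sigma> t by (intro finite_law)
  ultimately show ?thesis
    using wt_pos c0_nonneg c0_negative by (intro exI[of _ "\<lambda>x. wt x * c0 x"]) (auto simp: less_imp_le)
next
  case False
  interpret equi_integrable "\<lambda>n. law (\<sigma> n) t" bound
    using \<sigma> t by (intro law_equi_integrable)
  obtain d :: "real \<Rightarrow> real" where [measurable]: "d \<in> borel_measurable borel" and d: "\<And>x. 0 \<le> d x"
    "finite_measure (density lborel (\<lambda>x. ennreal (d x)))"
    "\<And>A. A \<in> sets borel \<Longrightarrow> (\<lambda>n. measure (law (\<sigma> n) t) A) \<longlonglongrightarrow> measure (density lborel (\<lambda>x. ennreal (d x))) A"
    using ex_limit_density[OF conv] by blast
  define d' where "d' x = d x * indicator {0..} x" for x
  have [measurable]: "d' \<in> borel_measurable borel"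
    unfolding d'_def by measurable
  have d': "emeasure (density lborel (\<lambda>x. ennreal (d' x))) A = emeasure (density lborel (\<lambda>x. ennreal (d x))) (A \<inter> {0..})"
    if [measurable]: "A \<in> sets borel" for A
    unfolding d'_def by (subst (1 2) emeasure_density) (auto intro!: nn_integral_cong simp: indicator_def)
  have law: "measure (law (\<sigma> n) t) A = measure (law (\<sigma> n) t) (A \<inter> {0..})"
    if [measurable]: "A \<in> sets borel" for A n
  proof -
    interpret finite_measure "law (\<sigma> n) t"
      by (rule finite_nu)
    have "A = (A \<inter> {0..}) \<union> (A \<inter> {..<0})"
      by auto
    then have "measure (law (\<sigma> n) t) A = measure (law (\<sigma> n) t) ((A \<inter> {0..}) \<union> (A \<inter> {..<0}))"
      by simp
    also have "\<dots> = measure (law (\<sigma> n) t) (A \<inter> {0..}) + measure (law (\<sigma> n) t) (A \<inter> {..<0})"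
      by (intro finite_measure_Union) auto
    also have "measure (law (\<sigma> n) t) (A \<inter> {..<0}) \<le> measure (law (\<sigma> n) t) {..<0}"
      by (intro finite_measure_mono) auto
    also have "measure (law (\<sigma> n) t) {..<0} = 0"
      using law_negative by (simp add: measure_def)
    finally show ?thesis
      using finite_measure_mono[of "A \<inter> {0..}" A] by simp
  qed
  have "finite_measure (density lborel (\<lambda>x. ennreal (d' x)))"
    using d'[of UNIV] finite_measure.emeasure_finite[OF d(2), of "{0..}"]
    by (intro finite_measureI) (auto simp: top.not_eq_extremum)
  moreover have "(\<lambda>n. measure (law (\<sigma> n) t) A) \<longlonglongrightarrow> measure (density lborel (\<lambda>x. ennreal (d' x))) A"
    if [measurable]: "A \<in> sets borel" for A
    using d(3)[of "A \<inter> {0..}"] d'[OF that] unfolding law[OF that] by (simp add: measure_def)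
  ultimately show ?thesis
    using False d(1) by (intro exI[of _ d']) (auto simp: d'_def)
qed

end

text \<open>The densities \<open>d t\<close> still carry the weight. Regularity in time is not
  postulated: it comes from the approximations, through \<open>c_close\<close> and
  \<open>flux_time_integral\<close>.\<close>

locale exchange_limit = exchange_data +
  fixes \<sigma> :: "nat \<Rightarrow> nat" and d :: "real \<Rightarrow> real \<Rightarrow> real"
  assumes sigma_mono: "strict_mono \<sigma>" and sigma_pos: "0 < \<sigma> n"
    and d_measurable [measurable]: "d t \<in> borel_measurable borel"
    and d_nonneg: "0 \<le> d t x"
    and d_negative: "x < 0 \<Longrightarrow> d t x = 0"
    and d_0: "d 0 = (\<lambda>x. wt x * c0 x)"
    and d_finite: "0 \<le> t \<Longrightarrow> t < horizon \<Longrightarrow> finite_measure (density lborel (\<lambda>x. ennreal (d t x)))"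
    and d_tendsto: "0 \<le> t \<Longrightarrow> t < horizon \<Longrightarrow> A \<in> sets borel \<Longrightarrow>
      (\<lambda>n. measure (law (\<sigma> n) t) A) \<longlonglongrightarrow> measure (density lborel (\<lambda>x. ennreal (d t x))) A"

lemma (in exchange_data) ex_exchange_limit: "\<exists>\<sigma> d. exchange_limit K \<phi> c0 \<sigma> d"
proof -
  obtain \<sigma> :: "nat \<Rightarrow> nat" where \<sigma>: "strict_mono \<sigma>" "\<And>n. 0 < \<sigma> n"
    "\<And>t A. 0 \<le> t \<Longrightarrow> t < horizon \<Longrightarrow> A \<in> sets borel \<Longrightarrow> convergent (\<lambda>n. measure (law (\<sigma> n) t) A)"
    by (rule ex_subsequence) (rule that)
  define P where "P t d \<longleftrightarrow> d \<in> borel_measurable borel \<and> (\<forall>x. 0 \<le> d x) \<and> (\<forall>x<0. d x = 0) \<and>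
    (t = 0 \<longrightarrow> d = (\<lambda>x. wt x * c0 x)) \<and> finite_measure (density lborel (\<lambda>x. ennreal (d x))) \<and>
    (\<forall>A \<in> sets borel. (\<lambda>n. measure (law (\<sigma> n) t) A) \<longlonglongrightarrow> measure (density lborel (\<lambda>x. ennreal (d x))) A)" for t d
  have "\<exists>d. P t d" if "0 \<le> t" "t < horizon" for t
    unfolding P_def using that \<sigma> by (intro ex_limit_at) auto
  then have "\<exists>d. \<forall>t. 0 \<le> t \<longrightarrow> t < horizon \<longrightarrow> P t (d t)"
    by metis
  then obtain d where d: "\<And>t. 0 \<le> t \<Longrightarrow> t < horizon \<Longrightarrow> P t (d t)"
    by blast
  \<comment> \<open>Outside the interval of existence the zero function is a default, so that
    measurability and sign hold for every t.\<close>
  define d' where "d' t = (if 0 \<le> t \<and> t < horizon then d t else (\<lambda>x. 0))" for t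
  have "exchange_limit K \<phi> c0 \<sigma> d'"
  proof (intro exchange_limit.intro exchange_data_axioms exchange_limit_axioms.intro)
    show "strict_mono \<sigma>"
      by (rule \<sigma>)
    show "0 < \<sigma> n" for n
      by (rule \<sigma>)
    show "d' t \<in> borel_measurable borel" for t
      using d[of t] by (auto simp: d'_def P_def)
    show "0 \<le> d' t x" for t x
      using d[of t] by (auto simp: d'_def P_def)
    show "d' t x = 0" if "x < 0" for t x
      using d[of t] that by (auto simp: d'_def P_def)
    show "d' 0 = (\<lambda>x. wt x * c0 x)"
      using d[of 0] horizon_pos by (simp add: d'_def P_def)
    show "finite_measure (density lborel (\<lambda>x. ennreal (d' t x)))" if "0 \<le> t" "t < horizon" for t
      using d[OF that] that by (simp add: d'_def P_def)
    show "(\<lambda>n. measure (law (\<sigma> n) t) A) \<longlonglongrightarrow> measure (density lborel (\<lambda>x. ennreal (d' t x))) A"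
      if "0 \<le> t" "t < horizon" "A \<in> sets borel" for t A
      using d[OF that(1,2)] that by (simp add: d'_def P_def)
  qed
  then show ?thesis
    by blast
qed

section \<open>The limit density: continuity in time and conserved quantities\<close>

context exchange_limit
begin

definition \<mu> :: "real \<Rightarrow> real measure" where
  "\<mu> t = density lborel (\<lambda>x. ennreal (d t x))"

definition c :: "real \<Rightarrow> real \<Rightarrow> real" where
  "c t x = d t x / wt x"

lemma measurable_c [measurable]: "c t \<in> borel_measurable borel"
  unfolding c_def by measurable

lemma c_nonneg: "0 \<le> c t x"
  using d_nonneg wt_pos[of x] by (simp add: c_def)

lemma c_negative: "x < 0 \<Longrightarrow> c t x = 0"
  by (simp add: c_def d_negative)

lemma wt_c: "wt x * c t x = d t x"
  using wt_pos[of x] by (simp add: c_def)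

lemma c_0: "c 0 = c0"
proof
  show "c 0 x = c0 x" for x
    using wt_pos[of x] by (simp add: c_def d_0)
qed

lemma sets_mu [simp, measurable_cong]: "sets (\<mu> t) = sets borel"
  by (simp add: \<mu>_def)

lemma mu_eq: "\<mu> t = density lborel (\<lambda>x. ennreal (wt x) * ennreal (c t x))"
proof -
  have "ennreal (d t x) = ennreal (wt x) * ennreal (c t x)" for x
    using ennreal_mult[of "wt x" "c t x"] wt_pos[of x] c_nonneg[of t x] by (simp add: wt_c)
  then show ?thesis
    by (simp add: \<mu>_def)
qed

lemma limit_at: "0 \<le> t \<Longrightarrow> t < horizon \<Longrightarrow> equi_integrable_limit (\<lambda>n. law (\<sigma> n) t) bound (\<mu> t)"
  using law_equi_integrable[OF sigma_pos] d_finite d_tendsto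
  unfolding \<mu>_def by (intro equi_integrable_limit.intro equi_integrable_limit_axioms.intro) simp_all

lemma integral_mu:
  assumes [measurable]: "f \<in> borel_measurable borel"
  shows "(\<integral>x. f x / wt x \<partial>\<mu> t) = (\<integral>x. f x * c t x \<partial>lborel)"
  unfolding \<mu>_def using d_nonneg by (subst integral_density) (auto simp: c_def mult.commute)

lemma wt_c_integrable:
  assumes "0 \<le> t" "t < horizon"
  shows "integrable lborel (\<lambda>x. wt x * c t x)" and "(\<integral>x. wt x * c t x \<partial>lborel) \<le> bound"
proof -
  interpret equi_integrable_limit "\<lambda>n. law (\<sigma> n) t" bound "\<mu> t"
    using assms by (rule limit_at)
  interpret finite_measure "\<mu> t"
    by (rule finite_mu)
  have *: "(\<integral>\<^sup>+ x. ennreal (d t x) \<partial>lborel) = ennreal (measure (\<mu> t) UNIV)"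
    unfolding emeasure_eq_measure[symmetric] by (simp add: \<mu>_def emeasure_density)
  then show "integrable lborel (\<lambda>x. wt x * c t x)"
    unfolding wt_c using d_nonneg by (intro integrableI_nonneg) auto
  show "(\<integral>x. wt x * c t x \<partial>lborel) \<le> bound"
    unfolding wt_c using d_nonneg * measure_mu_le by (subst integral_eq_nn_integral) auto
qed

lemma integrable_c:
  assumes "0 \<le> t" "t < horizon" and [measurable]: "f \<in> borel_measurable borel" and f: "\<And>x. \<bar>f x\<bar> \<le> C * wt x"
  shows "integrable lborel (\<lambda>x. f x * c t x)"
proof (rule Bochner_Integration.integrable_bound)
  show "integrable lborel (\<lambda>x. C * (wt x * c t x))"
    using assms by (intro integrable_mult_right wt_c_integrable)
  have "norm (f x * c t x) \<le> norm (C * (wt x * c t x))" for x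
    using mult_right_mono[OF f[of x] c_nonneg[of t x]] c_nonneg[of t x] abs_ge_self[of "C * (wt x * c t x)"]
    by (simp add: abs_mult mult.assoc)
  then show "AE x in lborel. norm (f x * c t x) \<le> norm (C * (wt x * c t x))"
    by simp
qed measurable

text \<open>Because the laws carry the weight, every Borel function of at most quadratic growth
  becomes a bounded test function after division by \<open>wt\<close>; this includes the first
  moment.\<close>

lemma test_tendsto:
  assumes t: "0 \<le> t" "t < horizon" and [measurable]: "f \<in> borel_measurable borel" and f: "\<And>x. \<bar>f x\<bar> \<le> C * wt x"
  shows "(\<lambda>n. \<integral>x. f x / wt x \<partial>law (\<sigma> n) t) \<longlonglongrightarrow> (\<integral>x. f x * c t x \<partial>lborel)"
proof -
  interpret equi_integrable_limit "\<lambda>n. law (\<sigma> n) t" bound "\<mu> t"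
    using t by (rule limit_at)
  have "\<bar>f x / wt x\<bar> \<le> C" for x
    using f[of x] wt_pos[of x] by (simp add: abs_divide field_simps)
  then show ?thesis
    unfolding integral_mu[symmetric, OF assms(3)] by (intro integral_tendsto) auto
qed

lemma c_close_test:
  assumes s: "0 \<le> s" "s < horizon" and t: "0 \<le> t" "t < horizon" and [measurable]: "f \<in> borel_measurable borel"
    and f: "\<And>x. 0 \<le> f x" "\<And>x. f x \<le> 1"
  shows "\<bar>(\<integral>x. f x * c t x \<partial>lborel) - (\<integral>x. f x * c s x \<partial>lborel)\<bar> \<le> \<bar>t - s\<bar> * (2 * phi_norm * bound\<^sup>2)"
proof (rule LIMSEQ_le)
  have f': "\<bar>f x\<bar> \<le> 1 * wt x" for x
    using f[of x] wt_ge_1[of x] by simp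
  show "(\<lambda>n. \<bar>(\<integral>x. f x / wt x \<partial>law (\<sigma> n) t) - (\<integral>x. f x / wt x \<partial>law (\<sigma> n) s)\<bar>) \<longlonglongrightarrow>
      \<bar>(\<integral>x. f x * c t x \<partial>lborel) - (\<integral>x. f x * c s x \<partial>lborel)\<bar>"
    by (intro tendsto_intros test_tendsto[OF _ _ _ f'] s t) measurable
  have "(\<lambda>n. (\<bar>t - s\<bar> + tau (\<sigma> n)) * (2 * phi_norm * bound\<^sup>2)) \<longlonglongrightarrow> (\<bar>t - s\<bar> + 0) * (2 * phi_norm * bound\<^sup>2)"
    by (intro tendsto_intros tau_tendsto sigma_mono)
  then show "(\<lambda>n. (\<bar>t - s\<bar> + tau (\<sigma> n)) * (2 * phi_norm * bound\<^sup>2)) \<longlonglongrightarrow> \<bar>t - s\<bar> * (2 * phi_norm * bound\<^sup>2)"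
    by simp
  show "\<exists>N. \<forall>n\<ge>N. \<bar>(\<integral>x. f x / wt x \<partial>law (\<sigma> n) t) - (\<integral>x. f x / wt x \<partial>law (\<sigma> n) s)\<bar> \<le>
      (\<bar>t - s\<bar> + tau (\<sigma> n)) * (2 * phi_norm * bound\<^sup>2)"
    using law_close[OF sigma_pos s t _ f] by simp
qed

text \<open>The sign of c s - c t is realised by an indicator \<open>f\<close> and its complement 1
  - \<open>f\<close>, each tested once; hence the constant 4 in place of 2.\<close>

lemma c_close:
  assumes s: "0 \<le> s" "s < horizon" and t: "0 \<le> t" "t < horizon"
  shows "(\<integral>x. \<bar>c s x - c t x\<bar> \<partial>lborel) \<le> \<bar>s - t\<bar> * (4 * phi_norm * bound\<^sup>2)"
proof -
  define f where "f x = indicat_real {x. c t x \<le> c s x} x" for x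
  have [measurable]: "f \<in> borel_measurable borel"
    unfolding f_def by measurable
  have f: "0 \<le> f x" "f x \<le> 1" "0 \<le> 1 - f x" "1 - f x \<le> 1" "\<bar>f x\<bar> \<le> 1 * wt x" "\<bar>1 - f x\<bar> \<le> 1 * wt x" for x
    using wt_ge_1[of x] by (auto simp: f_def indicator_def)
  note int = integrable_c[OF s _ f(5)] integrable_c[OF t _ f(5)] integrable_c[OF s _ f(6)] integrable_c[OF t _ f(6)]
  have "(\<integral>x. \<bar>c s x - c t x\<bar> \<partial>lborel) = (\<integral>x. (f x * c s x - f x * c t x) + ((1 - f x) * c t x - (1 - f x) * c s x) \<partial>lborel)"
    by (intro Bochner_Integration.integral_cong) (auto simp: f_def indicator_def)
  also have "\<dots> = ((\<integral>x. f x * c s x \<partial>lborel) - (\<integral>x. f x * c t x \<partial>lborel)) +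
      ((\<integral>x. (1 - f x) * c t x \<partial>lborel) - (\<integral>x. (1 - f x) * c s x \<partial>lborel))"
    using int by simp
  also have "\<dots> \<le> \<bar>s - t\<bar> * (2 * phi_norm * bound\<^sup>2) + \<bar>t - s\<bar> * (2 * phi_norm * bound\<^sup>2)"
    using c_close_test[OF t s, of f] c_close_test[OF s t, of "\<lambda>x. 1 - f x"] f
    by (intro add_mono) (simp_all add: abs_le_iff)
  finally show ?thesis
    by (simp add: abs_minus_commute algebra_simps)
qed

text \<open>Exact for the scheme, hence for the limit. It is what later allows test functions to be
  shifted by a constant in order to become nonnegative.\<close>

lemma mass_conserved:
  assumes t: "0 \<le> t" "t < horizon"
  shows "(\<integral>x. c t x \<partial>lborel) = (\<integral>x. c0 x \<partial>lborel)"
proof -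
  have one: "\<bar>1\<bar> \<le> 1 * wt x" for x
    using wt_ge_1[of x] by simp
  have "(\<integral>x. 1 / wt x \<partial>law (\<sigma> n) t) = (\<integral>x. 1 / wt x \<partial>law (\<sigma> n) 0)" for n
  proof -
    have "ennreal (\<integral>x. 1 / wt x \<partial>law (\<sigma> n) s) = (\<integral>\<^sup>+ x. ennreal (c0 x) \<partial>lborel)" if "0 \<le> s" "s < horizon" for s
      using nn_integral_euler[OF sigma_pos[of n] that(2), of "\<lambda>_. 1" 1]
        euler_mass_wt(1)[OF sigma_pos[of n] idx_le[OF sigma_pos[of n] that(2)]] wt_ge_1 by simp
    from this[of t] this[of 0] t horizon_pos
    have "ennreal (\<integral>x. 1 / wt x \<partial>law (\<sigma> n) t) = ennreal (\<integral>x. 1 / wt x \<partial>law (\<sigma> n) 0)"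
      by simp
    then show ?thesis
      using wt_pos by (subst (asm) ennreal_inj) (auto intro!: integral_nonneg_AE simp: less_imp_le)
  qed
  then have "(\<integral>x. 1 * c t x \<partial>lborel) = (\<integral>x. 1 * c 0 x \<partial>lborel)"
    using test_tendsto[OF t _ one] test_tendsto[OF _ _ _ one, of 0] horizon_pos by (intro LIMSEQ_unique) auto
  then show ?thesis
    by (simp add: c_0)
qed

text \<open>\<open>max 0 x\<close> is the real counterpart of \<open>ennreal x\<close>, for which
  the scheme conserves the integral exactly. It lies below \<open>wt\<close>, so the identity passes
  to the limit.\<close>

lemma first_moment_conserved:
  assumes t: "0 \<le> t" "t < horizon"
  shows "(\<integral>x. max 0 x * c t x \<partial>lborel) = (\<integral>x. max 0 x * c0 x \<partial>lborel)"
proof -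
  have le: "max 0 x \<le> 1 * wt x" "\<bar>max 0 x\<bar> \<le> 1 * wt x" for x
    using zero_le_power2[of "x - 1 / 2"] by (auto simp: wt_def power2_eq_square algebra_simps max_def)
  have "(\<integral>x. max 0 x / wt x \<partial>law (\<sigma> n) t) = (\<integral>x. max 0 x / wt x \<partial>law (\<sigma> n) 0)" for n
  proof -
    have "ennreal (\<integral>x. max 0 x / wt x \<partial>law (\<sigma> n) s) = (\<integral>\<^sup>+ x. ennreal x * ennreal (c0 x) \<partial>lborel)"
      if "0 \<le> s" "s < horizon" for s
      using nn_integral_euler[OF sigma_pos[of n] that(2), of "max 0" 1]
        euler_first_moment[OF sigma_pos[of n] idx_le[OF sigma_pos[of n] that(2)]] le by (simp add: ennreal_max_0)
    from this[of t] this[of 0] t horizon_pos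
    have "ennreal (\<integral>x. max 0 x / wt x \<partial>law (\<sigma> n) t) = ennreal (\<integral>x. max 0 x / wt x \<partial>law (\<sigma> n) 0)"
      by simp
    then show ?thesis
      using wt_pos by (subst (asm) ennreal_inj) (auto intro!: integral_nonneg_AE simp: less_imp_le)
  qed
  then have "(\<integral>x. max 0 x * c t x \<partial>lborel) = (\<integral>x. max 0 x * c 0 x \<partial>lborel)"
    using test_tendsto[OF t _ le(2)] test_tendsto[OF _ _ _ le(2), of 0] horizon_pos by (intro LIMSEQ_unique) auto
  then show ?thesis
    by (simp add: c_0)
qed

end

section \<open>Fluxes and the weak form of the scheme\<close>

context exchange_data
begin

definition flux :: "nat \<Rightarrow> nat \<Rightarrow> (real \<Rightarrow> real \<Rightarrow> real) \<Rightarrow> ennreal" where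
  "flux n j g = (\<integral>\<^sup>+ x. \<integral>\<^sup>+ z. rate n (euler n j) x z * euler n j x * ennreal (g x z) \<partial>lborel \<partial>lborel)"

text \<open>Cut off after the last Euler step, so that it is bounded in all arguments.\<close>

definition real_flux :: "nat \<Rightarrow> (real \<Rightarrow> real \<Rightarrow> real) \<Rightarrow> nat \<Rightarrow> real" where
  "real_flux n g j = (if j \<le> n then enn2real (flux n j g) else 0)"

lemma flux_le:
  assumes "0 < n" "j \<le> n" and [measurable]: "case_prod g \<in> borel_measurable (borel \<Otimes>\<^sub>M borel)"
    and g: "\<And>x z. 0 \<le> g x z" "\<And>x z. g x z \<le> C"
  shows "flux n j g \<le> ennreal (C * phi_norm * bound\<^sup>2)"
  unfolding flux_def using assms order_trans[OF g(1) g(2)] by (intro euler_flux_le ennreal_leI) auto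

lemma real_flux_le:
  assumes "0 < n" "case_prod g \<in> borel_measurable (borel \<Otimes>\<^sub>M borel)"
    and g: "\<And>x z. 0 \<le> g x z" "\<And>x z. g x z \<le> C"
  shows "\<bar>real_flux n g j\<bar> \<le> C * phi_norm * bound\<^sup>2"
proof -
  have "0 \<le> C"
    using order_trans[OF g(1) g(2)] by auto
  then have nonneg: "0 \<le> C * phi_norm * bound\<^sup>2"
    using phi_norm_pos by simp
  then show ?thesis
    using enn2real_mono[OF flux_le[OF assms(1) _ assms(2) g, of j]] by (auto simp: real_flux_def)
qed

lemma truncated_measurable: "(\<lambda>(x, y, z). truncated n x y z) \<in> borel_measurable (borel \<Otimes>\<^sub>M borel \<Otimes>\<^sub>M borel)"
  unfolding split_beta' by measurable

lemma real_flux_eq: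
  assumes "0 < n" "t < horizon" and g_meas [measurable]: "case_prod g \<in> borel_measurable (borel \<Otimes>\<^sub>M borel)"
    and g: "\<And>x z. 0 \<le> g x z" "\<And>x z. g x z \<le> C"
  shows "real_flux n g (idx n t) = (\<integral>x. \<integral>y. profile (truncated n) g x y \<partial>law n t \<partial>law n t)"
proof -
  have "flux n (idx n t) g = ennreal (\<integral>x. \<integral>y. profile (truncated n) g x y \<partial>law n t \<partial>law n t)"
    unfolding flux_def rate_def
    by (rule nn_integral_profile[OF truncated_measurable truncated_nonneg truncated_le g_meas g _ law_def finite_law])
      (use assms in auto)
  moreover have "0 \<le> (\<integral>x. \<integral>y. profile (truncated n) g x y \<partial>law n t \<partial>law n t)"
    by (intro integral_nonneg_AE AE_I2 profile_nonneg[OF truncated_measurable truncated_nonneg truncated_le g_meas g])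
  ultimately show ?thesis
    using idx_le[OF assms(1,2)] by (simp add: real_flux_def)
qed

lemma euler_test_finite:
  fixes f :: "real \<Rightarrow> real"
  assumes "0 < n" "k \<le> n" and [measurable]: "f \<in> borel_measurable borel"
    and f: "\<And>x. 0 \<le> f x" "\<And>x. f x \<le> C"
  shows "(\<integral>\<^sup>+ x. ennreal (f x) * euler n k x \<partial>lborel) < \<infinity>"
proof -
  have "(\<integral>\<^sup>+ x. ennreal (f x) * euler n k x \<partial>lborel) \<le> (\<integral>\<^sup>+ x. ennreal C * (ennreal (wt x) * euler n k x) \<partial>lborel)"
  proof (intro nn_integral_mono)
    fix x
    have "0 \<le> C"
      using order_trans[OF f(1) f(2)] by auto
    then have "ennreal (f x) \<le> ennreal C * ennreal (wt x)"
      using order_trans[OF f(2)[of x], of "C * wt x"] mult_left_mono[OF wt_ge_1[of x] \<open>0 \<le> C\<close>] wt_pos[of x]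
      by (auto simp: intro!: ennreal_leI simp flip: ennreal_mult)
    then show "ennreal (f x) * euler n k x \<le> ennreal C * (ennreal (wt x) * euler n k x)"
      unfolding mult.assoc[symmetric] by (intro mult_right_mono) auto
  qed
  also have "\<dots> = ennreal C * (\<integral>\<^sup>+ x. ennreal (wt x) * euler n k x \<partial>lborel)"
    by (rule nn_integral_cmult) measurable
  also have "\<dots> \<le> ennreal C * ennreal bound"
    by (intro mult_left_mono euler_wt_le assms) auto
  also have "\<dots> < \<infinity>"
    by (simp add: ennreal_mult_less_top)
  finally show ?thesis .
qed

text \<open>The balance of one step, summed up. Gain and loss are kept as two sums, since each of
  them converges by itself.\<close>

lemma discrete_weak_form:
  fixes f :: "real \<Rightarrow> real"
  assumes "0 < n" "k \<le> n" and [measurable]: "f \<in> borel_measurable borel"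
    and f: "\<And>x. 0 \<le> f x" "\<And>x. f x \<le> C"
  shows "enn2real (\<integral>\<^sup>+ x. ennreal (f x) * euler n k x \<partial>lborel) =
    enn2real (\<integral>\<^sup>+ x. ennreal (f x) * euler n 0 x \<partial>lborel) +
      (tau n * (\<Sum>j<k. real_flux n (\<lambda>x z. f (x + z) + f (x - z)) j) - tau n * (\<Sum>j<k. real_flux n (\<lambda>x z. 2 * f x) j))"
  using \<open>k \<le> n\<close>
proof (induction k)
  case (Suc k)
  let ?I = "\<lambda>k. \<integral>\<^sup>+ x. ennreal (f x) * euler n k x \<partial>lborel"
  let ?in = "\<lambda>x z. f (x + z) + f (x - z)" and ?out = "\<lambda>x z. 2 * f x"
  have k: "k \<le> n" "Suc k \<le> n"
    using Suc.prems by auto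
  have "flux n k ?in \<le> ennreal (2 * C * phi_norm * bound\<^sup>2)"
  proof (rule flux_le[OF \<open>0 < n\<close> k(1)])
    show "f (x + z) + f (x - z) \<le> 2 * C" for x z
      using f(2)[of "x + z"] f(2)[of "x - z"] by simp
  qed (simp_all add: f add_nonneg_nonneg)
  then have fin_in: "flux n k ?in < \<infinity>"
    by (rule order_le_less_trans) simp
  have "flux n k ?out \<le> ennreal (2 * C * phi_norm * bound\<^sup>2)"
    by (rule flux_le[OF \<open>0 < n\<close> k(1)]) (simp_all add: f)
  then have fin_out: "flux n k ?out < \<infinity>"
    by (rule order_le_less_trans) simp
  have "?I (Suc k) + ennreal (tau n) * flux n k ?out = ?I k + ennreal (tau n) * flux n k ?in"
    using euler_balance[OF \<open>0 < n\<close> k(1), of "\<lambda>x. ennreal (f x)"] f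
    unfolding flux_def by (simp add: ennreal_mult ennreal_plus)
  then have "enn2real (?I (Suc k) + ennreal (tau n) * flux n k ?out) = enn2real (?I k + ennreal (tau n) * flux n k ?in)"
    by simp
  \<comment> \<open>\<open>enn2real\<close> is additive for finite summands only, hence the four
    finiteness facts.\<close>
  then have "enn2real (?I (Suc k)) + tau n * enn2real (flux n k ?out) =
      enn2real (?I k) + tau n * enn2real (flux n k ?in)"
    using euler_test_finite[OF \<open>0 < n\<close> k(1) assms(3) f] euler_test_finite[OF \<open>0 < n\<close> k(2) assms(3) f]
      fin_in fin_out tau_nonneg[of n]
    by (simp add: enn2real_plus enn2real_mult ennreal_mult_less_top del: euler.simps)
  with Suc k show ?case
    by (simp add: real_flux_def distrib_left)
qed simp

end

section \<open>Passage to the limit in the fluxes\<close>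

context exchange_limit
begin

definition limit_flux :: "(real \<Rightarrow> real \<Rightarrow> real) \<Rightarrow> real \<Rightarrow> real" where
  "limit_flux g t = (\<integral>x. \<integral>y. profile K g x y \<partial>\<mu> t \<partial>\<mu> t)"

text \<open>The truncation level grows without bound only where \<open>\<phi> z\<close> is positive;
  where it is 0, the bound on \<open>K\<close> makes \<open>K\<close> vanish as well.\<close>

lemma truncated_tendsto: "(\<lambda>n. truncated (\<sigma> n) x y z) \<longlonglongrightarrow> K x y z"
proof (cases "\<phi> z = 0")
  case True
  then have "K x y z = 0"
    using K_bound[of x y z] K_nonneg[of x y z] by simp
  with True show ?thesis
    by (simp add: truncated_def)
next
  case False
  then have "0 < \<phi> z"
    using phi_nonneg[of z] by simp
  obtain N where N: "K x y z / \<phi> z \<le> real N"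
    using real_arch_simple by blast
  have "truncated (\<sigma> n) x y z = K x y z" if "N \<le> n" for n
  proof -
    have "real N \<le> real (\<sigma> n)"
      using seq_suble[OF sigma_mono, of n] that by simp
    with N have "K x y z / \<phi> z \<le> real (\<sigma> n)"
      by linarith
    then show ?thesis
      using \<open>0 < \<phi> z\<close> by (simp add: truncated_def field_simps)
  qed
  then show ?thesis
    by (intro tendsto_eventually eventually_sequentiallyI[of N])
qed

context
  fixes g :: "real \<Rightarrow> real \<Rightarrow> real" and C :: real
  assumes g_measurable [measurable]: "case_prod g \<in> borel_measurable (borel \<Otimes>\<^sub>M borel)"
    and g: "\<And>x z. 0 \<le> g x z" "\<And>x z. g x z \<le> C"
begin

lemma profile_tendsto: "(\<lambda>n. profile (truncated (\<sigma> n)) g x y) \<longlonglongrightarrow> profile K g x y"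
  unfolding profile_def
proof (intro tendsto_divide tendsto_const)
  show "(\<lambda>n. \<integral>z. g x z * truncated (\<sigma> n) x y z \<partial>lborel) \<longlonglongrightarrow> (\<integral>z. g x z * K x y z \<partial>lborel)"
  proof (rule integral_dominated_convergence[where w = "\<lambda>z. C * (wt x * wt y * \<phi> z)"])
    show "integrable lborel (\<lambda>z. C * (wt x * wt y * \<phi> z))"
      by (intro integrable_mult_right integrable_phi)
    show "AE z in lborel. (\<lambda>n. g x z * truncated (\<sigma> n) x y z) \<longlonglongrightarrow> g x z * K x y z"
      by (intro AE_I2 tendsto_intros truncated_tendsto)
    have "norm (g x z * truncated (\<sigma> n) x y z) \<le> C * (wt x * wt y * \<phi> z)" for n z
      using g[of x z] truncated_nonneg[of "\<sigma> n" x y z] truncated_le[of "\<sigma> n" x y z]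
      by (auto simp: abs_mult intro!: mult_mono)
    then show "AE z in lborel. norm (g x z * truncated (\<sigma> n) x y z) \<le> C * (wt x * wt y * \<phi> z)" for n
      by simp
  qed measurable
qed (use wt_pos[of x] wt_pos[of y] in auto)

text \<open>The quadratic term. The flux at the grid index of t is a double integral of the bounded
  \<open>profile\<close> against the law at time t, and \<open>double_integral_tendsto\<close> lets
  kernel and measure vary at once.\<close>

lemma real_flux_tendsto:
  assumes t: "0 \<le> t" "t < horizon"
  shows "(\<lambda>n. real_flux (\<sigma> n) g (idx (\<sigma> n) t)) \<longlonglongrightarrow> limit_flux g t"
proof -
  interpret equi_integrable_limit "\<lambda>n. law (\<sigma> n) t" bound "\<mu> t"
    using t by (rule limit_at)
  note PT = profile[OF truncated_measurable truncated_nonneg truncated_le g_measurable g]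
  note PK = profile[OF K_measurable K_nonneg K_bound g_measurable g]
  show ?thesis
    unfolding real_flux_eq[OF sigma_pos t(2) g_measurable g] limit_flux_def
    by (rule double_integral_tendsto[OF PT(1) PK(1) _ _ profile_tendsto, of "C * phi_norm"])
      (use PT(3,4) PK(3,4) in simp_all)
qed

lemma nn_limit_flux:
  assumes t: "0 \<le> t" "t < horizon"
  shows "(\<integral>\<^sup>+ x. \<integral>\<^sup>+ z. (\<integral>\<^sup>+ y. ennreal (K x y z) * ennreal (c t y) \<partial>lborel) * ennreal (c t x) * ennreal (g x z) \<partial>lborel \<partial>lborel) =
    ennreal (limit_flux g t)"
proof -
  interpret equi_integrable_limit "\<lambda>n. law (\<sigma> n) t" bound "\<mu> t"
    using t by (rule limit_at)
  show ?thesis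
    unfolding limit_flux_def
    by (rule nn_integral_profile[OF K_measurable K_nonneg K_bound g_measurable g _ mu_eq finite_mu]) measurable
qed

lemma limit_flux_bounds:
  assumes t: "0 \<le> t" "t < horizon"
  shows "0 \<le> limit_flux g t" "limit_flux g t \<le> C * phi_norm * bound\<^sup>2"
proof -
  show "0 \<le> limit_flux g t"
    unfolding limit_flux_def
    by (intro integral_nonneg_AE AE_I2 profile_nonneg[OF K_measurable K_nonneg K_bound g_measurable g])
  show "limit_flux g t \<le> C * phi_norm * bound\<^sup>2"
    by (rule LIMSEQ_le_const2[OF real_flux_tendsto[OF t]])
      (use real_flux_le[OF sigma_pos g_measurable g] in \<open>auto simp: abs_le_iff\<close>)
qed

text \<open>As a pointwise limit of step functions, \<open>limit_flux\<close> is measurable in time,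
  and the uniform flux bound allows dominated convergence. The Riemann sum differs from the integral
  of the step function by a multiple of one step length.\<close>

lemma flux_time_integral:
  assumes t: "0 \<le> t" "t < horizon"
  shows "integrable (lebesgue_on {0..t}) (limit_flux g)"
    and "(\<lambda>n. tau (\<sigma> n) * (\<Sum>j<idx (\<sigma> n) t. real_flux (\<sigma> n) g j)) \<longlonglongrightarrow> (\<integral>s. limit_flux g s \<partial>lebesgue_on {0..t})"
proof -
  let ?C = "C * phi_norm * bound\<^sup>2"
  let ?q = "\<lambda>n s. real_flux (\<sigma> n) g (nat \<lfloor>s / tau (\<sigma> n)\<rfloor>)"
  have bound_q: "\<bar>real_flux (\<sigma> n) g j\<bar> \<le> ?C" for n j
    by (rule real_flux_le[OF sigma_pos g_measurable g])
  note step = step_function_integral[where q = "real_flux (\<sigma> _) g", OF tau_pos[OF sigma_pos] t(1) bound_q]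
  have lim: "(\<lambda>n. ?q n s) \<longlonglongrightarrow> limit_flux g s" if "s \<in> {0..t}" for s
    using real_flux_tendsto[of s] that t by (simp add: idx_def)
  have meas: "limit_flux g \<in> borel_measurable (lebesgue_on {0..t})"
    by (rule borel_measurable_LIMSEQ_metric[OF step(1)]) (use lim in simp)
  have finite: "finite_measure (lebesgue_on {0..t})"
    by (intro finite_measure_lebesgue_on) simp
  then show "integrable (lebesgue_on {0..t}) (limit_flux g)"
    using limit_flux_bounds t meas
    by (intro finite_measure.integrable_const_bound[of _ _ ?C]) (auto intro!: AE_I2)
  have "(\<lambda>n. \<integral>s. ?q n s \<partial>lebesgue_on {0..t}) \<longlonglongrightarrow> (\<integral>s. limit_flux g s \<partial>lebesgue_on {0..t})"
  proof (rule integral_dominated_convergence[where w = "\<lambda>_. ?C", OF meas step(1)])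
    show "integrable (lebesgue_on {0..t}) (\<lambda>_. ?C)"
      using finite by (simp add: finite_measure.integrable_const)
  qed (use lim bound_q in \<open>auto intro!: AE_I2\<close>)
  moreover have "(\<lambda>n. tau (\<sigma> n) * (\<Sum>j<idx (\<sigma> n) t. real_flux (\<sigma> n) g j) - (\<integral>s. ?q n s \<partial>lebesgue_on {0..t})) \<longlonglongrightarrow> 0"
  proof (rule Lim_null_comparison)
    show "(\<lambda>n. ?C * tau (\<sigma> n)) \<longlonglongrightarrow> 0"
      by (intro tendsto_mult_right_zero tau_tendsto sigma_mono)
    show "\<forall>\<^sub>F n in sequentially. norm (tau (\<sigma> n) * (\<Sum>j<idx (\<sigma> n) t. real_flux (\<sigma> n) g j) -
        (\<integral>s. ?q n s \<partial>lebesgue_on {0..t})) \<le> ?C * tau (\<sigma> n)"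
      using step(2) by (simp add: idx_def abs_minus_commute)
  qed
  ultimately have "(\<lambda>n. (\<integral>s. ?q n s \<partial>lebesgue_on {0..t}) +
      (tau (\<sigma> n) * (\<Sum>j<idx (\<sigma> n) t. real_flux (\<sigma> n) g j) - (\<integral>s. ?q n s \<partial>lebesgue_on {0..t}))) \<longlonglongrightarrow>
      (\<integral>s. limit_flux g s \<partial>lebesgue_on {0..t}) + 0"
    by (rule tendsto_add)
  then show "(\<lambda>n. tau (\<sigma> n) * (\<Sum>j<idx (\<sigma> n) t. real_flux (\<sigma> n) g j)) \<longlonglongrightarrow> (\<integral>s. limit_flux g s \<partial>lebesgue_on {0..t})"
    by simp
qed

end

text \<open>Restricted to nonnegative \<open>f\<close>, like the discrete identity behind it; signs
  are restored later by subtracting a constant.\<close>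

lemma weak_form:
  fixes f :: "real \<Rightarrow> real"
  assumes t: "0 \<le> t" "t < horizon" and [measurable]: "f \<in> borel_measurable borel"
    and f: "\<And>x. 0 \<le> f x" "\<And>x. f x \<le> C"
  shows "(\<integral>x. f x * c t x \<partial>lborel) = (\<integral>x. f x * c0 x \<partial>lborel) +
    ((\<integral>s. limit_flux (\<lambda>x z. f (x + z) + f (x - z)) s \<partial>lebesgue_on {0..t}) -
     (\<integral>s. limit_flux (\<lambda>x z. 2 * f x) s \<partial>lebesgue_on {0..t}))"
proof -
  have "0 \<le> C"
    using order_trans[OF f(1) f(2)] by auto
  have f': "f x \<le> C * wt x" "\<bar>f x\<bar> \<le> C * wt x" for x
    using f[of x] mult_left_mono[OF wt_ge_1[of x] \<open>0 \<le> C\<close>] by auto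
  have I: "enn2real (\<integral>\<^sup>+ x. ennreal (f x) * euler (\<sigma> n) (idx (\<sigma> n) s) x \<partial>lborel) = (\<integral>x. f x / wt x \<partial>law (\<sigma> n) s)"
    if "s < horizon" for n s
    using f wt_pos by (subst nn_integral_euler[OF sigma_pos that assms(3) f(1) f'(1)])
      (auto intro!: integral_nonneg_AE enn2real_ennreal simp: less_imp_le)
  let ?in = "\<lambda>x z. f (x + z) + f (x - z)" and ?out = "\<lambda>x z. 2 * f x"
  have "(\<integral>x. f x / wt x \<partial>law (\<sigma> n) t) = (\<integral>x. f x / wt x \<partial>law (\<sigma> n) 0) +
      (tau (\<sigma> n) * (\<Sum>j<idx (\<sigma> n) t. real_flux (\<sigma> n) ?in j) - tau (\<sigma> n) * (\<Sum>j<idx (\<sigma> n) t. real_flux (\<sigma> n) ?out j))" for n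
    using discrete_weak_form[OF sigma_pos idx_le[OF sigma_pos t(2)] assms(3) f, of n] I[OF t(2), of n] I[OF horizon_pos, of n]
    by (simp add: idx_def)
  moreover have "(\<lambda>n. (\<integral>x. f x / wt x \<partial>law (\<sigma> n) 0) +
      (tau (\<sigma> n) * (\<Sum>j<idx (\<sigma> n) t. real_flux (\<sigma> n) ?in j) - tau (\<sigma> n) * (\<Sum>j<idx (\<sigma> n) t. real_flux (\<sigma> n) ?out j))) \<longlonglongrightarrow>
    (\<integral>x. f x * c 0 x \<partial>lborel) +
      ((\<integral>s. limit_flux ?in s \<partial>lebesgue_on {0..t}) - (\<integral>s. limit_flux ?out s \<partial>lebesgue_on {0..t}))"
  proof (intro tendsto_add tendsto_diff)
    show "(\<lambda>n. \<integral>x. f x / wt x \<partial>law (\<sigma> n) 0) \<longlonglongrightarrow> (\<integral>x. f x * c 0 x \<partial>lborel)"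
      by (rule test_tendsto[OF _ horizon_pos assms(3) f'(2)]) simp
    show "(\<lambda>n. tau (\<sigma> n) * (\<Sum>j<idx (\<sigma> n) t. real_flux (\<sigma> n) ?in j)) \<longlonglongrightarrow> (\<integral>s. limit_flux ?in s \<partial>lebesgue_on {0..t})"
    proof (rule flux_time_integral(2)[OF _ _ _ t])
      show "f (x + z) + f (x - z) \<le> 2 * C" for x z
        using f(2)[of "x + z"] f(2)[of "x - z"] by simp
    qed (simp_all add: f add_nonneg_nonneg)
    show "(\<lambda>n. tau (\<sigma> n) * (\<Sum>j<idx (\<sigma> n) t. real_flux (\<sigma> n) ?out j)) \<longlonglongrightarrow> (\<integral>s. limit_flux ?out s \<partial>lebesgue_on {0..t})"
      by (rule flux_time_integral(2)[where C = "2 * C", OF _ _ _ t]) (simp_all add: f)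
  qed
  moreover have "(\<lambda>n. \<integral>x. f x / wt x \<partial>law (\<sigma> n) t) \<longlonglongrightarrow> (\<integral>x. f x * c t x \<partial>lborel)"
    by (rule test_tendsto[OF t assms(3) f'(2)])
  ultimately show ?thesis
    unfolding c_0 by (simp add: LIMSEQ_unique)
qed

end

section \<open>Borel representatives\<close>

lemma closed_lebesgue: "closed S \<Longrightarrow> S \<in> sets lebesgue"
  by (rule sets_completionI_sets) simp

lemma AE_lebesgue_on_iff:
  "S \<in> sets lebesgue \<Longrightarrow> (AE x in lebesgue_on S. P x) \<longleftrightarrow> (AE x in lborel. x \<in> S \<longrightarrow> P x)"
  by (simp add: AE_restrict_space_iff AE_completion_iff)

text \<open>The bridge between integrals over a Lebesgue measurable set and Borel functions on the
  whole space. Measurability of \<open>f\<close> is not assumed: it follows from the agreement with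
  \<open>h\<close>, since Lebesgue measure is complete.\<close>

lemma lebesgue_on_eq_lborel:
  fixes f h :: "'a::euclidean_space \<Rightarrow> real"
  assumes S [measurable]: "S \<in> sets lebesgue" and h [measurable]: "h \<in> borel_measurable borel"
    and h0: "\<And>x. x \<notin> S \<Longrightarrow> h x = 0" and ae: "AE x in lborel. x \<in> S \<longrightarrow> f x = h x"
  shows "integrable (lebesgue_on S) f \<longleftrightarrow> integrable lborel h"
    and "integral\<^sup>L (lebesgue_on S) f = integral\<^sup>L lborel h"
    and "(\<integral>\<^sup>+ x. ennreal (f x) \<partial>lebesgue_on S) = (\<integral>\<^sup>+ x. ennreal (h x) \<partial>lborel)"
proof -
  have hl: "h \<in> borel_measurable lebesgue"
    by (intro measurable_completion) simp
  have eq: "AE x in lebesgue. h x = indicator S x *\<^sub>R f x"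
    using ae h0 by (intro AE_completion) (auto elim!: eventually_mono simp: indicator_def)
  have fl: "(\<lambda>x. indicator S x *\<^sub>R f x) \<in> borel_measurable lebesgue"
    by (rule borel_measurable_AE[OF hl eq])
  show "integrable (lebesgue_on S) f \<longleftrightarrow> integrable lborel h"
    using integrable_cong_AE[OF hl fl eq] integrable_completion[of h lborel]
    by (simp add: integrable_restrict_space)
  show "integral\<^sup>L (lebesgue_on S) f = integral\<^sup>L lborel h"
    using integral_cong_AE[OF hl fl eq] integral_completion[of h lborel]
    by (simp add: integral_restrict_space)
  have "(\<integral>\<^sup>+ x. ennreal (f x) \<partial>lebesgue_on S) = (\<integral>\<^sup>+ x. ennreal (f x) * indicator S x \<partial>lebesgue)"
    by (rule nn_integral_restrict_space) simp
  also have "\<dots> = (\<integral>\<^sup>+ x. ennreal (h x) \<partial>lebesgue)"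
    by (rule nn_integral_cong_AE, rule eventually_mono[OF eq]) (auto simp: indicator_def)
  finally show "(\<integral>\<^sup>+ x. ennreal (f x) \<partial>lebesgue_on S) = (\<integral>\<^sup>+ x. ennreal (h x) \<partial>lborel)"
    by (simp add: nn_integral_completion)
qed

text \<open>The exceptional set lies in the image of a null set under the left inverse
  \<open>T'\<close>, and linear maps of a space into itself send null sets to null sets.\<close>

lemma AE_lborel_linear:
  fixes T T' :: "'a::euclidean_space \<Rightarrow> 'a"
  assumes "linear T'" "\<And>x. T' (T x) = x" and P: "AE x in lborel. P x"
  shows "AE x in lborel. P (T x)"
proof -
  obtain N where N: "N \<in> null_sets lborel" "{x. \<not> P x} \<subseteq> N"
    using P unfolding eventually_ae_filter by auto
  then have "negligible N"
    by (simp add: negligible_iff_null_sets null_sets_completionI)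
  then have "negligible (T' ` N)"
    using assms(1) by (intro negligible_differentiable_image_negligible linear_imp_differentiable_on) auto
  moreover have "{x. \<not> P (T x)} \<subseteq> T' ` N"
  proof
    fix x assume "x \<in> {x. \<not> P (T x)}"
    then have "T x \<in> N"
      using N by auto
    then show "x \<in> T' ` N"
      by (rule rev_image_eqI) (simp add: assms(2))
  qed
  ultimately have "AE x in lebesgue. P (T x)"
    unfolding negligible_iff_null_sets eventually_ae_filter by auto
  then show ?thesis
    by (simp add: AE_completion_iff)
qed

lemma nn_integral_lborel_pair:
  fixes f :: "('a::euclidean_space \<times> 'b::euclidean_space) \<Rightarrow> ennreal"
  assumes [measurable]: "f \<in> borel_measurable borel"
  shows "(\<integral>\<^sup>+ p. f p \<partial>lborel) = (\<integral>\<^sup>+ x. \<integral>\<^sup>+ y. f (x, y) \<partial>lborel \<partial>lborel)"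
proof -
  have "f \<in> borel_measurable (lborel \<Otimes>\<^sub>M lborel)"
    by (simp add: lborel_prod)
  then show ?thesis
    unfolding lborel_prod[symmetric] by (rule lborel.nn_integral_fst[symmetric])
qed

lemma nn_integral_lborel_triple:
  fixes f :: "real \<times> real \<times> real \<Rightarrow> ennreal"
  assumes [measurable]: "f \<in> borel_measurable borel"
  shows "(\<integral>\<^sup>+ p. f p \<partial>lborel) = (\<integral>\<^sup>+ x. \<integral>\<^sup>+ y. \<integral>\<^sup>+ z. f (x, y, z) \<partial>lborel \<partial>lborel \<partial>lborel)"
proof -
  have "(\<lambda>q. f (x, q)) \<in> borel_measurable borel" for x
    by measurable
  then show ?thesis
    by (simp add: nn_integral_lborel_pair)
qed

lemma AE_lborel_pair:
  fixes P :: "('a::euclidean_space \<times> 'b::euclidean_space) \<Rightarrow> bool"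
  assumes "AE p in lborel. P p"
  shows "AE x in lborel. AE y in lborel. P (x, y)"
  using assms unfolding lborel_prod[symmetric] by (rule lborel_pair.AE_pair)

lemma AE_lborel_triple:
  fixes P :: "real \<times> real \<times> real \<Rightarrow> bool"
  assumes "AE p in lborel. P p"
  shows "AE x in lborel. AE y in lborel. AE z in lborel. P (x, y, z)"
  using AE_lborel_pair[OF assms] by (rule eventually_mono) (rule AE_lborel_pair)

lemma AE_lborel_fst:
  fixes P :: "'a::euclidean_space \<Rightarrow> bool"
  assumes "AE x in lborel. P x"
  shows "AE p in (lborel :: ('a \<times> 'b::euclidean_space) measure). P (fst p)"
proof -
  obtain N where N: "N \<in> null_sets lborel" "{x. \<not> P x} \<subseteq> N"
    using assms unfolding eventually_ae_filter by auto
  have "N \<times> UNIV \<in> null_sets (lborel \<Otimes>\<^sub>M (lborel :: 'b measure))"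
    using N by (intro null_setsI) (auto simp: lborel.emeasure_pair_measure_Times null_sets_def)
  then have "N \<times> UNIV \<in> null_sets (lborel :: ('a \<times> 'b) measure)"
    by (simp add: lborel_prod)
  moreover have "{p \<in> space lborel. \<not> P (fst p)} \<subseteq> N \<times> (UNIV :: 'b set)"
    using N(2) by auto
  ultimately show ?thesis
    unfolding eventually_ae_filter by blast
qed

lemma linear_triple_shear:
  "linear (\<lambda>p :: real \<times> real \<times> real. (fst p + s * snd (snd p), fst (snd p), snd (snd p)))"
  by (rule linearI) (auto simp: algebra_simps)

text \<open>Shears with factors s and -s are inverse to each other. Second differences evaluate
  functions at x + z and x - z, and the shears carry almost everywhere statements to these
  points.\<close>

lemma AE_triple_shear:
  assumes "AE p in (lborel :: (real \<times> real \<times> real) measure). P (fst p) (fst (snd p)) (snd (snd p))"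
  shows "AE p in (lborel :: (real \<times> real \<times> real) measure). P (fst p + s * snd (snd p)) (fst (snd p)) (snd (snd p))"
  using AE_lborel_linear[OF linear_triple_shear[of "-s"] _ assms,
      of "\<lambda>p. (fst p + s * snd (snd p), fst (snd p), snd (snd p))"] by simp

lemma AE_triple_third:
  fixes P :: "real \<Rightarrow> bool"
  assumes "AE z in lborel. P z"
  shows "AE p in (lborel :: (real \<times> real \<times> real) measure). P (snd (snd p))"
proof -
  have "linear (\<lambda>p :: real \<times> real \<times> real. (snd (snd p), fst (snd p), fst p))"
    by (rule linearI) auto
  from AE_lborel_linear[OF this, of "\<lambda>p. (snd (snd p), fst (snd p), fst p)", OF _ AE_lborel_fst[OF assms]]
  show ?thesis
    by simp
qed

section \<open>From the one-sided bound on the second derivative to second differences\<close>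

lemma second_difference_bound:
  fixes k k1 k2 :: "real \<Rightarrow> real"
  assumes k1: "\<And>x. 0 \<le> x \<Longrightarrow> (k has_real_derivative k1 x) (at x within {0..})"
    and k2: "\<And>x. 0 \<le> x \<Longrightarrow> (k1 has_real_derivative k2 x) (at x within {0..})"
    and B: "\<And>x. 0 \<le> x \<Longrightarrow> k2 x \<le> B" and s: "0 \<le> s" "s \<le> x"
  shows "k (x + s) + k (x - s) \<le> 2 * k x + s\<^sup>2 * B"
proof -
  have interior: "at w within {0..} = at w" if "0 < w" for w :: real
    using that by (intro at_within_interior) (auto simp: interior_real_atLeast)
  have cont: "continuous_on {0..} k" "continuous_on {0..} k1"
    using k1 k2 by (auto intro!: DERIV_continuous_on)
  have slope: "k1 (x + u) - k1 (x - u) \<le> 2 * u * B" if "0 < u" "u < s" for u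
  proof -
    \<comment> \<open>Monotonicity of \<open>k1 w - B * w\<close> replaces an integration of
      \<open>k2\<close>, about which no integrability is known.\<close>
    have "k1 (x + u) - B * (x + u) \<le> k1 (x - u) - B * (x - u)"
    proof (rule DERIV_nonpos_imp_decreasing_open[where f = "\<lambda>w. k1 w - B * w" and a = "x - u" and b = "x + u"])
      show "x - u \<le> x + u"
        using that by simp
      show "\<exists>y. ((\<lambda>w. k1 w - B * w) has_real_derivative y) (at w) \<and> y \<le> 0" if "x - u < w" "w < x + u" for w
      proof -
        have "0 < w"
          using that \<open>u < s\<close> s by simp
        then have "((\<lambda>w. k1 w - B * w) has_real_derivative k2 w - B) (at w)"
          using k2[of w] interior[of w] by (auto intro!: derivative_eq_intros)
        with B[of w] \<open>0 < w\<close> show ?thesis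
          by (intro exI[of _ "k2 w - B"]) auto
      qed
      show "continuous_on {x - u..x + u} (\<lambda>w. k1 w - B * w)"
        using that s by (intro continuous_intros continuous_on_subset[OF cont(2)]) auto
    qed
    then show ?thesis
      by (simp add: algebra_simps)
  qed
  \<comment> \<open>The comparison is with step 0, where the expression is 2 * k x. Derivatives are
    taken for steps strictly between 0 and s, so x - s = 0 is allowed.\<close>
  have "k (x + s) + k (x - s) - s\<^sup>2 * B \<le> k (x + 0) + k (x - 0) - 0\<^sup>2 * B"
  proof (rule DERIV_nonpos_imp_decreasing_open[where f = "\<lambda>s. k (x + s) + k (x - s) - s\<^sup>2 * B" and a = 0 and b = s])
    show "\<exists>y. ((\<lambda>s. k (x + s) + k (x - s) - s\<^sup>2 * B) has_real_derivative y) (at u) \<and> y \<le> 0" if "0 < u" "u < s" for u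
    proof -
      have deriv: "(k has_real_derivative k1 (x + u)) (at (x + u))" "(k has_real_derivative k1 (x - u)) (at (x - u))"
        using k1[of "x + u"] k1[of "x - u"] interior[of "x + u"] interior[of "x - u"] that s by auto
      have "((\<lambda>s. k (x + s)) has_real_derivative k1 (x + u) * 1) (at u)"
        by (rule DERIV_chain2[where g = "\<lambda>s. x + s", OF deriv(1)]) (auto intro!: derivative_eq_intros)
      moreover have "((\<lambda>s. k (x - s)) has_real_derivative k1 (x - u) * (0 - 1)) (at u)"
        by (rule DERIV_chain2[where g = "\<lambda>s. x - s", OF deriv(2)]) (auto intro!: derivative_eq_intros)
      moreover have "((\<lambda>s. s\<^sup>2 * B) has_real_derivative 2 * u * B) (at u)"
        by (auto intro!: derivative_eq_intros)
      ultimately have "((\<lambda>s. k (x + s) + k (x - s) - s\<^sup>2 * B) has_real_derivative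
          k1 (x + u) * 1 + k1 (x - u) * (0 - 1) - 2 * u * B) (at u)"
        by (intro DERIV_diff DERIV_add)
      with slope[OF that] show ?thesis
        by (intro exI[of _ "k1 (x + u) * 1 + k1 (x - u) * (0 - 1) - 2 * u * B"]) auto
    qed
    show "continuous_on {0..s} (\<lambda>s. k (x + s) + k (x - s) - s\<^sup>2 * B)"
      using s by (intro continuous_intros continuous_on_compose2[OF cont(1)]) auto
  qed (use s in simp)
  then show ?thesis
    by simp
qed

text \<open>Below the threshold \<open>z\<close>, where \<open>k\<close> vanishes, the second difference reduces to \<open>k (x + z)\<close>,
  which is a second difference centred at \<open>z\<close>.\<close>

lemma truncated_second_difference_bound:
  fixes k k1 k2 :: "real \<Rightarrow> real"
  assumes k1: "\<And>x. 0 \<le> x \<Longrightarrow> (k has_real_derivative k1 x) (at x within {0..})"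
    and k2: "\<And>x. 0 \<le> x \<Longrightarrow> (k1 has_real_derivative k2 x) (at x within {0..})"
    and B: "\<And>x. 0 \<le> x \<Longrightarrow> k2 x \<le> B" "0 \<le> B" and z: "0 < z"
    and zero: "\<And>x. 0 \<le> x \<Longrightarrow> x < z \<Longrightarrow> k x = 0"
  defines "kt \<equiv> \<lambda>x. if z \<le> x then k x else 0"
  shows "kt (x + z) + kt (x - z) \<le> 2 * kt x + z\<^sup>2 * B"
proof -
  have kt: "kt w = k w" if "0 \<le> w" for w
    using zero[of w] that by (auto simp: kt_def)
  consider "z \<le> x" | "0 \<le> x" "x < z" | "x < 0"
    by linarith
  then show ?thesis
  proof cases
    case 1
    then show ?thesis
      using second_difference_bound[OF k1 k2 B(1), of z x] z kt by simp
  next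
    case 2
    \<comment> \<open>\<open>zero\<close> says nothing at z itself; the value there is forced by
      continuity from the left.\<close>
    have "isCont k z"
      using DERIV_isCont[of k "k1 z" z] k1[of z] z at_within_interior[of z "{0..}"] by (simp add: interior_real_atLeast)
    then have "(k \<longlongrightarrow> k z) (at_left z)"
      unfolding isCont_def by (rule tendsto_within_subset) simp
    moreover have "(k \<longlongrightarrow> 0) (at_left z)"
      using zero z by (intro tendsto_eventually) (auto simp: eventually_at_left_field intro!: exI[of _ 0])
    ultimately have "k z = 0"
      using tendsto_unique trivial_limit_at_left_real by blast
    moreover have "k (z + x) + k (z - x) \<le> 2 * k z + x\<^sup>2 * B"
      using 2 by (intro second_difference_bound[OF k1 k2 B(1)]) auto
    moreover have "k (z - x) = 0"
      using 2 zero[of "z - x"] \<open>k z = 0\<close> by (cases "x = 0") auto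
    moreover have "x\<^sup>2 * B \<le> z\<^sup>2 * B"
      using 2 B(2) by (intro mult_right_mono power_mono) auto
    ultimately have "k (x + z) \<le> z\<^sup>2 * B"
      by (simp add: add.commute)
    with 2 kt[of "x + z"] z show ?thesis
      by (simp add: kt_def)
  next
    case 3
    then show ?thesis
      using z B(2) by (simp add: kt_def)
  qed
qed

section \<open>Transfer of densities, kernels and test functions to Borel functions on the
  line\<close>

lemma max_1_square_le_wt: "(max 1 x)\<^sup>2 \<le> wt x"
  by (simp add: max_def wt_def)

lemma half_line_density:
  assumes c' [measurable]: "c' \<in> borel_measurable borel" and nonneg: "\<And>x. 0 \<le> c' x"
    and negative: "\<And>x. x < 0 \<Longrightarrow> c' x = 0" and ae: "AE x in lborel. 0 \<le> x \<longrightarrow> c x = c' x"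
  shows "c \<in> Y_cone 0 2 \<longleftrightarrow> integrable lborel (\<lambda>x. wt x * c' x)"
    and "Y_norm 0 2 c = (\<integral>x. wt x * c' x \<partial>lborel)"
    and "moment 0 c = (\<integral>x. c' x \<partial>lborel)"
    and "moment 1 c = (\<integral>x. max 0 x * c' x \<partial>lborel)"
    and "moment 2 c = (\<integral>x. x\<^sup>2 * c' x \<partial>lborel)"
    and "integrable (lebesgue_on \<real>\<^sub>+) c \<longleftrightarrow> integrable lborel c'"
proof -
  have S: "\<real>\<^sub>+ \<in> sets lebesgue"
    by simp
  \<comment> \<open>The point 0 is discarded as well: \<open>0 powr 0\<close> is 0, so the powers
    match the weight only for x > 0.\<close>
  have ae': "AE x in lborel. x \<in> \<real>\<^sub>+ \<longrightarrow> c x = c' x \<and> 0 < x"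
    using ae AE_lborel_singleton[of "0::real"] by eventually_elim auto
  have transfer: "integrable (lebesgue_on \<real>\<^sub>+) f \<longleftrightarrow> integrable lborel h" "integral\<^sup>L (lebesgue_on \<real>\<^sub>+) f = integral\<^sup>L lborel h"
    if [measurable]: "h \<in> borel_measurable borel" and "\<And>x. x < 0 \<Longrightarrow> h x = 0"
      and eq: "\<And>x. 0 < x \<Longrightarrow> c x = c' x \<Longrightarrow> f x = h x" for f h :: "real \<Rightarrow> real"
  proof -
    have "AE x in lborel. x \<in> \<real>\<^sub>+ \<longrightarrow> f x = h x"
      using ae' by eventually_elim (use eq in auto)
    moreover have "h x = 0" if "x \<notin> \<real>\<^sub>+" for x
      using that \<open>\<And>x. x < 0 \<Longrightarrow> h x = 0\<close> by simp
    ultimately show "integrable (lebesgue_on \<real>\<^sub>+) f \<longleftrightarrow> integrable lborel h"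
      "integral\<^sup>L (lebesgue_on \<real>\<^sub>+) f = integral\<^sup>L lborel h"
      using lebesgue_on_eq_lborel(1,2)[OF S that(1), of f] by blast+
  qed
  have norm_eq: "(x powr (- 0) + x powr 2) * \<bar>c x\<bar> = wt x * c' x" if "0 < x" "c x = c' x" for x
    using that nonneg[of x] by (simp add: wt_def)
  have "AE x in lebesgue_on \<real>\<^sub>+. 0 \<le> c x"
    unfolding AE_lebesgue_on_iff[OF S] using ae by eventually_elim (use nonneg in auto)
  moreover show int_c: "integrable (lebesgue_on \<real>\<^sub>+) c \<longleftrightarrow> integrable lborel c'"
    by (rule transfer) (auto simp: negative)
  moreover have "integrable (lebesgue_on \<real>\<^sub>+) (\<lambda>x. (x powr (- 0) + x powr 2) * \<bar>c x\<bar>) \<longleftrightarrow> integrable lborel (\<lambda>x. wt x * c' x)"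
    by (rule transfer[OF _ _ norm_eq]) (auto simp: negative)
  moreover have "integrable lborel c'" if "integrable lborel (\<lambda>x. wt x * c' x)"
  proof (rule Bochner_Integration.integrable_bound[OF that])
    have "c' x \<le> wt x * c' x" for x
      using mult_right_mono[OF wt_ge_1[of x] nonneg[of x]] by simp
    then show "AE x in lborel. norm (c' x) \<le> norm (wt x * c' x)"
      using nonneg wt_pos by (auto simp: abs_mult less_imp_le)
  qed measurable
  ultimately show "c \<in> Y_cone 0 2 \<longleftrightarrow> integrable lborel (\<lambda>x. wt x * c' x)"
    unfolding Y_cone_def Y_space_def by auto
  show "Y_norm 0 2 c = (\<integral>x. wt x * c' x \<partial>lborel)"
    unfolding Y_norm_def by (rule transfer[OF _ _ norm_eq]) (auto simp: negative)
  show "moment 0 c = (\<integral>x. c' x \<partial>lborel)"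
    unfolding moment_def by (rule transfer) (auto simp: negative)
  show "moment 1 c = (\<integral>x. max 0 x * c' x \<partial>lborel)"
    unfolding moment_def by (rule transfer) (auto simp: negative)
  show "moment 2 c = (\<integral>x. x\<^sup>2 * c' x \<partial>lborel)"
    unfolding moment_def by (rule transfer) (auto simp: negative)
qed

lemma ex_half_line_density:
  assumes "c \<in> Y_cone 0 2"
  obtains c' where "c' \<in> borel_measurable borel" "\<And>x. 0 \<le> c' x" "\<And>x. x < 0 \<Longrightarrow> c' x = 0"
    "AE x in lborel. 0 \<le> x \<longrightarrow> c x = c' x"
proof -
  have S: "\<real>\<^sub>+ \<in> sets lebesgue"
    by simp
  have "c \<in> borel_measurable (lebesgue_on \<real>\<^sub>+)" and pos: "AE x in lborel. x \<in> \<real>\<^sub>+ \<longrightarrow> 0 \<le> c x"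
    using assms by (auto simp: Y_cone_def Y_space_def AE_lebesgue_on_iff)
  then have "(\<lambda>x. if x \<in> \<real>\<^sub>+ then c x else 0) \<in> borel_measurable lebesgue"
    by (subst borel_measurable_if) auto
  then obtain g where [measurable]: "g \<in> borel_measurable borel" and g: "AE x in lborel. (if x \<in> \<real>\<^sub>+ then c x else 0) = g x"
    using completion_ex_borel_measurable_real by force
  show ?thesis
  proof
    show "(\<lambda>x. max 0 (g x) * indicator {0..} x) \<in> borel_measurable borel"
      by measurable
    show "AE x in lborel. 0 \<le> x \<longrightarrow> c x = max 0 (g x) * indicator {0..} x"
      using g pos by eventually_elim (auto simp: max_def)
  qed auto
qed

text \<open>The minimum with \<open>wt x * wt y * \<psi> z\<close> and the explicit support restore
  at every point what a Borel representative keeps only almost everywhere. A second difference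
  involves three points at once, so it is compared with that of \<open>K\<close> for almost every
  triple, by means of shears.\<close>

lemma ex_borel_kernel:
  fixes K K\<^sub>1 K\<^sub>2 :: "real \<Rightarrow> real \<Rightarrow> real \<Rightarrow> real" and \<phi> \<psi> :: "real \<Rightarrow> real"
  assumes K_measurable:
      "(\<lambda>(x, y, z). K x y z) \<in> borel_measurable (lebesgue_on (\<real>\<^sub>+ \<times> \<real>\<^sub>+ \<times> \<real>\<^sub>+))"
    and K_nonneg: "\<And>x y z. \<lbrakk>x \<ge> 0; y \<ge> 0; z \<ge> 0\<rbrakk> \<Longrightarrow> 0 \<le> K x y z"
    and K_sym: "\<And>x y z. \<lbrakk>x \<ge> 0; y \<ge> 0; z \<ge> 0\<rbrakk> \<Longrightarrow> K x y z = K y x z"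
    and K_zero: "\<And>x y z. \<lbrakk>x \<ge> 0; y \<ge> 0; z \<ge> 0; z > x\<rbrakk> \<Longrightarrow> K x y z = 0"
    and K_bound: "\<And>x y z. \<lbrakk>x \<ge> 0; y \<ge> 0; z \<ge> 0\<rbrakk>
      \<Longrightarrow> K x y z \<le> (max 1 x)\<^sup>2 * (max 1 y)\<^sup>2 * \<phi> z"
    and K_deriv1: "\<And>x y z. \<lbrakk>x \<ge> 0; y \<ge> 0; z \<ge> 0\<rbrakk>
      \<Longrightarrow> ((\<lambda>x. K x y z) has_real_derivative K\<^sub>1 x y z) (at x within \<real>\<^sub>+)"
    and K_deriv2: "\<And>x y z. \<lbrakk>x \<ge> 0; y \<ge> 0; z \<ge> 0\<rbrakk>
      \<Longrightarrow> ((\<lambda>x. K\<^sub>1 x y z) has_real_derivative K\<^sub>2 x y z) (at x within \<real>\<^sub>+)"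
    and K_deriv2_bound: "\<And>x y z. \<lbrakk>x \<ge> 0; y \<ge> 0; z \<ge> 0\<rbrakk>
      \<Longrightarrow> K\<^sub>2 x y z \<le> (max 1 y)\<^sup>2 * \<phi> z"
    and psi [measurable]: "\<psi> \<in> borel_measurable borel" and psi_nonneg: "\<And>z. 0 \<le> \<psi> z"
    and psi_eq: "AE z in lborel. 0 \<le> z \<longrightarrow> \<phi> z = \<psi> z"
  obtains K' :: "real \<Rightarrow> real \<Rightarrow> real \<Rightarrow> real" where
    "(\<lambda>(x, y, z). K' x y z) \<in> borel_measurable (borel \<Otimes>\<^sub>M borel \<Otimes>\<^sub>M borel)"
    "\<And>x y z. 0 \<le> K' x y z" "\<And>x y z. K' x y z \<noteq> 0 \<Longrightarrow> 0 \<le> z \<and> z \<le> x \<and> z \<le> y"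
    "\<And>x y z. K' x y z \<le> wt x * wt y * \<psi> z"
    "AE x in lborel. AE y in lborel. AE z in lborel.
      K' (x + z) y z + K' (x - z) y z \<le> 2 * K' x y z + z\<^sup>2 * wt y * \<psi> z"
    "AE p in lborel. p \<in> \<real>\<^sub>+ \<times> \<real>\<^sub>+ \<times> \<real>\<^sub>+ \<longrightarrow>
      K (fst p) (fst (snd p)) (snd (snd p)) = K' (fst p) (fst (snd p)) (snd (snd p))"
proof -
  let ?S = "\<real>\<^sub>+ \<times> \<real>\<^sub>+ \<times> \<real>\<^sub>+"
  have S: "?S \<in> sets lebesgue"
    by (intro closed_lebesgue closed_Times) auto
  \<comment> \<open>For \<open>z > y\<close> the zero comes from the symmetry of
    \<open>K\<close>.\<close>
  have K0: "K x y z = 0" if "x \<ge> 0" "y \<ge> 0" "z \<ge> 0" "\<not> (z \<le> x \<and> z \<le> y)" for x y z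
    using that K_zero[of x y z] K_zero[of y x z] K_sym[of x y z] by (cases "z \<le> x") auto
  \<comment> \<open>Read off from the bound at x = y = 0, hence valid at every point and not just
    almost everywhere.\<close>
  have phi_nonneg: "0 \<le> \<phi> z" if "0 \<le> z" for z
    using K_nonneg[of 0 0 z] K_bound[of 0 0 z] that by simp
  have "(\<lambda>p. if p \<in> ?S then (case p of (x, y, z) \<Rightarrow> K x y z) else 0) \<in> borel_measurable lebesgue"
    using K_measurable by (subst borel_measurable_if[OF S])
  then obtain g where [measurable]: "g \<in> borel_measurable borel" and
    g: "AE p in lborel. (if p \<in> ?S then (case p of (x, y, z) \<Rightarrow> K x y z) else 0) = g p"
    using completion_ex_borel_measurable_real by force
  define K' where "K' x y z = (if 0 \<le> z \<and> z \<le> x \<and> z \<le> y then max 0 (min (g (x, y, z)) (wt x * wt y * \<psi> z)) else 0)" for x y z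
  have bound_nonneg: "0 \<le> wt x * wt y * \<psi> z" for x y z
    using wt_pos[of x] wt_pos[of y] psi_nonneg[of z] by simp
  have eq: "AE p in lborel. p \<in> ?S \<longrightarrow>
      K (fst p) (fst (snd p)) (snd (snd p)) = K' (fst p) (fst (snd p)) (snd (snd p))"
    using g AE_triple_third[OF psi_eq]
  proof eventually_elim
    fix p :: "real \<times> real \<times> real"
    assume gp: "(if p \<in> ?S then (case p of (x, y, z) \<Rightarrow> K x y z) else 0) = g p"
      and phi: "0 \<le> snd (snd p) \<longrightarrow> \<phi> (snd (snd p)) = \<psi> (snd (snd p))"
    obtain x y z where p: "p = (x, y, z)"
      by (cases p)
    show "p \<in> ?S \<longrightarrow> K (fst p) (fst (snd p)) (snd (snd p)) = K' (fst p) (fst (snd p)) (snd (snd p))"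
    proof
      assume "p \<in> ?S"
      then have xyz: "0 \<le> x" "0 \<le> y" "0 \<le> z"
        by (auto simp: p)
      have "g (x, y, z) = K x y z"
        using gp \<open>p \<in> ?S\<close> by (simp add: p)
      moreover have "K x y z \<le> wt x * wt y * \<psi> z"
      proof -
        have "K x y z \<le> (max 1 x)\<^sup>2 * (max 1 y)\<^sup>2 * \<psi> z"
          using K_bound[OF xyz] phi xyz by (simp add: p)
        also have "\<dots> \<le> wt x * wt y * \<psi> z"
          using wt_pos psi_nonneg by (intro mult_right_mono mult_mono max_1_square_le_wt) (auto simp: less_imp_le)
        finally show ?thesis .
      qed
      ultimately show "K (fst p) (fst (snd p)) (snd (snd p)) = K' (fst p) (fst (snd p)) (snd (snd p))"
        using K_nonneg[OF xyz] K0[OF xyz] xyz by (auto simp: p K'_def)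
    qed
  qed
  have second: "AE p in lborel. (case p of (x, y, z) \<Rightarrow>
      K' (x + z) y z + K' (x - z) y z \<le> 2 * K' x y z + z\<^sup>2 * wt y * \<psi> z)"
  proof -
    define E where "E x y z \<longleftrightarrow> 0 \<le> x \<and> 0 \<le> y \<and> 0 \<le> z \<longrightarrow> K x y z = K' x y z" for x y z
    have E: "AE p in lborel. E (fst p) (fst (snd p)) (snd (snd p))"
      using eq by eventually_elim (auto simp: E_def mem_Times_iff)
    \<comment> \<open>The estimate in one variable is for positive z; the plane z = 0 is
      null.\<close>
    have nz: "AE p in (lborel :: (real \<times> real \<times> real) measure). snd (snd p) \<noteq> 0"
      by (rule AE_triple_third[OF AE_lborel_singleton])
    show ?thesis
      using E AE_triple_shear[OF E, of 1] AE_triple_shear[OF E, of "-1"] AE_triple_third[OF psi_eq] nz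
    proof eventually_elim
      fix p :: "real \<times> real \<times> real"
      obtain x y z where p: "p = (x, y, z)"
        by (cases p)
      assume "E (fst p) (fst (snd p)) (snd (snd p))"
        "E (fst p + 1 * snd (snd p)) (fst (snd p)) (snd (snd p))"
        "E (fst p + - 1 * snd (snd p)) (fst (snd p)) (snd (snd p))"
        "0 \<le> snd (snd p) \<longrightarrow> \<phi> (snd (snd p)) = \<psi> (snd (snd p))" "snd (snd p) \<noteq> 0"
      then have E: "E x y z" "E (x + z) y z" "E (x - z) y z" and phi: "0 \<le> z \<Longrightarrow> \<phi> z = \<psi> z" and "z \<noteq> 0"
        by (simp_all add: p)
      have rhs: "0 \<le> z\<^sup>2 * wt y * \<psi> z"
        using wt_pos[of y] psi_nonneg[of z] by simp
      have "K' (x + z) y z + K' (x - z) y z \<le> 2 * K' x y z + z\<^sup>2 * wt y * \<psi> z"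
      proof (cases "0 < z \<and> z \<le> y")
        case False
        with \<open>z \<noteq> 0\<close> have "K' w y z = 0" for w
          by (auto simp: K'_def)
        with rhs show ?thesis
          by simp
      next
        case True
        let ?kt = "\<lambda>w. if z \<le> w then K w y z else 0"
        let ?B = "(max 1 y)\<^sup>2 * \<phi> z"
        have kt: "K' w y z = ?kt w" if "E w y z" for w
          using True that by (auto simp: E_def K'_def)
        have "?kt (x + z) + ?kt (x - z) \<le> 2 * ?kt x + z\<^sup>2 * ?B"
          by (rule truncated_second_difference_bound[where k = "\<lambda>x. K x y z" and ?k1.0 = "\<lambda>x. K\<^sub>1 x y z" and ?k2.0 = "\<lambda>x. K\<^sub>2 x y z"])
            (use True K_deriv1 K_deriv2 K_deriv2_bound K_zero phi_nonneg in auto)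
        also have "z\<^sup>2 * ?B \<le> z\<^sup>2 * (wt y * \<psi> z)"
          using True phi psi_nonneg by (intro mult_left_mono mult_mono) (auto simp: max_1_square_le_wt wt_pos less_imp_le)
        finally show ?thesis
          using E by (simp add: kt mult.assoc)
      qed
      then show "case p of (x, y, z) \<Rightarrow> K' (x + z) y z + K' (x - z) y z \<le> 2 * K' x y z + z\<^sup>2 * wt y * \<psi> z"
        by (simp add: p)
    qed
  qed
  show ?thesis
  proof
    show "(\<lambda>(x, y, z). K' x y z) \<in> borel_measurable (borel \<Otimes>\<^sub>M borel \<Otimes>\<^sub>M borel)"
      unfolding K'_def split_beta' by measurable
    show "0 \<le> K' x y z" "K' x y z \<noteq> 0 \<Longrightarrow> 0 \<le> z \<and> z \<le> x \<and> z \<le> y" "K' x y z \<le> wt x * wt y * \<psi> z" for x y z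
      using bound_nonneg[of x y z] by (auto simp: K'_def split: if_splits)
    show "AE x in lborel. AE y in lborel. AE z in lborel.
      K' (x + z) y z + K' (x - z) y z \<le> 2 * K' x y z + z\<^sup>2 * wt y * \<psi> z"
      using AE_lborel_triple[OF second] by simp
    show "AE p in lborel. p \<in> ?S \<longrightarrow>
      K (fst p) (fst (snd p)) (snd (snd p)) = K' (fst p) (fst (snd p)) (snd (snd p))"
      by (rule eq)
  qed
qed

lemma octant_lebesgue: "\<real>\<^sub>+ \<times> \<real>\<^sub>+ \<times> (\<real>\<^sub>+ :: real set) \<in> sets lebesgue"
  by (intro closed_lebesgue closed_Times) auto

lemma exchange_domain_lebesgue: "exchange_domain \<in> sets lebesgue"
proof -
  have "exchange_domain = {p. 0 \<le> fst p} \<inter> {p. 0 \<le> fst (snd p)} \<inter> {p. 0 \<le> snd (snd p)} \<inter>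
      {p. snd (snd p) \<le> fst p} \<inter> {p. snd (snd p) \<le> fst (snd p)}"
    by (auto simp: exchange_domain_def)
  moreover have "closed \<dots>"
    by (intro closed_Int closed_Collect_le continuous_intros)
  ultimately show ?thesis
    by (simp add: closed_lebesgue)
qed

text \<open>The shift by \<open>M\<close> makes the function nonnegative and changes neither side of
  the weak form: a constant has second difference 0, and the mass is conserved.\<close>

lemma ex_borel_test_function:
  assumes "f \<in> L_infinity"
  obtains F :: "real \<Rightarrow> real" and M where "F \<in> borel_measurable borel" "\<And>x. 0 \<le> F x" "\<And>x. F x \<le> 2 * M"
    "AE x in lborel. 0 \<le> x \<longrightarrow> f x = F x - M"
proof -
  have S: "\<real>\<^sub>+ \<in> sets lebesgue"
    by simp
  obtain C where f: "f \<in> borel_measurable (lebesgue_on \<real>\<^sub>+)" and C: "AE x in lborel. x \<in> \<real>\<^sub>+ \<longrightarrow> \<bar>f x\<bar> \<le> C"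
    using assms unfolding L_infinity_def AE_lebesgue_on_iff[OF S] by auto
  have "(\<lambda>x. if x \<in> \<real>\<^sub>+ then f x else 0) \<in> borel_measurable lebesgue"
    using f by (subst borel_measurable_if[OF S])
  then obtain g where [measurable]: "g \<in> borel_measurable borel" and g: "AE x in lborel. (if x \<in> \<real>\<^sub>+ then f x else 0) = g x"
    using completion_ex_borel_measurable_real by force
  define M where "M = max 0 C"
  show ?thesis
  proof
    show "(\<lambda>x. max 0 (min (g x + M) (2 * M))) \<in> borel_measurable borel"
      by measurable
    show "0 \<le> max 0 (min (g x + M) (2 * M))" "max 0 (min (g x + M) (2 * M)) \<le> 2 * M" for x
      by (auto simp: M_def)
    show "AE x in lborel. 0 \<le> x \<longrightarrow> f x = max 0 (min (g x + M) (2 * M)) - M"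
      using g C by eventually_elim (auto simp: M_def max_def min_def)
  qed
qed

section \<open>The limit solves the equation with the original kernel\<close>

context exchange_limit
begin

lemma nn_integral_triple:
  assumes s: "0 \<le> s" "s < horizon" and g_meas [measurable]: "case_prod g \<in> borel_measurable (borel \<Otimes>\<^sub>M borel)"
    and g: "\<And>x z. 0 \<le> g x z" "\<And>x z. g x z \<le> C"
  shows "(\<integral>\<^sup>+ p. ennreal (case p of (x, y, z) \<Rightarrow> g x z * (K x y z * c s x * c s y)) \<partial>lborel) = ennreal (limit_flux g s)"
proof -
  have "(\<integral>\<^sup>+ p. ennreal (case p of (x, y, z) \<Rightarrow> g x z * (K x y z * c s x * c s y)) \<partial>lborel) =
      (\<integral>\<^sup>+ x. \<integral>\<^sup>+ y. \<integral>\<^sup>+ z. ennreal (g x z * (K x y z * c s x * c s y)) \<partial>lborel \<partial>lborel \<partial>lborel)"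
    by (subst nn_integral_lborel_triple) (simp_all add: split_beta' borel_prod[symmetric])
  also have "\<dots> = (\<integral>\<^sup>+ x. \<integral>\<^sup>+ z. \<integral>\<^sup>+ y. ennreal (g x z * (K x y z * c s x * c s y)) \<partial>lborel \<partial>lborel \<partial>lborel)"
    by (intro nn_integral_cong lborel_pair.Fubini') measurable
  also have "\<dots> = (\<integral>\<^sup>+ x. \<integral>\<^sup>+ z. (\<integral>\<^sup>+ y. ennreal (K x y z) * ennreal (c s y) \<partial>lborel) * ennreal (c s x) * ennreal (g x z) \<partial>lborel \<partial>lborel)"
  proof (intro nn_integral_cong)
    fix x z
    have "(\<integral>\<^sup>+ y. ennreal (K x y z) * ennreal (c s y) \<partial>lborel) * (ennreal (c s x) * ennreal (g x z)) =
        (\<integral>\<^sup>+ y. ennreal (K x y z) * ennreal (c s y) * (ennreal (c s x) * ennreal (g x z)) \<partial>lborel)"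
      by (rule nn_integral_multc[symmetric]) measurable
    then show "(\<integral>\<^sup>+ y. ennreal (g x z * (K x y z * c s x * c s y)) \<partial>lborel) =
        (\<integral>\<^sup>+ y. ennreal (K x y z) * ennreal (c s y) \<partial>lborel) * ennreal (c s x) * ennreal (g x z)"
      using g K_nonneg c_nonneg by (simp add: ennreal_mult mult_ac)
  qed
  also have "\<dots> = ennreal (limit_flux g s)"
    by (rule nn_limit_flux[OF g_meas g s])
  finally show ?thesis .
qed

lemma integral_triple:
  assumes s: "0 \<le> s" "s < horizon" and g_meas [measurable]: "case_prod g \<in> borel_measurable (borel \<Otimes>\<^sub>M borel)"
    and g: "\<And>x z. 0 \<le> g x z" "\<And>x z. g x z \<le> C"
  shows "integrable lborel (\<lambda>(x, y, z). g x z * (K x y z * c s x * c s y))"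
    and "(\<integral>p. (case p of (x, y, z) \<Rightarrow> g x z * (K x y z * c s x * c s y)) \<partial>lborel) = limit_flux g s"
proof -
  have meas: "(\<lambda>(x, y, z). g x z * (K x y z * c s x * c s y)) \<in> borel_measurable borel"
    by (simp add: split_beta' borel_prod[symmetric])
  have nonneg: "0 \<le> (case p of (x, y, z) \<Rightarrow> g x z * (K x y z * c s x * c s y))" for p
    using g K_nonneg c_nonneg by (auto split: prod.split)
  note nn = nn_integral_triple[OF s g_meas g]
  show "integrable lborel (\<lambda>(x, y, z). g x z * (K x y z * c s x * c s y))"
    using meas nonneg nn by (intro integrableI_nonneg) auto
  show "(\<integral>p. (case p of (x, y, z) \<Rightarrow> g x z * (K x y z * c s x * c s y)) \<partial>lborel) = limit_flux g s"
    using meas nonneg nn limit_flux_bounds(1)[OF g_meas g s] by (subst integral_eq_nn_integral) auto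
qed

context
  fixes K\<^sub>0 :: "real \<Rightarrow> real \<Rightarrow> real \<Rightarrow> real" and u :: "real \<Rightarrow> real"
  assumes K_eq: "AE p in lborel. p \<in> \<real>\<^sub>+ \<times> \<real>\<^sub>+ \<times> \<real>\<^sub>+ \<longrightarrow>
      K\<^sub>0 (fst p) (fst (snd p)) (snd (snd p)) = K (fst p) (fst (snd p)) (snd (snd p))"
    and u: "u \<in> Y_cone 0 2" and u_eq: "AE x in lborel. 0 \<le> x \<longrightarrow> u x = c0 x"
begin

lemma kappa_finite:
  assumes s: "0 \<le> s" "s < horizon"
  shows "(\<integral>\<^sup>+ (x, y, z). ennreal (\<kappa> K\<^sub>0 (c s) x y z) \<partial>lebesgue_on (\<real>\<^sub>+ \<times> \<real>\<^sub>+ \<times> \<real>\<^sub>+)) \<le> ennreal (phi_norm * bound\<^sup>2)"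
proof -
  have "(\<integral>\<^sup>+ p. ennreal (case p of (x, y, z) \<Rightarrow> \<kappa> K\<^sub>0 (c s) x y z) \<partial>lebesgue_on (\<real>\<^sub>+ \<times> \<real>\<^sub>+ \<times> \<real>\<^sub>+)) =
      (\<integral>\<^sup>+ p. ennreal (case p of (x, y, z) \<Rightarrow> 1 * (K x y z * c s x * c s y)) \<partial>lborel)"
  proof (rule lebesgue_on_eq_lborel(3)[OF octant_lebesgue])
    show "(\<lambda>(x, y, z). 1 * (K x y z * c s x * c s y)) \<in> borel_measurable borel"
      by (simp add: split_beta' borel_prod[symmetric])
    show "(case p of (x, y, z) \<Rightarrow> 1 * (K x y z * c s x * c s y)) = 0" if "p \<notin> \<real>\<^sub>+ \<times> \<real>\<^sub>+ \<times> \<real>\<^sub>+" for p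
      using that K_support by (cases p) force
    show "AE p in lborel. p \<in> \<real>\<^sub>+ \<times> \<real>\<^sub>+ \<times> \<real>\<^sub>+ \<longrightarrow>
        (case p of (x, y, z) \<Rightarrow> \<kappa> K\<^sub>0 (c s) x y z) = (case p of (x, y, z) \<Rightarrow> 1 * (K x y z * c s x * c s y))"
      using K_eq by eventually_elim (auto simp: \<kappa>_def split_beta')
  qed
  also have "\<dots> = ennreal (limit_flux (\<lambda>_ _. 1) s)"
    by (rule nn_integral_triple[OF s, of _ 1]) auto
  also have "\<dots> \<le> ennreal (phi_norm * bound\<^sup>2)"
    using limit_flux_bounds(2)[of "\<lambda>_ _. 1" 1 s] s by (intro ennreal_leI) auto
  finally show ?thesis
    by (simp add: split_beta')
qed

text \<open>The Borel kernel vanishes outside the exchange domain, so gain and loss may be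
  integrated over the whole space, each with a finite integral. The constant \<open>M\<close>
  cancels in the second difference.\<close>

lemma second_difference_integral:
  assumes s: "0 \<le> s" "s < horizon" and [measurable]: "F \<in> borel_measurable borel"
    and F: "\<And>x. 0 \<le> F x" "\<And>x. F x \<le> 2 * M" and f: "AE x in lborel. 0 \<le> x \<longrightarrow> f x = F x - M"
  shows "(\<integral>(x, y, z). second_difference z f x * \<kappa> K\<^sub>0 (c s) x y z \<partial>lebesgue_on exchange_domain) =
    limit_flux (\<lambda>x z. F (x + z) + F (x - z)) s - limit_flux (\<lambda>x z. 2 * F x) s"
proof -
  let ?in = "\<lambda>x z. F (x + z) + F (x - z)" and ?out = "\<lambda>x z. 2 * F x"
  let ?I = "\<lambda>g p. case p of (x, y, z) \<Rightarrow> g x z * (K x y z * c s x * c s y)"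
  have in_le: "?in x z \<le> 4 * M" for x z
    using F(2)[of "x + z"] F(2)[of "x - z"] by simp
  have out_le: "?out x z \<le> 4 * M" for x z
    using F(2)[of x] by simp
  have f1: "AE p in (lborel :: (real \<times> real \<times> real) measure). 0 \<le> fst p \<longrightarrow> f (fst p) = F (fst p) - M"
    by (rule AE_lborel_fst[OF f])
  have "(\<integral>p. (case p of (x, y, z) \<Rightarrow> second_difference z f x * \<kappa> K\<^sub>0 (c s) x y z) \<partial>lebesgue_on exchange_domain) =
      (\<integral>p. ?I ?in p - ?I ?out p \<partial>lborel)"
  proof (rule lebesgue_on_eq_lborel(2)[OF exchange_domain_lebesgue])
    show "(\<lambda>p. ?I ?in p - ?I ?out p) \<in> borel_measurable borel"
      by (simp add: split_beta' borel_prod[symmetric])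
    show "?I ?in p - ?I ?out p = 0" if "p \<notin> exchange_domain" for p
      using that K_support by (cases p) (force simp: exchange_domain_def)
    show "AE p in lborel. p \<in> exchange_domain \<longrightarrow>
        (case p of (x, y, z) \<Rightarrow> second_difference z f x * \<kappa> K\<^sub>0 (c s) x y z) = ?I ?in p - ?I ?out p"
      using K_eq f1 AE_triple_shear[OF f1, of 1] AE_triple_shear[OF f1, of "-1"]
    proof eventually_elim
      fix p :: "real \<times> real \<times> real"
      obtain x y z where p: "p = (x, y, z)"
        by (cases p)
      assume "p \<in> \<real>\<^sub>+ \<times> \<real>\<^sub>+ \<times> \<real>\<^sub>+ \<longrightarrow> K\<^sub>0 (fst p) (fst (snd p)) (snd (snd p)) = K (fst p) (fst (snd p)) (snd (snd p))"
        "0 \<le> fst p \<longrightarrow> f (fst p) = F (fst p) - M"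
        "0 \<le> fst p + 1 * snd (snd p) \<longrightarrow> f (fst p + 1 * snd (snd p)) = F (fst p + 1 * snd (snd p)) - M"
        "0 \<le> fst p + - 1 * snd (snd p) \<longrightarrow> f (fst p + - 1 * snd (snd p)) = F (fst p + - 1 * snd (snd p)) - M"
      then have *: "0 \<le> x \<Longrightarrow> 0 \<le> y \<Longrightarrow> 0 \<le> z \<Longrightarrow> K\<^sub>0 x y z = K x y z"
          "0 \<le> x \<Longrightarrow> f x = F x - M" "0 \<le> x + z \<Longrightarrow> f (x + z) = F (x + z) - M"
          "0 \<le> x - z \<Longrightarrow> f (x - z) = F (x - z) - M"
        by (simp_all add: p)
      show "p \<in> exchange_domain \<longrightarrow>
          (case p of (x, y, z) \<Rightarrow> second_difference z f x * \<kappa> K\<^sub>0 (c s) x y z) = ?I ?in p - ?I ?out p"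
      proof
        assume "p \<in> exchange_domain"
        then have "0 \<le> x" "0 \<le> y" "0 \<le> z" "0 \<le> x + z" "0 \<le> x - z"
          by (auto simp: p exchange_domain_def)
        then show "(case p of (x, y, z) \<Rightarrow> second_difference z f x * \<kappa> K\<^sub>0 (c s) x y z) = ?I ?in p - ?I ?out p"
          using * by (simp add: p second_difference_def \<kappa>_def) (simp add: algebra_simps)
      qed
    qed
  qed
  also have "\<dots> = (\<integral>p. ?I ?in p \<partial>lborel) - (\<integral>p. ?I ?out p \<partial>lborel)"
    using F by (intro Bochner_Integration.integral_diff integral_triple(1)[OF s _ _ in_le] integral_triple(1)[OF s _ _ out_le])
      (auto intro: add_nonneg_nonneg)
  also have "(\<integral>p. ?I ?in p \<partial>lborel) = limit_flux ?in s"
    by (rule integral_triple(2)[OF s _ _ in_le]) (use F in \<open>auto intro: add_nonneg_nonneg\<close>)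
  also have "(\<integral>p. ?I ?out p \<partial>lborel) = limit_flux ?out s"
    by (rule integral_triple(2)[OF s _ _ out_le]) (use F in auto)
  finally show ?thesis
    by (simp add: split_beta')
qed

lemma c_half_line:
  assumes t: "0 \<le> t" "t < horizon"
  shows "c t \<in> Y_cone 0 2" "Y_norm 0 2 (c t) \<le> bound" "moment 1 (c t) = moment 1 u"
proof -
  note density = half_line_density[of "c t" "c t", OF measurable_c c_nonneg c_negative]
  show "c t \<in> Y_cone 0 2"
    using wt_c_integrable(1)[OF t] by (simp add: density)
  show "Y_norm 0 2 (c t) \<le> bound"
    using wt_c_integrable(2)[OF t] by (simp add: density)
  show "moment 1 (c t) = moment 1 u"
    using first_moment_conserved[OF t]
    by (simp add: density half_line_density(4)[OF c0_measurable c0_nonneg c0_negative u_eq])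
qed

lemma weak_solution_limit: "weak_solution K\<^sub>0 0 2 (ereal horizon) u c"
  unfolding weak_solution_def
proof (intro conjI ballI)
  have T: "t \<in> time_interval (ereal horizon) \<longleftrightarrow> 0 \<le> t \<and> t < horizon" for t
    by (simp add: time_interval_def)
  have S: "\<real>\<^sub>+ \<in> sets lebesgue"
    by simp
  show "0 < ereal horizon"
    using horizon_pos by simp
  show "u \<in> Y_cone 0 2"
    by (rule u)
  show "c t \<in> Y_cone 0 2" if "t \<in> time_interval (ereal horizon)" for t
    using that c_half_line by (simp add: T)
  show "AE x in lebesgue_on \<real>\<^sub>+. c 0 x = u x"
    unfolding AE_lebesgue_on_iff[OF S] c_0 using u_eq by eventually_elim auto
  show "\<exists>B. AE t in lebesgue_on (time_interval (ereal horizon)). Y_norm 0 2 (c t) \<le> B"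
  proof (intro exI[of _ bound] AE_I2)
    fix t assume "t \<in> space (lebesgue_on (time_interval (ereal horizon)))"
    then show "Y_norm 0 2 (c t) \<le> bound"
      using c_half_line by (simp add: T)
  qed
  show "((\<lambda>s. LINT x|lebesgue_on \<real>\<^sub>+. \<bar>c s x - c t x\<bar>) \<longlongrightarrow> 0) (at t within time_interval (ereal horizon))"
    if t: "t \<in> time_interval (ereal horizon)" for t
  proof (rule Lim_null_comparison)
    show "\<forall>\<^sub>F s in at t within time_interval (ereal horizon).
        norm (LINT x|lebesgue_on \<real>\<^sub>+. \<bar>c s x - c t x\<bar>) \<le> \<bar>s - t\<bar> * (4 * phi_norm * bound\<^sup>2)"
    proof (rule eventually_at_topological[THEN iffD2], intro exI[of _ UNIV] conjI ballI impI)
      fix s assume s: "s \<in> time_interval (ereal horizon)"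
      have "(LINT x|lebesgue_on \<real>\<^sub>+. \<bar>c s x - c t x\<bar>) = (\<integral>x. \<bar>c s x - c t x\<bar> \<partial>lborel)"
        by (rule lebesgue_on_eq_lborel(2)[OF S]) (auto simp: c_negative)
      also have "\<dots> \<le> \<bar>s - t\<bar> * (4 * phi_norm * bound\<^sup>2)"
        using s t by (intro c_close) (auto simp: T)
      finally show "norm (LINT x|lebesgue_on \<real>\<^sub>+. \<bar>c s x - c t x\<bar>) \<le> \<bar>s - t\<bar> * (4 * phi_norm * bound\<^sup>2)"
        by (simp add: integral_nonneg_AE)
    qed auto
    have "((\<lambda>s. \<bar>s - t\<bar> * (4 * phi_norm * bound\<^sup>2)) \<longlongrightarrow> \<bar>t - t\<bar> * (4 * phi_norm * bound\<^sup>2))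
        (at t within time_interval (ereal horizon))"
      by (intro tendsto_intros)
    then show "((\<lambda>s. \<bar>s - t\<bar> * (4 * phi_norm * bound\<^sup>2)) \<longlongrightarrow> 0) (at t within time_interval (ereal horizon))"
      by simp
  qed
  fix t assume "t \<in> time_interval (ereal horizon)"
  then have t: "0 \<le> t" "t < horizon"
    by (simp_all add: T)
  \<comment> \<open>The inner integral is bounded uniformly in s, and [0, t] has finite
    length.\<close>
  show "(\<integral>\<^sup>+ s. (\<integral>\<^sup>+ (x, y, z). ennreal (\<kappa> K\<^sub>0 (c s) x y z) \<partial>lebesgue_on (\<real>\<^sub>+ \<times> \<real>\<^sub>+ \<times> \<real>\<^sub>+))
      \<partial>lebesgue_on {0..t}) < \<infinity>"
  proof -
    have "(\<integral>\<^sup>+ s. (\<integral>\<^sup>+ (x, y, z). ennreal (\<kappa> K\<^sub>0 (c s) x y z) \<partial>lebesgue_on (\<real>\<^sub>+ \<times> \<real>\<^sub>+ \<times> \<real>\<^sub>+))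
        \<partial>lebesgue_on {0..t}) \<le> (\<integral>\<^sup>+ s. ennreal (phi_norm * bound\<^sup>2) \<partial>lebesgue_on {0..t})"
      using t by (intro nn_integral_mono kappa_finite) auto
    also have "\<dots> < \<infinity>"
      using t by (simp add: emeasure_restrict_space ennreal_mult_less_top)
    finally show ?thesis .
  qed
  fix f assume "f \<in> L_infinity"
  then obtain F M where [measurable]: "F \<in> borel_measurable borel" and F: "\<And>x. 0 \<le> F x" "\<And>x. F x \<le> 2 * M"
    and fF: "AE x in lborel. 0 \<le> x \<longrightarrow> f x = F x - M"
    by (rule ex_borel_test_function) (rule that)
  have "0 \<le> M"
    using order_trans[OF F(1) F(2)] by auto
  have F_wt: "\<bar>F x\<bar> \<le> (2 * M) * wt x" "\<bar>M\<bar> \<le> M * wt x" for x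
    using F[of x] mult_left_mono[OF wt_ge_1[of x] \<open>0 \<le> M\<close>] \<open>0 \<le> M\<close> by auto
  note int = integrable_c[OF t _ F_wt(1)] integrable_c[OF t _ F_wt(2)]
    integrable_c[OF _ horizon_pos _ F_wt(1)] integrable_c[OF _ horizon_pos _ F_wt(2)]
  have "(LINT x|lebesgue_on \<real>\<^sub>+. f x * (c t x - u x)) = (\<integral>x. (F x - M) * (c t x - c0 x) \<partial>lborel)"
  proof (rule lebesgue_on_eq_lborel(2)[OF S])
    show "AE x in lborel. x \<in> \<real>\<^sub>+ \<longrightarrow> f x * (c t x - u x) = (F x - M) * (c t x - c0 x)"
      using fF u_eq by eventually_elim auto
  qed (auto simp: c_negative c0_negative)
  also have "\<dots> = (\<integral>x. (F x * c t x - M * c t x) - (F x * c0 x - M * c0 x) \<partial>lborel)"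
    by (simp add: algebra_simps)
  also have "\<dots> = (\<integral>x. F x * c t x \<partial>lborel) - (\<integral>x. M * c t x \<partial>lborel) - ((\<integral>x. F x * c0 x \<partial>lborel) - (\<integral>x. M * c0 x \<partial>lborel))"
    using int by (simp add: c_0 del: integrable_mult_right_iff Bochner_Integration.integral_mult_right_zero)
  \<comment> \<open>Conservation of mass removes the two terms with \<open>M\<close>.\<close>
  also have "\<dots> = (\<integral>x. F x * c t x \<partial>lborel) - (\<integral>x. F x * c0 x \<partial>lborel)"
    using mass_conserved[OF t] by simp
  also have "\<dots> = (\<integral>s. limit_flux (\<lambda>x z. F (x + z) + F (x - z)) s \<partial>lebesgue_on {0..t}) -
      (\<integral>s. limit_flux (\<lambda>x z. 2 * F x) s \<partial>lebesgue_on {0..t})"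
    using weak_form[OF t _ F] by simp
  also have "\<dots> = (\<integral>s. limit_flux (\<lambda>x z. F (x + z) + F (x - z)) s - limit_flux (\<lambda>x z. 2 * F x) s \<partial>lebesgue_on {0..t})"
  proof (rule Bochner_Integration.integral_diff[symmetric])
    have le: "F (x + z) + F (x - z) \<le> 4 * M" "2 * F x \<le> 4 * M" for x z
      using F(2)[of "x + z"] F(2)[of "x - z"] F(2)[of x] by simp_all
    show "integrable (lebesgue_on {0..t}) (limit_flux (\<lambda>x z. F (x + z) + F (x - z)))"
      by (rule flux_time_integral(1)[OF _ _ le(1) t]) (simp_all add: F add_nonneg_nonneg)
    show "integrable (lebesgue_on {0..t}) (limit_flux (\<lambda>x z. 2 * F x))"
      by (rule flux_time_integral(1)[OF _ _ le(2) t]) (simp_all add: F)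
  qed
  also have "\<dots> = (LINT s|lebesgue_on {0..t}. (LINT (x, y, z)|lebesgue_on exchange_domain.
      second_difference z f x * \<kappa> K\<^sub>0 (c s) x y z))"
  proof (rule Bochner_Integration.integral_cong[OF refl])
    fix s assume "s \<in> space (lebesgue_on {0..t})"
    then have "0 \<le> s" "s < horizon"
      using t by auto
    then show "limit_flux (\<lambda>x z. F (x + z) + F (x - z)) s - limit_flux (\<lambda>x z. 2 * F x) s =
        (LINT (x, y, z)|lebesgue_on exchange_domain. second_difference z f x * \<kappa> K\<^sub>0 (c s) x y z)"
      using second_difference_integral[OF _ _ _ F fF] by simp
  qed
  finally show "(LINT x|lebesgue_on \<real>\<^sub>+. f x * (c t x - u x)) =
      (LINT s|lebesgue_on {0..t}. (LINT (x, y, z)|lebesgue_on exchange_domain.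
        second_difference z f x * \<kappa> K\<^sub>0 (c s) x y z))" .
qed

end

end

section \<open>The degenerate case and the conclusion\<close>

lemma wt_integral_eq_zero_iff:
  assumes [measurable]: "c' \<in> borel_measurable borel" and nonneg: "\<And>x. 0 \<le> c' x"
    and int: "integrable lborel (\<lambda>x. wt x * c' x)"
  shows "0 \<le> (\<integral>x. wt x * c' x \<partial>lborel)"
    and "(\<integral>x. wt x * c' x \<partial>lborel) = 0 \<longleftrightarrow> (AE x in lborel. c' x = 0)"
proof -
  have pos: "0 \<le> wt x * c' x" for x
    using nonneg[of x] wt_pos[of x] by simp
  then show "0 \<le> (\<integral>x. wt x * c' x \<partial>lborel)"
    by (intro integral_nonneg_AE) auto
  have "wt x \<noteq> 0" for x
    using wt_pos[of x] by simp
  then show "(\<integral>x. wt x * c' x \<partial>lborel) = 0 \<longleftrightarrow> (AE x in lborel. c' x = 0)"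
    using integral_nonneg_eq_0_iff_AE[OF int] pos by simp
qed

text \<open>If \<open>\<phi>\<close> vanishes almost everywhere, so does the kernel, and nothing
  moves: the constant solution is global, in accordance with the infinite value of
  \<open>existence_time\<close>.\<close>

lemma weak_solution_constant:
  assumes u: "u \<in> Y_cone 0 2"
    and K: "AE p in lborel. p \<in> \<real>\<^sub>+ \<times> \<real>\<^sub>+ \<times> \<real>\<^sub>+ \<longrightarrow> K (fst p) (fst (snd p)) (snd (snd p)) = 0"
  shows "weak_solution K 0 2 \<infinity> u (\<lambda>t. u)"
proof -
  have "AE p in lebesgue_on (\<real>\<^sub>+ \<times> \<real>\<^sub>+ \<times> \<real>\<^sub>+). (case p of (x, y, z) \<Rightarrow> ennreal (\<kappa> K u x y z)) = 0"
    unfolding AE_lebesgue_on_iff[OF octant_lebesgue] using K by eventually_elim (auto simp: \<kappa>_def split_beta')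
  then have zero1: "(\<integral>\<^sup>+ (x, y, z). ennreal (\<kappa> K u x y z) \<partial>lebesgue_on (\<real>\<^sub>+ \<times> \<real>\<^sub>+ \<times> \<real>\<^sub>+)) = 0"
    by (subst nn_integral_cong_AE[where v = "\<lambda>_. 0"]) auto
  have zero2: "(LINT (x, y, z)|lebesgue_on exchange_domain. second_difference z f x * \<kappa> K u x y z) = 0" for f
  proof (rule integral_eq_zero_AE)
    show "AE p in lebesgue_on exchange_domain. (case p of (x, y, z) \<Rightarrow> second_difference z f x * \<kappa> K u x y z) = 0"
      unfolding AE_lebesgue_on_iff[OF exchange_domain_lebesgue] using K
      by eventually_elim (auto simp: \<kappa>_def split_beta' exchange_domain_def)
  qed
  show ?thesis
    unfolding weak_solution_def zero1 zero2 using u by auto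
qed

theorem theorem1p14:
  fixes K K\<^sub>1 K\<^sub>2 :: "real \<Rightarrow> real \<Rightarrow> real \<Rightarrow> real"
    and \<phi> c\<^sub>0 :: "real \<Rightarrow> real"
  assumes K_measurable:
      "(\<lambda>(x, y, z). K x y z) \<in> borel_measurable (lebesgue_on (\<real>\<^sub>+ \<times> \<real>\<^sub>+ \<times> \<real>\<^sub>+))"
    and K_nonneg: "\<And>x y z. \<lbrakk>x \<ge> 0; y \<ge> 0; z \<ge> 0\<rbrakk> \<Longrightarrow> 0 \<le> K x y z"
    and K_sym: "\<And>x y z. \<lbrakk>x \<ge> 0; y \<ge> 0; z \<ge> 0\<rbrakk> \<Longrightarrow> K x y z = K y x z"
    and K_zero: "\<And>x y z. \<lbrakk>x \<ge> 0; y \<ge> 0; z \<ge> 0; z > x\<rbrakk> \<Longrightarrow> K x y z = 0"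
    and phi: "\<phi> \<in> Y_cone 0 2"
    and K_bound: "\<And>x y z. \<lbrakk>x \<ge> 0; y \<ge> 0; z \<ge> 0\<rbrakk>
      \<Longrightarrow> K x y z \<le> (max 1 x)\<^sup>2 * (max 1 y)\<^sup>2 * \<phi> z"
    and K_deriv1: "\<And>x y z. \<lbrakk>x \<ge> 0; y \<ge> 0; z \<ge> 0\<rbrakk>
      \<Longrightarrow> ((\<lambda>x. K x y z) has_real_derivative K\<^sub>1 x y z) (at x within \<real>\<^sub>+)"
    and K_deriv2: "\<And>x y z. \<lbrakk>x \<ge> 0; y \<ge> 0; z \<ge> 0\<rbrakk>
      \<Longrightarrow> ((\<lambda>x. K\<^sub>1 x y z) has_real_derivative K\<^sub>2 x y z) (at x within \<real>\<^sub>+)"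
    and K_deriv2_bound: "\<And>x y z. \<lbrakk>x \<ge> 0; y \<ge> 0; z \<ge> 0\<rbrakk>
      \<Longrightarrow> K\<^sub>2 x y z \<le> (max 1 y)\<^sup>2 * \<phi> z"
    and c0: "c\<^sub>0 \<in> Y_cone 0 2"
    and c0_nonzero: "\<not> (AE x in lebesgue_on \<real>\<^sub>+. c\<^sub>0 x = 0)"
  shows "\<exists>c. weak_solution K 0 2 (existence_time \<phi> c\<^sub>0) c\<^sub>0 c \<and>
     (\<forall>t \<in> time_interval (existence_time \<phi> c\<^sub>0). moment 1 (c t) = moment 1 c\<^sub>0)"
proof -
  obtain \<psi> where psi [measurable]: "\<psi> \<in> borel_measurable borel" and psi_nonneg: "\<And>z. 0 \<le> \<psi> z"
    and psi_negative: "\<And>z. z < 0 \<Longrightarrow> \<psi> z = 0" and psi_eq: "AE z in lborel. 0 \<le> z \<longrightarrow> \<phi> z = \<psi> z"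
    using ex_half_line_density[OF phi] by blast
  obtain d where d [measurable]: "d \<in> borel_measurable borel" and d_nonneg: "\<And>x. 0 \<le> d x"
    and d_negative: "\<And>x. x < 0 \<Longrightarrow> d x = 0" and d_eq: "AE x in lborel. 0 \<le> x \<longrightarrow> c\<^sub>0 x = d x"
    using ex_half_line_density[OF c0] by blast
  note psi_density = half_line_density[OF psi psi_nonneg psi_negative psi_eq]
  note d_density = half_line_density[OF d d_nonneg d_negative d_eq]
  have psi_int: "integrable lborel (\<lambda>z. wt z * \<psi> z)" and d_int: "integrable lborel (\<lambda>x. wt x * d x)"
    using phi c0 psi_density(1) d_density(1) by auto
  obtain K' where K': "(\<lambda>(x, y, z). K' x y z) \<in> borel_measurable (borel \<Otimes>\<^sub>M borel \<Otimes>\<^sub>M borel)"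
    "\<And>x y z. 0 \<le> K' x y z" "\<And>x y z. K' x y z \<noteq> 0 \<Longrightarrow> 0 \<le> z \<and> z \<le> x \<and> z \<le> y"
    "\<And>x y z. K' x y z \<le> wt x * wt y * \<psi> z"
    "AE x in lborel. AE y in lborel. AE z in lborel.
      K' (x + z) y z + K' (x - z) y z \<le> 2 * K' x y z + z\<^sup>2 * wt y * \<psi> z"
    "AE p in lborel. p \<in> \<real>\<^sub>+ \<times> \<real>\<^sub>+ \<times> \<real>\<^sub>+ \<longrightarrow>
      K (fst p) (fst (snd p)) (snd (snd p)) = K' (fst p) (fst (snd p)) (snd (snd p))"
    by (rule ex_borel_kernel[OF K_measurable K_nonneg K_sym K_zero K_bound K_deriv1 K_deriv2 K_deriv2_bound
        psi psi_nonneg psi_eq]) (assumption+, rule that)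
  have "\<not> (AE x in lborel. d x = 0)"
  proof
    assume "AE x in lborel. d x = 0"
    then have "AE x in lebesgue_on \<real>\<^sub>+. c\<^sub>0 x = 0"
      using d_eq by (subst AE_lebesgue_on_iff) (auto elim!: eventually_elim2)
    with c0_nonzero show False
      by contradiction
  qed
  then have d_pos: "0 < (\<integral>x. wt x * d x \<partial>lborel)"
    using wt_integral_eq_zero_iff[OF d d_nonneg d_int] by linarith
  show ?thesis
  proof (cases "Y_norm 0 2 \<phi> = 0")
    case True
    then have "AE z in lborel. \<psi> z = 0"
      using wt_integral_eq_zero_iff[OF psi psi_nonneg psi_int] by (simp add: psi_density)
    from K'(6) AE_triple_third[OF this]
    have "AE p in lborel. p \<in> \<real>\<^sub>+ \<times> \<real>\<^sub>+ \<times> \<real>\<^sub>+ \<longrightarrow> K (fst p) (fst (snd p)) (snd (snd p)) = 0"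
    proof eventually_elim
      fix p :: "real \<times> real \<times> real"
      assume "p \<in> \<real>\<^sub>+ \<times> \<real>\<^sub>+ \<times> \<real>\<^sub>+ \<longrightarrow> K (fst p) (fst (snd p)) (snd (snd p)) = K' (fst p) (fst (snd p)) (snd (snd p))"
        and "\<psi> (snd (snd p)) = 0"
      then show "p \<in> \<real>\<^sub>+ \<times> \<real>\<^sub>+ \<times> \<real>\<^sub>+ \<longrightarrow> K (fst p) (fst (snd p)) (snd (snd p)) = 0"
        using K'(2,4)[of "fst p" "fst (snd p)" "snd (snd p)"] by simp
    qed
    then have "weak_solution K 0 2 \<infinity> c\<^sub>0 (\<lambda>t. c\<^sub>0)"
      by (rule weak_solution_constant[OF c0])
    with True show ?thesis
      by (auto simp: existence_time_def)
  next
    case False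
    have "0 \<le> (\<integral>z. \<psi> z \<partial>lborel)"
      using psi_nonneg by (intro integral_nonneg_AE) auto
    \<comment> \<open>The norm of \<open>\<phi>\<close> and the plain integral of
      \<open>\<psi>\<close> vanish together, since each being 0 means that \<open>\<psi>\<close> is
      null.\<close>
    moreover have "(\<integral>z. \<psi> z \<partial>lborel) \<noteq> 0"
    proof
      have "integrable lborel \<psi>"
        using phi psi_density(6) by (simp add: Y_cone_def Y_space_def)
      moreover assume "(\<integral>z. \<psi> z \<partial>lborel) = 0"
      ultimately have "AE z in lborel. \<psi> z = 0"
        using integral_nonneg_eq_0_iff_AE[of lborel \<psi>] psi_nonneg by simp
      with False show False
        using wt_integral_eq_zero_iff[OF psi psi_nonneg psi_int] by (simp add: psi_density)
    qed
    ultimately have psi_pos: "0 < (\<integral>z. \<psi> z \<partial>lborel)"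
      by linarith
    interpret exchange_data K' \<psi> d
      by (unfold_locales; fact)
    obtain \<sigma> e where "exchange_limit K' \<psi> d \<sigma> e"
      using ex_exchange_limit by blast
    then interpret exchange_limit K' \<psi> d \<sigma> e .
    \<comment> \<open>With this splitting of the weight, \<open>existence_time\<close> becomes the
      \<open>horizon\<close> of the scheme.\<close>
    have "moment 0 c\<^sub>0 + moment 2 c\<^sub>0 = wt_mass"
    proof -
      have "integrable lborel d"
        using c0 d_density(6) by (simp add: Y_cone_def Y_space_def)
      moreover from Bochner_Integration.integrable_diff[OF d_int this]
      have "integrable lborel (\<lambda>x. x\<^sup>2 * d x)"
        by (simp add: wt_def algebra_simps)
      ultimately have "(\<integral>x. d x + x\<^sup>2 * d x \<partial>lborel) = (\<integral>x. d x \<partial>lborel) + (\<integral>x. x\<^sup>2 * d x \<partial>lborel)"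
        by (rule Bochner_Integration.integral_add)
      then show ?thesis
        by (simp add: d_density wt_mass_def wt_def distrib_right)
    qed
    then have T: "existence_time \<phi> c\<^sub>0 = ereal horizon"
      using False by (simp add: existence_time_def horizon_def phi_norm_def psi_density inverse_eq_divide)
    have "weak_solution K 0 2 (existence_time \<phi> c\<^sub>0) c\<^sub>0 c"
      unfolding T by (rule weak_solution_limit[OF K'(6) c0 d_eq])
    moreover have "moment 1 (c t) = moment 1 c\<^sub>0" if "t \<in> time_interval (existence_time \<phi> c\<^sub>0)" for t
      using that c_half_line(3)[OF K'(6) c0 d_eq, of t] by (simp add: T time_interval_def)
    ultimately show ?thesis
      by blast
  qed
qed

end
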